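(* There exist infinitely many hyperelliptic curves of genus $4$ over $\mathbb{Q}$ whose Jacobians possess a $\mathbb{Q}$-rational point of order $15$.
   Context: A hyperelliptic curve of genus $g$ over $\mathbb{Q}$ is a smooth projective curve given by $y^2=f(x)$ with $f\in\mathbb{Q}[x]$ squarefree of degree $2g+1$ or $2g+2$; its Jacobian is the Jacobian variety over $\mathbb{Q}$. *)

theory Defs
  imports
    "HOL-Algebra.Algebraic_Closure_Type"
    "HOL-Algebra.Free_Abelian_Groups"
    "HOL-Algebra.Multiplicative_Group"
    "HOL-Computational_Algebra.Polynomial_Factorial"
    "HOL-Computational_Algebra.Squarefree"
begin

type_synonym qbar = "rat alg_closure"

definition hyperelliptic :: "nat \<Rightarrow> rat poly \<Rightarrow> bool" where
  "hyperelliptic g f \<longleftrightarrow>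
     squarefree f \<and> Polynomial.degree f \<in> {2 * g + 1, 2 * g + 2}"

abbreviation geom :: "rat poly \<Rightarrow> qbar poly" where
  "geom f \<equiv> map_poly to_ac f"

text \<open>
  The smooth projective curve of genus \<open>g\<close> given by \<open>y^2 = f(x)\<close> is covered by two affine
  charts: \<open>y^2 = f(x)\<close> and, with \<open>u = 1/x\<close> and \<open>v = y/x^(g+1)\<close>, the curve
  \<open>v^2 = u^(2g+2) f(1/u)\<close>.  The points missed by the first chart are those with \<open>u = 0\<close>, where
  the second equation reads \<open>v^2 =\<close> (coefficient of \<open>x^(2g+2)\<close> in \<open>f\<close>): there is one such point
  if \<open>deg f = 2g+1\<close>, and there are two if \<open>deg f = 2g+2\<close>.
\<close>

datatype point =
    Fin qbar qbar  \<comment> \<open>coordinates \<open>(x, y)\<close>\<close>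
  | Inf qbar       \<comment> \<open>coordinates \<open>(u, v) = (0, s)\<close>\<close>

definition points :: "nat \<Rightarrow> qbar poly \<Rightarrow> point set" where
  "points g f =
     {Fin x y | x y. y ^ 2 = poly f x} \<union> {Inf s | s. s ^ 2 = Polynomial.coeff f (2 * g + 2)}"


text \<open>
  The function field \<open>Qbar(x)[y]/(y^2 - f)\<close>; the pair \<open>(a, b)\<close> stands for \<open>a + b y\<close>.
\<close>

type_synonym rat_fun = "qbar poly fract \<times> qbar poly fract"

definition function_field :: "qbar poly \<Rightarrow> rat_fun ring" where
  "function_field f =
     \<lparr>carrier = UNIV,
      monoid.mult = (\<lambda>(a, b) (c, d). (a * c + b * d * to_fract f, a * d + b * c)),
      one = (1, 0),
      ring.zero = (0, 0),
      add = (\<lambda>(a, b) (c, d). (a + c, b + d))\<rparr>"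

definition at_inverse :: "qbar poly \<Rightarrow> qbar poly fract" where
  "at_inverse p = poly (map_poly (\<lambda>c. to_fract [:c:]) p) (inverse (to_fract [:0, 1:]))"

text \<open>
  The element \<open>a(x) + b(x) y\<close> (for a finite point) or \<open>a(u) + b(u) v\<close> (for a point at
  infinity) of the coordinate ring of the chosen affine chart around the point, first as an
  element of the function field and then as its value at the point.  Modulo the equation of the
  chart every polynomial in the two coordinates is of this form.
\<close>

fun chart_fun :: "nat \<Rightarrow> point \<Rightarrow> qbar poly \<Rightarrow> qbar poly \<Rightarrow> rat_fun" where
  "chart_fun g (Fin x0 y0) a b = (to_fract a, to_fract b)"
| "chart_fun g (Inf s) a b = (at_inverse a, at_inverse b / to_fract [:0, 1:] ^ (g + 1))"

fun chart_val :: "point \<Rightarrow> qbar poly \<Rightarrow> qbar poly \<Rightarrow> qbar" where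
  "chart_val (Fin x0 y0) a b = poly a x0 + poly b x0 * y0"
| "chart_val (Inf s) a b = poly a 0 + poly b 0 * s"

text \<open>
  \<open>has_value g f P h c\<close>: the rational function \<open>h\<close> is regular at \<open>P\<close> and \<open>h(P) = c\<close>, i.e.
  \<open>h = G/H\<close> with \<open>G\<close>, \<open>H\<close> in the coordinate ring of the chart, \<open>H(P)\<close> nonzero and
  \<open>c = G(P)/H(P)\<close>.
\<close>

definition has_value :: "nat \<Rightarrow> qbar poly \<Rightarrow> point \<Rightarrow> rat_fun \<Rightarrow> qbar \<Rightarrow> bool" where
  "has_value g f P h c \<longleftrightarrow>
     (\<exists>a b a' b'. chart_val P a' b' \<noteq> 0 \<and>
        h \<otimes>\<^bsub>function_field f\<^esub> chart_fun g P a' b' = chart_fun g P a b \<and>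
        c = chart_val P a b / chart_val P a' b')"

definition local_ring :: "nat \<Rightarrow> qbar poly \<Rightarrow> point \<Rightarrow> rat_fun set" where
  "local_ring g f P = {h. \<exists>c. has_value g f P h c}"

definition local_units :: "nat \<Rightarrow> qbar poly \<Rightarrow> point \<Rightarrow> rat_fun set" where
  "local_units g f P = {h. \<exists>c. c \<noteq> 0 \<and> has_value g f P h c}"

definition max_ideal :: "nat \<Rightarrow> qbar poly \<Rightarrow> point \<Rightarrow> rat_fun set" where
  "max_ideal g f P = {h. has_value g f P h 0}"

definition uniformizer :: "nat \<Rightarrow> qbar poly \<Rightarrow> point \<Rightarrow> rat_fun \<Rightarrow> bool" where
  "uniformizer g f P t \<longleftrightarrow>
     max_ideal g f P = (\<lambda>h. t \<otimes>\<^bsub>function_field f\<^esub> h) ` local_ring g f P"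

text \<open>
  \<open>has_order g f P h n\<close>: the valuation of \<open>h\<close> at \<open>P\<close> is \<open>n\<close>.  It never holds for \<open>h = 0\<close>.
\<close>

definition has_order :: "nat \<Rightarrow> qbar poly \<Rightarrow> point \<Rightarrow> rat_fun \<Rightarrow> int \<Rightarrow> bool" where
  "has_order g f P h n \<longleftrightarrow>
     (\<exists>t w. uniformizer g f P t \<and> w \<in> local_units g f P \<and>
        h = t [^]\<^bsub>function_field f\<^esub> n \<otimes>\<^bsub>function_field f\<^esub> w)"


definition divisor_degree :: "(point \<Rightarrow>\<^sub>0 int) \<Rightarrow> int" where
  "divisor_degree D = (\<Sum>P\<in>Poly_Mapping.keys D. Poly_Mapping.lookup D P)"

definition principal_divisors :: "nat \<Rightarrow> qbar poly \<Rightarrow> (point \<Rightarrow>\<^sub>0 int) set" where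
  "principal_divisors g f =
     {D. Poly_Mapping.keys D \<subseteq> points g f \<and>
         (\<exists>h. h \<noteq> \<zero>\<^bsub>function_field f\<^esub> \<and>
              (\<forall>P\<in>points g f. has_order g f P h (Poly_Mapping.lookup D P)))}"

definition Pic :: "nat \<Rightarrow> qbar poly \<Rightarrow> (point \<Rightarrow>\<^sub>0 int) set monoid" where
  "Pic g f = free_Abelian_group (points g f) Mod principal_divisors g f"

definition galois :: "(qbar \<Rightarrow> qbar) set" where
  "galois = {\<sigma>. bij \<sigma> \<and> (\<forall>a b. \<sigma> (a + b) = \<sigma> a + \<sigma> b) \<and> (\<forall>a b. \<sigma> (a * b) = \<sigma> a * \<sigma> b) \<and>
                (\<forall>q. \<sigma> (to_ac q) = to_ac q)}"

fun galois_point :: "(qbar \<Rightarrow> qbar) \<Rightarrow> point \<Rightarrow> point" where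
  "galois_point \<sigma> (Fin x y) = Fin (\<sigma> x) (\<sigma> y)"
| "galois_point \<sigma> (Inf s) = Inf (\<sigma> s)"

definition galois_divisor :: "(qbar \<Rightarrow> qbar) \<Rightarrow> (point \<Rightarrow>\<^sub>0 int) \<Rightarrow> (point \<Rightarrow>\<^sub>0 int)" where
  "galois_divisor \<sigma> = frag_extend (\<lambda>P. frag_of (galois_point \<sigma> P))"

text \<open>
  The group \<open>J(\<rat>)\<close> of rational points of the Jacobian \<open>J\<close>: the points of \<open>J\<close> over \<open>Qbar\<close> are
  the divisor classes of degree 0 of the curve over \<open>Qbar\<close>, and the rational points are those
  fixed by the absolute Galois group.  Invariance is required of the class, not of a divisor
  representing it.  Since principal divisors have degree 0, it does not matter which
  representative of the class is used for the degree.
\<close>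

definition jacobian_rational_points :: "nat \<Rightarrow> rat poly \<Rightarrow> (point \<Rightarrow>\<^sub>0 int) set monoid" where
  "jacobian_rational_points g f =
     Pic g (geom f)
       \<lparr>carrier := {c \<in> carrier (Pic g (geom f)).
                     (\<exists>D\<in>c. divisor_degree D = 0) \<and>
                     (\<forall>\<sigma>\<in>galois. galois_divisor \<sigma> ` c = c)}\<rparr>"


text \<open>
  A map of curves pulls back rational functions: each rational function \<open>h\<close> on the target has a
  rational function \<open>h'\<close> on the source that represents \<open>h \<circ> \<phi>\<close> and is regular wherever \<open>h\<close> is
  regular at the image.
\<close>

definition pulls_back :: "nat \<Rightarrow> qbar poly \<Rightarrow> qbar poly \<Rightarrow> (point \<Rightarrow> point) \<Rightarrow> bool" where
  "pulls_back g f1 f2 \<phi> \<longleftrightarrow>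
     (\<forall>h. \<exists>h'. \<forall>P\<in>points g f1. \<forall>c. has_value g f2 (\<phi> P) h c \<longrightarrow> has_value g f1 P h' c)"

text \<open>
  Isomorphism of curves over \<open>\<rat>\<close>: an isomorphism over \<open>Qbar\<close> is defined over \<open>\<rat>\<close> iff it commutes
  with the absolute Galois group.
\<close>

definition isomorphic_over_Q :: "nat \<Rightarrow> rat poly \<Rightarrow> rat poly \<Rightarrow> bool" where
  "isomorphic_over_Q g f1 f2 \<longleftrightarrow>
     (\<exists>\<phi>. bij_betw \<phi> (points g (geom f1)) (points g (geom f2)) \<and>
          pulls_back g (geom f1) (geom f2) \<phi> \<and>
          pulls_back g (geom f2) (geom f1) (inv_into (points g (geom f1)) \<phi>) \<and>
          (\<forall>\<sigma>\<in>galois. \<forall>P\<in>points g (geom f1).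
             \<phi> (galois_point \<sigma> P) = galois_point \<sigma> (\<phi> P)))"

end

theory Submission
  imports Defs "HOL-Library.Ramsey"
begin

text \<open>
  Truncate the binomial series \<open>(1 + x)^(15/2)\<close> after \<open>x^5\<close> and add \<open>l x^6\<close> to get a polynomial
  \<open>a\<close>; then \<open>f = (a^2 - (1 + x)^15) / x^6\<close> has degree 9, and \<open>a - x^3 y\<close> has divisor
  \<open>15 (P - \<infinity>)\<close> on \<open>y^2 = f\<close>, where \<open>P = (-1, -a(-1))\<close>.  A smaller multiple \<open>n (P - \<infinity>)\<close> with
  \<open>n \<le> 2g = 8\<close> is not principal: a function regular away from \<open>\<infinity>\<close> with so small a pole there is
  a polynomial in \<open>x\<close>, so it cannot vanish at \<open>P\<close> without vanishing at the conjugate point.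

  For an isomorphism of two of these curves, the preimage of \<open>\<infinity>\<close> is one of the finitely many
  Weierstrass points.  Two isomorphisms from the same curve with the same preimage of \<open>\<infinity>\<close> compose
  to one that fixes \<open>\<infinity>\<close>, hence to an affine substitution in \<open>x\<close>, and comparing the top four
  coefficients shows that the two targets are equal.  So every isomorphism class in the family is
  finite, and Ramsey's theorem yields infinitely many pairwise non-isomorphic curves.

  All computations take place in an algebraic closure of \<open>Qbar(x)\<close>, into which the function field of
  each curve embeds.  Instead of valuations, only the relation ``regular at \<open>P\<close> with value \<open>c\<close>''
  and the existence of local parameters are used.
\<close>

section \<open>Charts and local rings\<close>

text \<open>All zeros of \<open>a + b y\<close> fall on one point if its norm
  \<open>a^2 - b^2 f\<close> is \<open>(1 + x)^15\<close>. With \<open>b = - x^3\<close> this asks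
  for a square root of \<open>(1 + x)^15\<close> modulo \<open>x^6\<close>; it fixes the
  coefficients of \<open>a\<close> below \<open>x^6\<close> and leaves that of \<open>x^6\<close>
  free, whence the parameter \<open>l\<close>. As \<open>a\<close> has degree only 6,
  \<open>f\<close> has degree 15 - 6 = 2g + 1, so there is a single point at infinity, and it is
  rational. The pole there is that of \<open>x^3 y\<close>, of order 6 + 9 = 15. Among the
  multiples, only 3 and 5 have to be excluded, and both are at most 2g.

  No invariant is computed that separates the curves of the family. It is enough to bound each
  isomorphism class, and the bound is proved for isomorphisms over \<open>Qbar\<close>, which is
  stronger than over Q.

  Function fields are records that vary with \<open>f\<close>, whereas field arithmetic needs a
  type. An algebraic closure of Qbar(x) contains a square root of every \<open>f\<close>, so one
  type serves all curves; the price is to track which elements lie in the image of a given function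
  field.\<close>

type_synonym ambient = "qbar poly fract alg_closure"

section \<open>Constants, coordinate functions and substitution in the ambient field\<close>

definition kconst :: "qbar \<Rightarrow> ambient" where
  "kconst c = to_ac (to_fract [:c:])"

definition xgen :: ambient where
  "xgen = to_ac (to_fract [:0, 1:])"

definition ygen :: "qbar poly \<Rightarrow> ambient" where
  "ygen f = (SOME y. y ^ 2 = to_ac (to_fract f))"

text \<open>The argument is an arbitrary element because three cases occur: \<open>xgen\<close> in
  the finite chart, \<open>inverse xgen\<close> in the chart at infinity, and the image of x under a
  map of curves.\<close>

definition subst_at :: "ambient \<Rightarrow> qbar poly \<Rightarrow> ambient" where
  "subst_at x p = poly (map_poly kconst p) x"

lemma kconst_simps [simp]:
  "kconst 0 = 0" "kconst 1 = 1" "kconst (a + b) = kconst a + kconst b"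
  "kconst (- a) = - kconst a" "kconst (a - b) = kconst a - kconst b"
  "kconst (a * b) = kconst a * kconst b"
proof -
  show m: "kconst (a * b) = kconst a * kconst b" for a b
  proof -
    have "[:a * b:] = [:a:] * [:b:]" by simp
    then show ?thesis
      unfolding kconst_def by (simp only: to_fract_mult to_ac_mult)
  qed
  show "kconst 0 = 0" "kconst 1 = 1"
    by (simp_all add: kconst_def flip: one_pCons)
  show p: "kconst (a + b) = kconst a + kconst b"  for a b
    by (simp add: kconst_def flip: to_ac_add to_fract_add)
  show n: "kconst (- a) = - kconst a" for a
    by (simp add: kconst_def flip: to_ac_minus to_fract_uminus)
  show "kconst (a - b) = kconst a - kconst b"
    using p[of a "-b"] n[of b] by simp
qed

lemma kconst_eq_iff [simp]: "kconst a = kconst b \<longleftrightarrow> a = b"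
  by (simp add: kconst_def)

lemma kconst_eq_0_iff [simp]: "kconst a = 0 \<longleftrightarrow> a = 0"
  using kconst_eq_iff[of a 0] by (simp del: kconst_eq_iff)

lemma kconst_power [simp]: "kconst (a ^ n) = kconst a ^ n"
  by (induction n) simp_all

lemma subst_at_0 [simp]: "subst_at x 0 = 0"
  by (simp add: subst_at_def)

lemma subst_at_pCons [simp]: "subst_at x (pCons c p) = kconst c + x * subst_at x p"
  by (simp add: subst_at_def map_poly_pCons)

lemma subst_at_1 [simp]: "subst_at x 1 = 1"
  by (simp add: one_pCons)

lemma subst_at_add [simp]: "subst_at x (p + q) = subst_at x p + subst_at x q"
  by (induction p q rule: poly_induct2) (simp_all add: algebra_simps)

lemma subst_at_minus [simp]: "subst_at x (- p) = - subst_at x p"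
  by (induction p) (simp_all add: algebra_simps)

lemma subst_at_diff [simp]: "subst_at x (p - q) = subst_at x p - subst_at x q"
  using subst_at_add[of x p "- q"] by simp

lemma subst_at_smult [simp]: "subst_at x (smult c p) = kconst c * subst_at x p"
  by (induction p) (simp_all add: algebra_simps)

lemma subst_at_mult [simp]: "subst_at x (p * q) = subst_at x p * subst_at x q"
  by (induction p) (simp_all add: algebra_simps)

lemma subst_at_power [simp]: "subst_at x (p ^ n) = subst_at x p ^ n"
  by (induction n) simp_all

lemma subst_at_pcompose: "subst_at x (pcompose p q) = subst_at (subst_at x q) p"
  by (induction p) (simp_all add: pcompose_pCons)

lemma subst_at_xgen: "subst_at xgen p = to_ac (to_fract p)"
proof (induction p)
  case (pCons c p)
  have "pCons c p = [:c:] + [:0, 1:] * p"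
    by simp
  then have "to_ac (to_fract (pCons c p)) = kconst c + xgen * to_ac (to_fract p)"
    by (metis kconst_def xgen_def to_ac_add to_ac_mult to_fract_add to_fract_mult)
  with pCons show ?case by simp
qed simp

lemma subst_at_xgen_eq_iff: "subst_at xgen p = subst_at xgen q \<longleftrightarrow> p = q"
  by (simp add: subst_at_xgen)

lemma subst_at_xgen_eq_0_iff: "subst_at xgen p = 0 \<longleftrightarrow> p = 0"
  by (simp add: subst_at_xgen)

lemma xgen_nonzero [simp]: "xgen \<noteq> 0"
  by (simp add: xgen_def)

lemma ygen_square: "ygen f ^ 2 = subst_at xgen f"
proof -
  obtain y :: ambient where "y ^ 2 = to_ac (to_fract f)"
    using nth_root_exists[of 2 "to_ac (to_fract f)"] by auto
  then show ?thesis
    unfolding ygen_def subst_at_xgen by (rule someI)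
qed

lemma subst_at_reflect_poly:
  "subst_at (inverse xgen) p * xgen ^ Polynomial.degree p = subst_at xgen (reflect_poly p)"
proof -
  have "map_poly kconst (reflect_poly p) = reflect_poly (map_poly kconst p)"
    by (rule poly_eqI) (auto simp: coeff_map_poly coeff_reflect_poly degree_map_poly)
  moreover have "Polynomial.degree (map_poly kconst p) = Polynomial.degree p"
    by (rule degree_map_poly) simp
  ultimately show ?thesis
    by (simp add: subst_at_def poly_reflect_poly_nz)
qed

text \<open>
  A point \<open>(x0, y0)\<close> in an affine chart whose coordinate functions are \<open>x\<close> and \<open>y\<close>.  Both kinds of
  points in \<^type>\<open>point\<close> become instances.
\<close>

locale chart_point =
  fixes x y :: ambient and F :: "qbar poly" and x0 y0 :: qbar
  assumes Y_square: "y ^ 2 = subst_at x F"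
    and independent: "\<And>a b. subst_at x a + subst_at x b * y = 0 \<Longrightarrow> a = 0 \<and> b = 0"
    and on_curve: "y0 ^ 2 = poly F x0"
begin

inductive coord_value :: "ambient \<Rightarrow> qbar \<Rightarrow> bool" where
  "coord_value (subst_at x a + subst_at x b * y) (poly a x0 + poly b x0 * y0)"

lemma coord_valueE:
  assumes "coord_value N c"
  obtains a b where "N = subst_at x a + subst_at x b * y" "c = poly a x0 + poly b x0 * y0"
  using assms by (cases rule: coord_value.cases) blast

text \<open>Since 1 and y are linearly independent over the polynomials in x, an element of the
  coordinate ring has only one representation to be evaluated.\<close>

lemma coord_value_unique:
  assumes "coord_value N c" "coord_value N d"
  shows "c = d"
proof -
  obtain a b where 1: "N = subst_at x a + subst_at x b * y" "c = poly a x0 + poly b x0 * y0"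
    using assms(1) by (rule coord_valueE)
  obtain a' b' where 2: "N = subst_at x a' + subst_at x b' * y" "d = poly a' x0 + poly b' x0 * y0"
    using assms(2) by (rule coord_valueE)
  have "subst_at x (a - a') + subst_at x (b - b') * y = 0"
    using 1 2 by (simp add: algebra_simps)
  then have "a - a' = 0 \<and> b - b' = 0"
    by (rule independent)
  with 1 2 show ?thesis by simp
qed

lemma coord_value_poly: "coord_value (subst_at x p) (poly p x0)"
  using coord_value.intros[of p 0] by simp

lemma coord_value_Y: "coord_value y y0"
  using coord_value.intros[of 0 1] by simp

lemma coord_value_add:
  assumes "coord_value N c" "coord_value M d"
  shows "coord_value (N + M) (c + d)"
proof -
  obtain a b where 1: "N = subst_at x a + subst_at x b * y" "c = poly a x0 + poly b x0 * y0"
    using assms(1) by (rule coord_valueE)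
  obtain a' b' where 2: "M = subst_at x a' + subst_at x b' * y" "d = poly a' x0 + poly b' x0 * y0"
    using assms(2) by (rule coord_valueE)
  show ?thesis
    using coord_value.intros[of "a + a'" "b + b'"] 1 2 by (simp add: algebra_simps)
qed

lemma coord_value_mult:
  assumes "coord_value N c" "coord_value M d"
  shows "coord_value (N * M) (c * d)"
proof -
  obtain a b where 1: "N = subst_at x a + subst_at x b * y" "c = poly a x0 + poly b x0 * y0"
    using assms(1) by (rule coord_valueE)
  obtain a' b' where 2: "M = subst_at x a' + subst_at x b' * y" "d = poly a' x0 + poly b' x0 * y0"
    using assms(2) by (rule coord_valueE)
  have "N * M = subst_at x a * subst_at x a' + subst_at x b * subst_at x b' * y ^ 2
      + (subst_at x a * subst_at x b' + subst_at x b * subst_at x a') * y"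
    unfolding 1 2 by (simp add: algebra_simps power2_eq_square)
  moreover have "c * d = poly a x0 * poly a' x0 + poly b x0 * poly b' x0 * y0 ^ 2
      + (poly a x0 * poly b' x0 + poly b x0 * poly a' x0) * y0"
    unfolding 1 2 by (simp add: algebra_simps power2_eq_square)
  ultimately show ?thesis
    using coord_value.intros[of "a * a' + b * b' * F" "a * b' + b * a'"]
    by (simp add: Y_square on_curve)
qed

section \<open>Regular functions and their values\<close>

definition regular_value :: "ambient \<Rightarrow> qbar \<Rightarrow> bool" where
  "regular_value h c \<longleftrightarrow>
     (\<exists>N D n d. coord_value N n \<and> coord_value D d \<and> d \<noteq> 0 \<and> h * D = N \<and> c = n / d)"

lemma regular_valueI:
  "coord_value N n \<Longrightarrow> coord_value D d \<Longrightarrow> d \<noteq> 0 \<Longrightarrow> h * D = N \<Longrightarrow> regular_value h (n / d)"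
  unfolding regular_value_def by blast

lemma regular_valueE:
  assumes "regular_value h c"
  obtains N D n d where "coord_value N n" "coord_value D d" "d \<noteq> 0" "D \<noteq> 0" "h = N / D" "c = n / d"
proof -
  obtain N D n d where *: "coord_value N n" "coord_value D d" "d \<noteq> 0" "h * D = N" "c = n / d"
    using assms unfolding regular_value_def by blast
  have "coord_value 0 0"
    using coord_value_poly[of 0] by simp
  then have "D \<noteq> 0"
    using * coord_value_unique by blast
  with * that[of N n D d] show ?thesis
    by (simp add: field_simps)
qed

lemma regular_value_coord: "coord_value h c \<Longrightarrow> regular_value h c"
  using regular_valueI[of h c 1 1 h] coord_value_poly[of 1] by simp

lemma regular_value_unique:
  assumes "regular_value h c" "regular_value h d"
  shows "c = d"
proof -
  obtain N D n e where 1: "coord_value N n" "coord_value D e" "e \<noteq> 0" "D \<noteq> 0" "h = N / D" "c = n / e"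
    using assms(1) by (rule regular_valueE)
  obtain N' D' n' e' where 2: "coord_value N' n'" "coord_value D' e'" "e' \<noteq> 0" "D' \<noteq> 0"
      "h = N' / D'" "d = n' / e'"
    using assms(2) by (rule regular_valueE)
  have "N * D' = N' * D"
    using 1 2 by (simp add: field_simps)
  then have "n * e' = n' * e"
    using coord_value_mult 1 2 coord_value_unique by metis
  then show ?thesis
    unfolding 1(6) 2(6) frac_eq_eq[OF 1(3) 2(3)] .
qed

lemma regular_value_add:
  assumes "regular_value h c" "regular_value k d"
  shows "regular_value (h + k) (c + d)"
proof -
  obtain N D n e where 1: "coord_value N n" "coord_value D e" "e \<noteq> 0" "D \<noteq> 0" "h = N / D" "c = n / e"
    using assms(1) by (rule regular_valueE)
  obtain N' D' n' e' where 2: "coord_value N' n'" "coord_value D' e'" "e' \<noteq> 0" "D' \<noteq> 0"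
      "k = N' / D'" "d = n' / e'"
    using assms(2) by (rule regular_valueE)
  have "(n * e' + n' * e) / (e * e') = c + d"
    unfolding 1(6) 2(6) by (rule add_frac_eq[OF 1(3) 2(3), symmetric])
  moreover have "regular_value (h + k) ((n * e' + n' * e) / (e * e'))"
  proof (rule regular_valueI[of "N * D' + N' * D" _ "D * D'"])
    show "coord_value (N * D' + N' * D) (n * e' + n' * e)" "coord_value (D * D') (e * e')"
      using 1(1,2) 2(1,2) by (blast intro: coord_value_add coord_value_mult)+
    show "e * e' \<noteq> 0"
      using 1(3) 2(3) by simp
    show "(h + k) * (D * D') = N * D' + N' * D"
      using 1(4) 2(4) unfolding 1(5) 2(5) by (simp add: distrib_right)
  qed
  ultimately show ?thesis by simp
qed

lemma regular_value_mult:
  assumes "regular_value h c" "regular_value k d"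
  shows "regular_value (h * k) (c * d)"
proof -
  obtain N D n e where 1: "coord_value N n" "coord_value D e" "e \<noteq> 0" "D \<noteq> 0" "h = N / D" "c = n / e"
    using assms(1) by (rule regular_valueE)
  obtain N' D' n' e' where 2: "coord_value N' n'" "coord_value D' e'" "e' \<noteq> 0" "D' \<noteq> 0"
      "k = N' / D'" "d = n' / e'"
    using assms(2) by (rule regular_valueE)
  have "regular_value (h * k) ((n * n') / (e * e'))"
  proof (rule regular_valueI[of "N * N'" _ "D * D'"])
    show "coord_value (N * N') (n * n')" "coord_value (D * D') (e * e')"
      using 1(1,2) 2(1,2) by (blast intro: coord_value_mult)+
    show "e * e' \<noteq> 0"
      using 1(3) 2(3) by simp
    show "h * k * (D * D') = N * N'"
      using 1(4) 2(4) unfolding 1(5) 2(5) by simp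
  qed
  then show ?thesis
    unfolding 1(6) 2(6) by simp
qed

lemma regular_value_inverse:
  assumes "regular_value h c" "c \<noteq> 0"
  shows "regular_value (inverse h) (inverse c)"
proof -
  obtain N D n e where 1: "coord_value N n" "coord_value D e" "e \<noteq> 0" "D \<noteq> 0" "h = N / D" "c = n / e"
    using assms(1) by (rule regular_valueE)
  have "n \<noteq> 0"
    using 1 assms(2) by auto
  moreover have "coord_value 0 0"
    using coord_value_poly[of 0] by simp
  ultimately have "N \<noteq> 0"
    using 1 coord_value_unique by blast
  then have "regular_value (inverse h) (e / n)"
    by (intro regular_valueI[of D _ N]) (use 1 \<open>n \<noteq> 0\<close> in \<open>auto simp: field_simps\<close>)
  with 1 show ?thesis by simp
qed

lemma regular_value_poly: "regular_value (subst_at x p) (poly p x0)"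
  by (rule regular_value_coord[OF coord_value_poly])

lemma regular_value_X: "regular_value x x0"
  using regular_value_poly[of "[:0, 1:]"] by simp

lemma regular_value_Y: "regular_value y y0"
  by (rule regular_value_coord[OF coord_value_Y])

lemma regular_value_const: "regular_value (kconst c) c"
  using regular_value_poly[of "[:c:]"] by simp

lemma regular_value_uminus: "regular_value h c \<Longrightarrow> regular_value (- h) (- c)"
  using regular_value_mult[OF regular_value_const[of "- 1"], of h c] by simp

lemma regular_value_diff:
  "regular_value h c \<Longrightarrow> regular_value k d \<Longrightarrow> regular_value (h - k) (c - d)"
  using regular_value_add[of h c "- k" "- d"] regular_value_uminus by simp

lemma regular_value_power: "regular_value h c \<Longrightarrow> regular_value (h ^ n) (c ^ n)"
proof (induction n)
  case 0
  show ?case using regular_value_const[of 1] by simp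
qed (simp add: regular_value_mult)

lemma regular_value_power_int:
  assumes "regular_value h c" "c \<noteq> 0"
  shows "regular_value (h powi n) (c powi n)"
proof (cases "n \<ge> 0")
  case True
  then show ?thesis
    using regular_value_power[OF assms(1), of "nat n"] by (simp add: power_int_def)
next
  case False
  then show ?thesis
    using regular_value_power[OF regular_value_inverse[OF assms], of "nat (- n)"]
    by (simp add: power_int_def)
qed

lemma regular_value_subst_at:
  "regular_value h c \<Longrightarrow> regular_value (subst_at h p) (poly p c)"
proof (induction p)
  case 0
  show ?case using regular_value_const[of 0] by simp
next
  case (pCons a p)
  then show ?case
    by (simp add: regular_value_add regular_value_mult regular_value_const)
qed

definition regular :: "ambient \<Rightarrow> bool" where
  "regular h \<longleftrightarrow> (\<exists>c. regular_value h c)"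

lemma regularI: "regular_value h c \<Longrightarrow> regular h"
  by (auto simp: regular_def)

lemma regular_intros:
  "regular h \<Longrightarrow> regular k \<Longrightarrow> regular (h + k)"
  "regular h \<Longrightarrow> regular k \<Longrightarrow> regular (h * k)"
  "regular h \<Longrightarrow> regular k \<Longrightarrow> regular (h - k)"
  "regular h \<Longrightarrow> regular (- h)"
  "regular h \<Longrightarrow> regular (h ^ n)"
  "regular (subst_at x p)" "regular x" "regular y" "regular (kconst c)"
  "regular_value h d \<Longrightarrow> d \<noteq> 0 \<Longrightarrow> regular (inverse h)"
  unfolding regular_def
  using regular_value_add regular_value_mult regular_value_diff regular_value_uminus
    regular_value_power regular_value_poly regular_value_X regular_value_Y regular_value_const
    regular_value_inverse by meson+

section \<open>Local parameters\<close>

definition local_parameter :: "ambient \<Rightarrow> bool" where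
  "local_parameter t \<longleftrightarrow>
     regular_value t 0 \<and> (\<forall>h. regular_value h 0 \<longrightarrow> (\<exists>r. regular r \<and> h = t * r))"

text \<open>Divisibility need only be tested on the coordinate ring: the denominator of a regular
  function is a unit of the local ring.\<close>

lemma local_parameterI:
  assumes "regular_value t 0"
    and "\<And>a b. poly a x0 + poly b x0 * y0 = 0 \<Longrightarrow>
      \<exists>r. regular r \<and> subst_at x a + subst_at x b * y = t * r"
  shows "local_parameter t"
  unfolding local_parameter_def
proof (intro conjI allI impI)
  fix h assume "regular_value h 0"
  then obtain N D n d where 1: "coord_value N n" "coord_value D d" "d \<noteq> 0" "D \<noteq> 0" "h = N / D"
      "0 = n / d"
    by (rule regular_valueE)
  then have "n = 0" by simp
  with 1(1) obtain a b where ab: "N = subst_at x a + subst_at x b * y" "poly a x0 + poly b x0 * y0 = 0"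
    by (auto elim!: coord_value.cases)
  from assms(2)[OF ab(2)] ab(1) obtain r where r: "regular r" "N = t * r"
    by auto
  have "regular (r * inverse D)"
    using r(1) regular_value_coord[OF 1(2)] 1(3) by (blast intro: regular_intros)
  moreover have "h = t * (r * inverse D)"
    using 1 r by (simp add: field_simps)
  ultimately show "\<exists>r. regular r \<and> h = t * r" by blast
qed (fact assms(1))

text \<open>Both \<open>a - a(x0)\<close> and \<open>b - b(x0)\<close> are divisible by
  \<open>x - x0\<close>, and so is \<open>y - y0 = (F(x) - F(x0)) / (y + y0)\<close>, because
  \<open>y + y0\<close> is a unit with value \<open>2 y0\<close>.\<close>

lemma local_parameter_X:
  assumes "y0 \<noteq> 0"
  shows "local_parameter (x - kconst x0)"
proof (rule local_parameterI)
  show "regular_value (x - kconst x0) 0"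
    using regular_value_diff[OF regular_value_X regular_value_const[of x0]] by simp
next
  fix a b assume ab: "poly a x0 + poly b x0 * y0 = 0"
  have div: "\<exists>q. p = [:poly p x0:] + [:- x0, 1:] * q" for p :: "qbar poly"
  proof -
    have "poly (p - [:poly p x0:]) x0 = 0" by simp
    then obtain q where "p - [:poly p x0:] = [:- x0, 1:] * q"
      using poly_eq_0_iff_dvd by blast
    then show ?thesis by (metis diff_eq_eq add.commute)
  qed
  obtain p q r where p: "a = [:poly a x0:] + [:- x0, 1:] * p" and q: "b = [:poly b x0:] + [:- x0, 1:] * q"
    and r: "F = [:poly F x0:] + [:- x0, 1:] * r"
    using div by meson
  have lin: "subst_at x [:- x0, 1:] = x - kconst x0"
    by simp
  have reg: "regular_value (inverse (y + kconst y0)) (inverse (y0 + y0))"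
    using assms by (intro regular_value_inverse regular_value_add regular_value_Y regular_value_const) simp
  have nz: "y + kconst y0 \<noteq> 0"
    using independent[of "[:y0:]" 1] by (auto simp: add.commute)
  have F: "y ^ 2 = kconst y0 ^ 2 + (x - kconst x0) * subst_at x r"
    unfolding Y_square by (subst r, subst subst_at_add, subst subst_at_mult, subst lin)
      (simp add: flip: on_curve)
  have y: "y - kconst y0 = (x - kconst x0) * (subst_at x r * inverse (y + kconst y0))"
    using F nz by (simp add: field_simps power2_eq_square)
  have "subst_at x a + subst_at x b * y = kconst (poly a x0) + kconst (poly b x0) * y
      + (x - kconst x0) * (subst_at x p + subst_at x q * y)"
    by (subst p, subst q, unfold subst_at_add subst_at_mult lin) (simp add: algebra_simps)
  also have "kconst (poly a x0) = - kconst (poly b x0) * kconst y0"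
    using ab by (simp add: eq_neg_iff_add_eq_0 flip: kconst_simps)
  also have "- kconst (poly b x0) * kconst y0 + kconst (poly b x0) * y = kconst (poly b x0) * (y - kconst y0)"
    by (simp add: algebra_simps)
  finally have "subst_at x a + subst_at x b * y = (x - kconst x0) *
      (kconst (poly b x0) * (subst_at x r * inverse (y + kconst y0)) + (subst_at x p + subst_at x q * y))"
    unfolding y by (simp add: algebra_simps)
  moreover have "regular
      (kconst (poly b x0) * (subst_at x r * inverse (y + kconst y0)) + (subst_at x p + subst_at x q * y))"
    by (intro regular_intros(1,2,6-9) regularI[OF reg])
  ultimately show "\<exists>r. regular r \<and> subst_at x a + subst_at x b * y = (x - kconst x0) * r"
    by blast
qed

lemma Y_square_ramified:
  assumes "y0 = 0" "poly (pderiv F) x0 \<noteq> 0"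
  obtains e c where "regular_value e c" "c \<noteq> 0" "y ^ 2 = (x - kconst x0) * e"
proof -
  have "poly F x0 = 0"
    using on_curve assms(1) by simp
  then obtain q where q: "F = [:- x0, 1:] * q"
    using poly_eq_0_iff_dvd by blast
  have "pderiv F = [:- x0, 1:] * pderiv q + q"
    unfolding q pderiv_mult by (simp add: pderiv_pCons)
  then have "poly q x0 \<noteq> 0"
    using assms(2) by simp
  moreover have "y ^ 2 = (x - kconst x0) * subst_at x q"
    unfolding Y_square q subst_at_mult by simp
  ultimately show ?thesis
    using that regular_value_poly by blast
qed

text \<open>At a simple root \<open>x0\<close> of \<open>F\<close> the function
  \<open>x - x0\<close> is \<open>y^2\<close> times a unit, so \<open>y\<close> divides everything
  that vanishes at the point.\<close>

lemma local_parameter_Y: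
  assumes "y0 = 0" "poly (pderiv F) x0 \<noteq> 0"
  shows "local_parameter y"
proof (rule local_parameterI)
  show "regular_value y 0"
    using regular_value_Y assms(1) by simp
next
  fix a b assume ab: "poly a x0 + poly b x0 * y0 = 0"
  obtain e c where e: "regular_value e c" "c \<noteq> 0" "y ^ 2 = (x - kconst x0) * e"
    using Y_square_ramified assms by blast
  have "poly a x0 = 0"
    using ab assms(1) by simp
  then obtain q where q: "a = [:- x0, 1:] * q"
    using poly_eq_0_iff_dvd by blast
  have "e \<noteq> 0"
    using e regular_value_unique[of 0 0 c] regular_value_const[of 0] by auto
  then have "x - kconst x0 = y ^ 2 * inverse e"
    using e by (simp add: field_simps)
  then have "subst_at x a = y ^ 2 * inverse e * subst_at x q"
    unfolding q subst_at_mult by simp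
  then have "subst_at x a + subst_at x b * y = y * (y * inverse e * subst_at x q + subst_at x b)"
    by (simp add: algebra_simps power2_eq_square)
  moreover have "regular (y * inverse e * subst_at x q + subst_at x b)"
    by (intro regular_intros(1,2,6-9) regular_intros(10)[OF e(1,2)])
  ultimately show "\<exists>r. regular r \<and> subst_at x a + subst_at x b * y = y * r"
    by blast
qed

text \<open>The maximal ideal is not zero: it contains \<open>x - x0\<close>.\<close>

lemma local_parameter_nonzero:
  assumes "local_parameter t"
  shows "t \<noteq> 0"
proof
  assume "t = 0"
  have "regular_value (x - kconst x0) 0"
    using regular_value_diff[OF regular_value_X regular_value_const[of x0]] by simp
  with \<open>t = 0\<close> assms have "x - kconst x0 = 0"
    unfolding local_parameter_def by auto
  then show False
    using independent[of "[:- x0, 1:]" 0] by simp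
qed

text \<open>Two parameters divide each other; the two quotients are regular with product 1, so their
  values are nonzero.\<close>

lemma local_parameter_ratio:
  assumes "local_parameter s" "local_parameter t"
  obtains w c where "regular_value w c" "c \<noteq> 0" "s = t * w"
proof -
  obtain w r where "regular w" "s = t * w" "regular r" "t = s * r"
    using assms unfolding local_parameter_def by metis
  moreover have "s \<noteq> 0" "t \<noteq> 0"
    using assms local_parameter_nonzero by auto
  ultimately have "w * r = 1"
    by (metis mult.assoc mult_cancel_left mult.right_neutral)
  obtain c d where "regular_value w c" "regular_value r d"
    using \<open>regular w\<close> \<open>regular r\<close> unfolding regular_def by blast
  then have "regular_value 1 (c * d)"
    using regular_value_mult \<open>w * r = 1\<close> by metis
  then have "c * d = 1"
    using regular_value_const[of 1] regular_value_unique by simp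
  then have "c \<noteq> 0" by auto
  with \<open>regular_value w c\<close> \<open>s = t * w\<close> that show ?thesis by blast
qed

lemma local_parameter_exists:
  assumes "y0 \<noteq> 0 \<or> poly (pderiv F) x0 \<noteq> 0"
  obtains t where "local_parameter t"
  using assms local_parameter_X local_parameter_Y by blast

end

section \<open>The function field inside an algebraically closed field\<close>

fun chart_x :: "point \<Rightarrow> ambient" where
  "chart_x (Fin a b) = xgen"
| "chart_x (Inf s) = inverse xgen"

fun chart_y :: "nat \<Rightarrow> qbar poly \<Rightarrow> point \<Rightarrow> ambient" where
  "chart_y g f (Fin a b) = ygen f"
| "chart_y g f (Inf s) = ygen f / xgen ^ (g + 1)"

text \<open>At infinity this is \<open>u^(2g+2) f(1/u)\<close>, which for degree \<open>2g+1\<close>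
  is u times the reflected polynomial.\<close>

fun chart_equation :: "qbar poly \<Rightarrow> point \<Rightarrow> qbar poly" where
  "chart_equation f (Fin a b) = f"
| "chart_equation f (Inf s) = pCons 0 (reflect_poly f)"

fun px :: "point \<Rightarrow> qbar" where
  "px (Fin a b) = a"
| "px (Inf s) = 0"

fun py :: "point \<Rightarrow> qbar" where
  "py (Fin a b) = b"
| "py (Inf s) = s"

text \<open>
  Moves the function field, a record depending on \<open>f\<close>, into a fixed type of class \<^class>\<open>field\<close>.
\<close>

definition embed :: "qbar poly \<Rightarrow> rat_fun \<Rightarrow> ambient" where
  "embed f h = to_ac (fst h) + to_ac (snd h) * ygen f"

lemma function_field_simps [simp]:
  "carrier (function_field f) = UNIV"
  "\<one>\<^bsub>function_field f\<^esub> = (1, 0)" "\<zero>\<^bsub>function_field f\<^esub> = (0, 0)"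
  by (simp_all add: function_field_def)

lemma embed_mult: "embed f (h \<otimes>\<^bsub>function_field f\<^esub> k) = embed f h * embed f k"
proof -
  obtain a b c d where hk: "h = (a, b)" "k = (c, d)"
    by (cases h, cases k)
  have "to_ac (to_fract f) = ygen f * ygen f"
    using ygen_square[of f] by (simp add: subst_at_xgen power2_eq_square)
  then show ?thesis
    by (simp add: hk embed_def function_field_def algebra_simps)
qed

lemma embed_one: "embed f (1, 0) = 1" and embed_zero: "embed f (0, 0) = 0"
  by (simp_all add: embed_def)

lemma embed_nat_pow: "embed f (h [^]\<^bsub>function_field f\<^esub> (n::nat)) = embed f h ^ n"
  by (induction n) (simp_all add: nat_pow_def embed_one embed_mult)

lemma to_ac_at_inverse: "to_ac (at_inverse p) = subst_at (inverse xgen) p"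
proof -
  have "to_ac (poly q z) = poly (map_poly to_ac q) (to_ac z)" for q :: "qbar poly fract poly" and z
    by (induction q) (simp_all add: map_poly_pCons)
  moreover have "map_poly to_ac (map_poly (\<lambda>c. to_fract [:c:]) p) = map_poly kconst p"
    by (simp add: map_poly_map_poly o_def kconst_def[abs_def])
  ultimately show ?thesis
    by (simp add: at_inverse_def subst_at_def xgen_def)
qed

lemma embed_chart_fun:
  "embed f (chart_fun g P a b) = subst_at (chart_x P) a + subst_at (chart_x P) b * chart_y g f P"
  by (cases P) (simp_all add: embed_def subst_at_xgen to_ac_at_inverse flip: xgen_def)

lemma chart_val_eq: "chart_val P a b = poly a (px P) + poly b (px P) * py P"
  by (cases P) simp_all

lemma clear_denominator:
  fixes c :: "'a::field"
  shows "c \<noteq> 0 \<Longrightarrow> (a + b * (z / c)) * u * v * c = (a * u) * (v * c) + (b * v) * (u * z)"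
  by (simp add: field_simps)

lemma divide_odd_power:
  fixes z :: "'a::field"
  assumes "z \<noteq> 0" "r * z ^ (2 * n + 1) = s"
  shows "s / (z ^ (n + 1)) ^ 2 = inverse z * r"
proof -
  define w where "w = z ^ n"
  have "z ^ (2 * n + 1) = w * w * z"
    unfolding w_def by (simp only: mult_2 power_add power_one_right)
  then have "s = r * (w * w * z)"
    unfolding assms(2)[symmetric] by (simp only:)
  moreover have "(z ^ (n + 1)) ^ 2 = w * w * z * z"
    by (simp add: w_def power2_eq_square mult_ac)
  moreover have "w \<noteq> 0"
    using assms(1) by (simp add: w_def)
  ultimately show ?thesis
    using assms(1) by (simp only:) (simp add: field_simps)
qed

text \<open>Odd degree makes \<open>Inf 0\<close> the only point at infinity. Over an algebraically
  closed field, \<open>simple_roots\<close> expresses that \<open>f\<close> is squarefree.\<close>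

locale odd_curve =
  fixes g :: nat and f :: "qbar poly"
  assumes degree_f: "Polynomial.degree f = 2 * g + 1"
    and simple_roots: "\<And>a. poly f a = 0 \<Longrightarrow> poly (pderiv f) a \<noteq> 0"
begin

abbreviation "y \<equiv> ygen f"

lemma f_nonzero: "f \<noteq> 0"
  using degree_f by auto

text \<open>A relation would give \<open>a^2 = b^2 f\<close>, where the left side has even degree
  and the right side odd degree.\<close>

lemma independent_finite:
  assumes "subst_at xgen a + subst_at xgen b * y = 0"
  shows "a = 0 \<and> b = 0"
proof -
  have "subst_at xgen a = - (subst_at xgen b * y)"
    using assms by (simp add: eq_neg_iff_add_eq_0)
  then have "subst_at xgen (a ^ 2) = subst_at xgen (b ^ 2 * f)"
    by (simp add: power_mult_distrib ygen_square)
  then have eq: "a ^ 2 = b ^ 2 * f"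
    using subst_at_xgen_eq_iff by blast
  have "b = 0"
  proof (rule ccontr)
    assume "b \<noteq> 0"
    then have "a \<noteq> 0"
      using eq f_nonzero by auto
    have "Polynomial.degree (a ^ 2) = Polynomial.degree (b ^ 2 * f)"
      using eq by simp
    then have "2 * Polynomial.degree a = 2 * Polynomial.degree b + (2 * g + 1)"
      using \<open>a \<noteq> 0\<close> \<open>b \<noteq> 0\<close> f_nonzero degree_f
      by (simp add: degree_power_eq degree_mult_eq)
    then show False by presburger
  qed
  with eq show ?thesis by simp
qed

lemma independent_infinite:
  assumes "subst_at (inverse xgen) a + subst_at (inverse xgen) b * (y / xgen ^ (g + 1)) = 0"
  shows "a = 0 \<and> b = 0"
proof -
  define m n where "m = Polynomial.degree a" and "n = Polynomial.degree b"
  have X: "subst_at xgen ([:0, 1:] ^ k) = xgen ^ k" for k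
    by simp
  \<comment> \<open>Multiplying by a large power of x clears all negative powers and reduces to the
    finite chart.\<close>
  have "0 = (subst_at (inverse xgen) a + subst_at (inverse xgen) b * (y / xgen ^ (g + 1))) *
      xgen ^ m * xgen ^ n * xgen ^ (g + 1)"
    using assms by simp
  also have "\<dots> = (subst_at (inverse xgen) a * xgen ^ m) * (xgen ^ n * xgen ^ (g + 1)) +
      (subst_at (inverse xgen) b * xgen ^ n) * (xgen ^ m * y)"
    by (rule clear_denominator) simp
  also have "\<dots> = subst_at xgen (reflect_poly a * ([:0, 1:] ^ n * [:0, 1:] ^ (g + 1))) +
      subst_at xgen (reflect_poly b * [:0, 1:] ^ m) * y"
    unfolding m_def n_def subst_at_reflect_poly by (simp add: mult_ac)
  finally have "reflect_poly a * ([:0, 1:] ^ n * [:0, 1:] ^ (g + 1)) = 0 \<and> reflect_poly b * [:0, 1:] ^ m = 0"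
    by (intro independent_finite) simp
  then show ?thesis by simp
qed

lemma Inf_in_points_iff [simp]: "Inf s \<in> points g f \<longleftrightarrow> s = 0"
  using degree_f by (auto simp: points_def coeff_eq_0)

lemma Fin_in_points_iff [simp]: "Fin a b \<in> points g f \<longleftrightarrow> b ^ 2 = poly f a"
  by (simp add: points_def)

lemma chart_point_at:
  assumes "P \<in> points g f"
  shows "chart_point (chart_x P) (chart_y g f P) (chart_equation f P) (px P) (py P)"
proof (cases P)
  case (Fin a b)
  with assms show ?thesis
    by unfold_locales (auto simp: ygen_square dest: independent_finite)
next
  case (Inf s)
  have "(y / xgen ^ (g + 1)) ^ 2 = inverse xgen * subst_at (inverse xgen) (reflect_poly f)"
  proof -
    \<comment> \<open>Reflecting twice gives back \<open>f\<close> only if \<open>f(0)\<close> is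
      nonzero. Otherwise a factor x is lost; it is exactly one factor because 0 is a simple
      root.\<close>
    have "subst_at (inverse xgen) (reflect_poly f) * xgen ^ (2 * g + 1) = subst_at xgen f"
    proof (cases "poly f 0 = 0")
      case False
      then show ?thesis
        using subst_at_reflect_poly[of "reflect_poly f"] degree_f
        by (simp add: poly_0_coeff_0)
    next
      case True
      then obtain q where q: "f = [:0, 1:] * q"
        using poly_eq_0_iff_dvd[of f 0] by auto
      have "poly q 0 \<noteq> 0"
        using simple_roots[OF True] unfolding q pderiv_mult by (simp add: pderiv_pCons)
      have "q \<noteq> 0" using q f_nonzero by auto
      then have "Polynomial.degree f = Suc (Polynomial.degree q)"
        by (simp add: q)
      then have "Polynomial.degree q = 2 * g"
        using degree_f by simp
      moreover have "reflect_poly f = reflect_poly q"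
        unfolding q reflect_poly_mult by (simp add: reflect_poly_def)
      ultimately show ?thesis
        using subst_at_reflect_poly[of "reflect_poly q"] \<open>poly q 0 \<noteq> 0\<close>
        by (simp add: poly_0_coeff_0 q mult_ac)
    qed
    then show ?thesis
      unfolding power_divide ygen_square by (intro divide_odd_power) auto
  qed
  with assms Inf independent_infinite show ?thesis
    by unfold_locales (auto simp del: power_Suc)
qed

lemma smooth_at:
  assumes "P \<in> points g f"
  shows "py P \<noteq> 0 \<or> poly (pderiv (chart_equation f P)) (px P) \<noteq> 0"
proof (cases P)
  case (Fin a b)
  with assms simple_roots[of a] show ?thesis by auto
next
  case (Inf s)
  then show ?thesis
    using f_nonzero by (simp add: pderiv_pCons poly_0_coeff_0)
qed

abbreviation value_at :: "point \<Rightarrow> ambient \<Rightarrow> qbar \<Rightarrow> bool" where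
  "value_at P \<equiv> chart_point.regular_value (chart_x P) (chart_y g f P) (px P) (py P)"

abbreviation regular_at :: "point \<Rightarrow> ambient \<Rightarrow> bool" where
  "regular_at P \<equiv> chart_point.regular (chart_x P) (chart_y g f P) (px P) (py P)"

abbreviation parameter_at :: "point \<Rightarrow> ambient \<Rightarrow> bool" where
  "parameter_at P \<equiv> chart_point.local_parameter (chart_x P) (chart_y g f P) (px P) (py P)"

section \<open>The image of the function field\<close>

lemma embed_eq_0_iff: "embed f h = 0 \<longleftrightarrow> h = (0, 0)"
proof
  assume h0: "embed f h = 0"
  obtain a b where h: "h = (a, b)" by (cases h)
  obtain p q where a: "a = Fract p q" "q \<noteq> 0" by (cases a)
  obtain r s where b: "b = Fract r s" "s \<noteq> 0" by (cases b)
  have pr: "to_fract p = a * to_fract q" "to_fract r = b * to_fract s"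
    using a b by (simp_all add: Fract_conv_to_fract)
  have "subst_at xgen (p * s) + subst_at xgen (r * q) * y =
      embed f h * (to_ac (to_fract q) * to_ac (to_fract s))"
    unfolding h embed_def subst_at_xgen to_fract_mult to_ac_mult pr by (simp add: algebra_simps)
  then have "p * s = 0 \<and> r * q = 0"
    using h0 by (intro independent_finite) simp
  with a b h show "h = (0, 0)"
    by (simp add: Fract_conv_to_fract)
qed (simp add: embed_zero)

lemma inj_embed: "inj (embed f)"
proof (rule injI)
  fix h k assume "embed f h = embed f k"
  then have "embed f (fst h - fst k, snd h - snd k) = 0"
    by (simp add: embed_def algebra_simps)
  then show "h = k"
    by (simp add: embed_eq_0_iff prod_eq_iff)
qed

text \<open>The inverse of \<open>a + b y\<close> is its conjugate \<open>a - b y\<close> divided by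
  the norm, which is rational in x.\<close>

lemma embed_inverse_ex: "\<exists>k. embed f k = inverse (embed f h)"
proof (cases "h = (0, 0)")
  case True
  then show ?thesis by (metis embed_zero inverse_zero)
next
  case False
  obtain a b where h: "h = (a, b)" by (cases h)
  have y2: "to_ac (to_fract f) = y * y"
    using ygen_square[of f] by (simp add: subst_at_xgen power2_eq_square)
  define n where "n = a * a - b * b * to_fract f"
  have n: "to_ac n = embed f h * embed f (a, - b)"
    by (simp add: n_def h embed_def y2 algebra_simps)
  have "embed f (a, - b) \<noteq> 0" "embed f h \<noteq> 0"
    using False h by (simp_all add: embed_eq_0_iff)
  then have "inverse (embed f h) = embed f (a, - b) * inverse (to_ac n)"
    unfolding n by simp
  also have "\<dots> = embed f (a * inverse n, - b * inverse n)"
    by (simp add: embed_def algebra_simps)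
  finally show ?thesis by metis
qed

lemma embed_range_simps:
  "subst_at xgen p \<in> range (embed f)" "xgen \<in> range (embed f)" "y \<in> range (embed f)"
  "kconst c \<in> range (embed f)"
proof -
  show p: "subst_at xgen p \<in> range (embed f)" for p
    by (rule range_eqI[of _ _ "(to_fract p, 0)"]) (simp add: embed_def subst_at_xgen)
  show "xgen \<in> range (embed f)" "kconst c \<in> range (embed f)"
    using p[of "[:0, 1:]"] p[of "[:c:]"] by simp_all
  show "y \<in> range (embed f)"
    by (rule range_eqI[of _ _ "(0, 1)"]) (simp add: embed_def)
qed

lemma embed_range_mult:
  assumes "h \<in> range (embed f)" "k \<in> range (embed f)"
  shows "h * k \<in> range (embed f)"
proof -
  obtain h' k' where "h = embed f h'" "k = embed f k'"
    using assms by blast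
  then show ?thesis
    by (intro range_eqI[of _ _ "h' \<otimes>\<^bsub>function_field f\<^esub> k'"]) (simp add: embed_mult)
qed

lemma embed_range_inverse:
  assumes "h \<in> range (embed f)"
  shows "inverse h \<in> range (embed f)"
proof -
  obtain k where "embed f k = inverse h"
    using assms embed_inverse_ex by blast
  then show ?thesis
    by (intro range_eqI[of _ _ k]) simp
qed

lemma embed_range_divide:
  "h \<in> range (embed f) \<Longrightarrow> k \<in> range (embed f) \<Longrightarrow> h / k \<in> range (embed f)"
  unfolding divide_inverse by (intro embed_range_mult embed_range_inverse)

lemma embed_range_diff:
  assumes "h \<in> range (embed f)" "k \<in> range (embed f)"
  shows "h - k \<in> range (embed f)"
proof -
  obtain h' k' where "h = embed f h'" "k = embed f k'"
    using assms by blast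
  then show ?thesis
    by (intro range_eqI[of _ _ "(fst h' - fst k', snd h' - snd k')"]) (simp add: embed_def algebra_simps)
qed

lemma embed_range_power: "h \<in> range (embed f) \<Longrightarrow> h ^ n \<in> range (embed f)"
  by (induction n) (use embed_range_simps(1)[of 1] in \<open>simp_all add: embed_range_mult\<close>)

text \<open>Regularity is defined for all elements of the ambient field. This confines regular
  elements to the function field, so divisibility by a parameter means the same in both.\<close>

lemma value_at_in_range:
  assumes "P \<in> points g f" "value_at P h c"
  shows "h \<in> range (embed f)"
proof -
  interpret chart_point "chart_x P" "chart_y g f P" "chart_equation f P" "px P" "py P"
    by (rule chart_point_at) fact
  obtain N D n d where *: "coord_value N n" "coord_value D d" "h = N / D"
    using assms(2) by (rule regular_valueE)
  obtain a b where "N = embed f (chart_fun g P a b)"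
    using *(1) by (rule coord_valueE) (metis embed_chart_fun)
  moreover obtain a b where "D = embed f (chart_fun g P a b)"
    using *(2) by (rule coord_valueE) (metis embed_chart_fun)
  ultimately show ?thesis
    using *(3) embed_range_divide by auto
qed

section \<open>Values, uniformizers and orders in terms of the ambient field\<close>

lemma has_value_iff:
  assumes "P \<in> points g f"
  shows "has_value g f P h c \<longleftrightarrow> value_at P (embed f h) c"
proof -
  interpret chart_point "chart_x P" "chart_y g f P" "chart_equation f P" "px P" "py P"
    by (rule chart_point_at) fact
  have "has_value g f P h c \<longleftrightarrow>
     (\<exists>a b a' b'. poly a' (px P) + poly b' (px P) * py P \<noteq> 0 \<and>
        embed f h * (subst_at (chart_x P) a' + subst_at (chart_x P) b' * chart_y g f P) =
          subst_at (chart_x P) a + subst_at (chart_x P) b * chart_y g f P \<and>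
        c = (poly a (px P) + poly b (px P) * py P) / (poly a' (px P) + poly b' (px P) * py P))"
    unfolding has_value_def chart_val_eq
    by (simp add: inj_eq[OF inj_embed, symmetric] embed_mult embed_chart_fun)
  also have "\<dots> \<longleftrightarrow> regular_value (embed f h) c"
    unfolding regular_value_def coord_value.simps by blast
  finally show ?thesis .
qed

lemma local_ring_iff: "P \<in> points g f \<Longrightarrow> h \<in> local_ring g f P \<longleftrightarrow> regular_at P (embed f h)"
  by (simp add: local_ring_def has_value_iff chart_point.regular_def[OF chart_point_at])

lemma uniformizer_iff:
  assumes "P \<in> points g f"
  shows "uniformizer g f P t \<longleftrightarrow> parameter_at P (embed f t)"
proof -
  interpret chart_point "chart_x P" "chart_y g f P" "chart_equation f P" "px P" "py P"
    by (rule chart_point_at) fact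
  have emb: "h \<in> range (embed f)" if "regular h" for h
    using that value_at_in_range[OF assms] unfolding regular_def by blast
  have max: "h \<in> max_ideal g f P \<longleftrightarrow> regular_value (embed f h) 0" for h
    using assms by (simp add: max_ideal_def has_value_iff)
  have img: "h \<in> (\<lambda>h. t \<otimes>\<^bsub>function_field f\<^esub> h) ` local_ring g f P \<longleftrightarrow>
      (\<exists>r. regular r \<and> embed f h = embed f t * r)" (is "?l \<longleftrightarrow> ?r") for h
  proof
    assume ?l
    then show ?r using local_ring_iff[OF assms] embed_mult by blast
  next
    assume ?r
    then obtain r where r: "regular r" "embed f h = embed f t * r" by blast
    then obtain k where "r = embed f k" using emb by blast
    with r have "embed f h = embed f (t \<otimes>\<^bsub>function_field f\<^esub> k)"
      by (simp add: embed_mult)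
    then have "h = t \<otimes>\<^bsub>function_field f\<^esub> k"
      using inj_embed by (simp add: inj_eq)
    with r \<open>r = embed f k\<close> show ?l
      using local_ring_iff[OF assms] by blast
  qed
  have "uniformizer g f P t \<longleftrightarrow> (\<forall>h. regular_value (embed f h) 0 \<longleftrightarrow>
      (\<exists>r. regular r \<and> embed f h = embed f t * r))"
    unfolding uniformizer_def set_eq_iff max img ..
  also have "\<dots> \<longleftrightarrow> local_parameter (embed f t)"
  proof
    assume *: "\<forall>h. regular_value (embed f h) 0 \<longleftrightarrow> (\<exists>r. regular r \<and> embed f h = embed f t * r)"
    have "regular 1" using regular_intros(9)[of 1] by simp
    then have "regular_value (embed f t) 0"
      using * by (metis mult.right_neutral)
    moreover have "\<exists>r. regular r \<and> h = embed f t * r" if h: "regular_value h 0" for h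
    proof -
      obtain k where "h = embed f k"
        using emb[OF regularI[OF h]] by blast
      with * h show ?thesis by blast
    qed
    ultimately show "local_parameter (embed f t)"
      unfolding local_parameter_def by blast
  next
    assume *: "local_parameter (embed f t)"
    have "regular_value (embed f t * r) 0" if "regular r" for r
    proof -
      obtain c where "regular_value r c" using \<open>regular r\<close> unfolding regular_def by blast
      then show ?thesis
        using * regular_value_mult[of "embed f t" 0 r c] unfolding local_parameter_def by simp
    qed
    with * show "\<forall>h. regular_value (embed f h) 0 \<longleftrightarrow> (\<exists>r. regular r \<and> embed f h = embed f t * r)"
      unfolding local_parameter_def by metis
  qed
  finally show ?thesis .
qed

definition order_at :: "point \<Rightarrow> ambient \<Rightarrow> int \<Rightarrow> bool" where
  "order_at P h n \<longleftrightarrow>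
     (\<exists>t w c. parameter_at P t \<and> value_at P w c \<and> c \<noteq> 0 \<and> h = t powi n * w)"

lemma embed_inv:
  assumes "embed f h \<noteq> 0"
  shows "embed f (inv\<^bsub>function_field f\<^esub> h) = inverse (embed f h)"
proof -
  obtain k where k: "embed f k = inverse (embed f h)"
    using embed_inverse_ex by blast
  \<comment> \<open>The inverse of the record structure is a definite description, so it is computed
    by showing that exactly one element qualifies; injectivity of \<open>embed\<close> moves the
    question into a field.\<close>
  have *: "h \<otimes>\<^bsub>function_field f\<^esub> k' = \<one>\<^bsub>function_field f\<^esub> \<and> k' \<otimes>\<^bsub>function_field f\<^esub> h = \<one>\<^bsub>function_field f\<^esub> \<longleftrightarrow> k' = k" for k'
  proof -
    have "h \<otimes>\<^bsub>function_field f\<^esub> k' = \<one>\<^bsub>function_field f\<^esub> \<longleftrightarrow> embed f h * embed f k' = 1"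
      by (simp add: inj_eq[OF inj_embed, symmetric] embed_mult embed_one)
    moreover have "k' \<otimes>\<^bsub>function_field f\<^esub> h = \<one>\<^bsub>function_field f\<^esub> \<longleftrightarrow> embed f k' * embed f h = 1"
      by (simp add: inj_eq[OF inj_embed, symmetric] embed_mult embed_one)
    moreover have "k' = k \<longleftrightarrow> embed f k' = inverse (embed f h)"
      by (simp add: inj_eq[OF inj_embed, symmetric] k)
    ultimately show ?thesis
      using assms by (metis inverse_unique mult.commute right_inverse)
  qed
  have "inv\<^bsub>function_field f\<^esub> h = k"
    unfolding m_inv_def by (simp add: * del: function_field_simps(2))
  with k show ?thesis by simp
qed

lemma embed_int_pow:
  assumes "embed f h \<noteq> 0"
  shows "embed f (h [^]\<^bsub>function_field f\<^esub> (n::int)) = embed f h powi n"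
proof -
  have "embed f (h [^]\<^bsub>function_field f\<^esub> (k::nat)) \<noteq> 0" for k
    using assms by (simp add: embed_nat_pow)
  then show ?thesis
    by (cases "n < 0") (simp_all only: int_pow_def2 embed_inv embed_nat_pow power_int_def power_inverse
        if_True if_False not_less simp_thms flip: not_le)
qed

lemma has_order_iff:
  assumes "P \<in> points g f"
  shows "has_order g f P h n \<longleftrightarrow> order_at P (embed f h) n"
proof
  assume "has_order g f P h n"
  then obtain t w c where *: "uniformizer g f P t" "c \<noteq> 0" "has_value g f P w c"
      "h = t [^]\<^bsub>function_field f\<^esub> n \<otimes>\<^bsub>function_field f\<^esub> w"
    unfolding has_order_def local_units_def by blast
  have t: "parameter_at P (embed f t)"
    using * uniformizer_iff assms by simp
  then have "embed f t \<noteq> 0"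
    by (rule chart_point.local_parameter_nonzero[OF chart_point_at[OF assms]])
  with * t has_value_iff[OF assms] show "order_at P (embed f h) n"
    unfolding order_at_def by (metis embed_mult embed_int_pow)
next
  assume "order_at P (embed f h) n"
  then obtain t w c where *: "parameter_at P t" "value_at P w c" "c \<noteq> 0" "embed f h = t powi n * w"
    unfolding order_at_def by blast
  have "t \<noteq> 0"
    using *(1) by (rule chart_point.local_parameter_nonzero[OF chart_point_at[OF assms]])
  have "value_at P t 0"
    using *(1) unfolding chart_point.local_parameter_def[OF chart_point_at[OF assms]] by blast
  then obtain t' w' where tw: "t = embed f t'" "w = embed f w'"
    using * value_at_in_range[OF assms] by blast
  have "embed f h = embed f (t' [^]\<^bsub>function_field f\<^esub> n \<otimes>\<^bsub>function_field f\<^esub> w')"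
    using * tw \<open>t \<noteq> 0\<close> by (simp add: embed_mult embed_int_pow)
  then have "h = t' [^]\<^bsub>function_field f\<^esub> n \<otimes>\<^bsub>function_field f\<^esub> w'"
    using inj_embed by (simp add: inj_eq)
  with * tw show "has_order g f P h n"
    unfolding has_order_def local_units_def using uniformizer_iff[OF assms] has_value_iff[OF assms]
    by blast
qed

end

section \<open>Functions regular on the affine part\<close>

fun conj_point :: "point \<Rightarrow> point" where
  "conj_point (Fin a b) = Fin a (- b)"
| "conj_point (Inf s) = Inf (- s)"

lemma horner_divide:
  fixes z :: "'a::field"
  shows "z \<noteq> 0 \<Longrightarrow> a * inverse (z ^ Suc m) + s / z ^ m = (a + z * s) / z ^ Suc m"
  by (simp add: field_simps)

lemma at_inverse_minus: "at_inverse (- p) = - at_inverse p"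
proof -
  have "to_ac (at_inverse (- p)) = to_ac (- at_inverse p)"
    by (simp add: to_ac_at_inverse)
  then show ?thesis by (simp only: to_ac_eq_iff)
qed

lemma chart_fun_conj:
  "chart_fun g (conj_point P) a (- b) = (fst (chart_fun g P a b), - snd (chart_fun g P a b))"
  by (cases P) (simp_all add: at_inverse_minus)

lemma conj_mult:
  "(p, - q) \<otimes>\<^bsub>function_field f\<^esub> (fst h, - snd h) =
    (fst ((p, q) \<otimes>\<^bsub>function_field f\<^esub> h), - snd ((p, q) \<otimes>\<^bsub>function_field f\<^esub> h))"
  by (cases h) (simp add: function_field_def)

text \<open>The hyperelliptic involution negates the second coordinate in both charts and acts on
  functions by \<open>y \<mapsto> - y\<close>, so the witnesses of regularity can be
  conjugated.\<close>

lemma has_value_conj: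
  assumes "has_value g f P (p, q) c"
  shows "has_value g f (conj_point P) (p, - q) c"
proof -
  obtain a b a' b' where *: "chart_val P a' b' \<noteq> 0"
      "(p, q) \<otimes>\<^bsub>function_field f\<^esub> chart_fun g P a' b' = chart_fun g P a b"
      "c = chart_val P a b / chart_val P a' b'"
    using assms unfolding has_value_def by blast
  have val: "chart_val (conj_point P) a (- b) = chart_val P a b" for a b
    by (cases P) simp_all
  have "(p, - q) \<otimes>\<^bsub>function_field f\<^esub> chart_fun g (conj_point P) a' (- b') =
      chart_fun g (conj_point P) a (- b)"
    unfolding chart_fun_conj conj_mult *(2) ..
  with * val show ?thesis
    unfolding has_value_def by metis
qed

context odd_curve
begin

lemma conj_point_in_points: "P \<in> points g f \<Longrightarrow> conj_point P \<in> points g f"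
  by (cases P) auto

lemma conj_point_conj: "conj_point (conj_point P) = P"
  by (cases P) auto

text \<open>The two parts are half the sum and half the difference of the function and its
  conjugate, and the conjugate is regular at P because the function is regular at the conjugate of
  P.\<close>

lemma regular_at_split:
  assumes P: "P \<in> points g f"
    and reg: "regular_at P (embed f (p, q))" "regular_at (conj_point P) (embed f (p, q))"
  shows "regular_at P (to_ac p)" "regular_at P (to_ac q * y)"
proof -
  interpret chart_point "chart_x P" "chart_y g f P" "chart_equation f P" "px P" "py P"
    by (rule chart_point_at) fact
  have cP: "conj_point P \<in> points g f"
    using P by (rule conj_point_in_points)
  obtain c where "has_value g f (conj_point P) (p, q) c"
    using reg(2) has_value_iff[OF cP] by (auto simp: chart_point.regular_def[OF chart_point_at[OF cP]])
  then have "has_value g f P (p, - q) c"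
    using has_value_conj[of g f "conj_point P"] conj_point_conj by simp
  then have c: "regular (embed f (p, - q))"
    using has_value_iff[OF P] by (auto simp: regular_def)
  have "regular (kconst (1 / 2) * (embed f (p, q) + embed f (p, - q)))"
       "regular (kconst (1 / 2) * (embed f (p, q) - embed f (p, - q)))"
    using c reg(1) by (blast intro: regular_intros)+
  moreover have "kconst (1 / 2) * 2 = 1"
  proof -
    have "kconst (1 / 2) * (kconst 1 + kconst 1) = kconst (1 / 2 * (1 + 1))"
      by (simp only: kconst_simps)
    then show ?thesis by simp
  qed
  then have "kconst (1 / 2) * (z * 2) = z" "kconst (1 / 2) * (2 * z) = z" for z
    by (metis mult.assoc mult.commute mult_1)+
  ultimately show "regular (to_ac p)" "regular (to_ac q * y)"
    by (simp_all add: embed_def mult_2[symmetric])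
qed

lemma point_over_ex: "\<exists>b. Fin a b \<in> points g f"
  using nth_root_exists[of 2 "poly f a"] by auto

text \<open>Some point lies over each root of the reduced denominator. Evaluating
  \<open>r q = p\<close> there makes the root common to numerator and denominator.\<close>

lemma rational_function_regular:
  assumes "\<And>P. P \<in> points g f \<Longrightarrow> P \<noteq> Inf 0 \<Longrightarrow> regular_at P (to_ac r)"
  obtains p where "r = to_fract p"
proof -
  define p q where "p = fst (quot_of_fract r)" and "q = snd (quot_of_fract r)"
  have r: "r = to_fract p / to_fract q"
    by (simp add: p_def q_def flip: Fract_conv_to_fract)
  have "q \<noteq> 0" "coprime p q"
    by (simp_all add: p_def q_def coprime_quot_of_fract)
  have no_root: "poly q a \<noteq> 0" for a
  proof
    assume a: "poly q a = 0"
    obtain b where P: "Fin a b \<in> points g f"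
      using point_over_ex by blast
    interpret chart_point "chart_x (Fin a b)" "chart_y g f (Fin a b)" "chart_equation f (Fin a b)"
        "px (Fin a b)" "py (Fin a b)"
      by (rule chart_point_at) fact
    obtain c where "regular_value (to_ac r) c"
      using assms[OF P] unfolding regular_def by auto
    then have "regular_value (to_ac r * subst_at xgen q) (c * poly q a)"
      using regular_value_mult regular_value_poly by simp
    moreover have "to_ac r * subst_at xgen q = subst_at xgen p"
    proof -
      have "r * to_fract q = to_fract p"
        using \<open>q \<noteq> 0\<close> by (simp add: r)
      then show ?thesis
        unfolding subst_at_xgen to_ac_mult[symmetric] by simp
    qed
    moreover have "regular_value (subst_at xgen p) (poly p a)"
      using regular_value_poly by simp
    ultimately have "poly p a = 0"
      using regular_value_unique a by (metis mult_zero_right)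
    then have "[:- a, 1:] dvd p" "[:- a, 1:] dvd q"
      using a by (simp_all add: poly_eq_0_iff_dvd)
    then have "is_unit [:- a, 1:]"
      using \<open>coprime p q\<close> coprime_common_divisor by blast
    then show False by (simp add: is_unit_iff_degree)
  qed
  have "Polynomial.degree q = 0"
    using alg_closed_imp_poly_has_root[of q] no_root by blast
  then obtain c where c: "q = [:c:]" "c \<noteq> 0"
    using \<open>q \<noteq> 0\<close> by (metis degree_eq_zeroE pCons_0_0)
  have "to_fract (smult (inverse c) p) * to_fract q = to_fract p"
    using c by (simp flip: to_fract_mult)
  then have "r = to_fract (smult (inverse c) p)"
    using \<open>q \<noteq> 0\<close> by (simp add: r field_simps)
  with that show ?thesis .
qed

text \<open>The coordinate ring is integrally closed because \<open>f\<close> is squarefree. The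
  parts r and \<open>s y\<close> are regular separately; then \<open>s^2 f\<close> is a polynomial,
  so the square of the reduced denominator of s divides \<open>f\<close>.\<close>

theorem finite_regular_imp_polynomial:
  assumes "h \<in> range (embed f)"
    and reg: "\<And>P. P \<in> points g f \<Longrightarrow> P \<noteq> Inf 0 \<Longrightarrow> regular_at P h"
  obtains a b where "h = subst_at xgen a + subst_at xgen b * y"
proof -
  obtain r s where h: "h = embed f (r, s)"
    using assms(1) by auto
  have conj: "conj_point P \<noteq> Inf 0" if "P \<noteq> Inf 0" for P
    using that by (cases P) auto
  have split: "regular_at P (to_ac r)" "regular_at P (to_ac s * y)"
    if "P \<in> points g f" "P \<noteq> Inf 0" for P
    using regular_at_split[OF that(1)] reg[OF that] reg[OF conj_point_in_points[OF that(1)] conj[OF that(2)]] h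
    by simp_all
  obtain a where a: "r = to_fract a"
    using rational_function_regular split(1) by blast
  have y2: "y * y = to_ac (to_fract f)"
    using ygen_square[of f] by (simp add: subst_at_xgen power2_eq_square)
  have "regular_at P (to_ac (s * s * to_fract f))" if "P \<in> points g f" "P \<noteq> Inf 0" for P
  proof -
    interpret chart_point "chart_x P" "chart_y g f P" "chart_equation f P" "px P" "py P"
      by (rule chart_point_at) fact
    have "regular ((to_ac s * y) * (to_ac s * y))"
      using split(2)[OF that] by (blast intro: regular_intros)
    then show ?thesis by (simp add: mult_ac flip: y2)
  qed
  then obtain k where k: "s * s * to_fract f = to_fract k"
    using rational_function_regular by blast
  define p q where "p = fst (quot_of_fract s)" and "q = snd (quot_of_fract s)"
  have s: "s = to_fract p / to_fract q"
    by (simp add: p_def q_def flip: Fract_conv_to_fract)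
  have "q \<noteq> 0" "coprime p q"
    by (simp_all add: p_def q_def coprime_quot_of_fract)
  have "to_fract (p * p * f) = to_fract (k * (q * q))"
    using k \<open>q \<noteq> 0\<close> by (simp add: s field_simps)
  then have "p * p * f = k * (q * q)"
    by (simp only: to_fract_eq_iff)
  then have "q * q dvd p * p * f"
    by simp
  moreover have "coprime (q * q) (p * p)"
    using \<open>coprime p q\<close> by (simp add: coprime_commute)
  ultimately have "q * q dvd f"
    using coprime_dvd_mult_right_iff by blast
  have no_root: "poly q c \<noteq> 0" for c
  proof
    assume "poly q c = 0"
    then have "[:- c, 1:] * [:- c, 1:] dvd f"
      using \<open>q * q dvd f\<close> mult_dvd_mono dvd_trans poly_eq_0_iff_dvd by metis
    then obtain z where "f = [:- c, 1:] * [:- c, 1:] * z"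
      by (rule dvdE)
    then have "f = [:- c, 1:] * ([:- c, 1:] * z)"
      unfolding mult.assoc .
    then have "poly f c = 0" "poly (pderiv f) c = 0"
      by (simp_all only: pderiv_mult) (simp_all add: pderiv_pCons)
    then show False using simple_roots by blast
  qed
  have "Polynomial.degree q = 0"
    using alg_closed_imp_poly_has_root[of q] no_root by blast
  then obtain c where c: "q = [:c:]" "c \<noteq> 0"
    using \<open>q \<noteq> 0\<close> by (metis degree_eq_zeroE pCons_0_0)
  have "to_fract (smult (inverse c) p) * to_fract q = to_fract p"
    using c by (simp flip: to_fract_mult)
  then have "s = to_fract (smult (inverse c) p)"
    using \<open>q \<noteq> 0\<close> by (simp add: s field_simps)
  then have "h = subst_at xgen a + subst_at xgen (smult (inverse c) p) * y"
    unfolding h a embed_def subst_at_xgen by simp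
  with that show ?thesis .
qed

section \<open>Local analysis at infinity\<close>

abbreviation "v \<equiv> y / xgen ^ (g + 1)"

lemma Inf_point: "Inf 0 \<in> points g f"
  by simp

sublocale inf: chart_point "inverse xgen" v "pCons 0 (reflect_poly f)" 0 0
  using chart_point_at[OF Inf_point] by simp

lemma parameter_infinity: "inf.local_parameter v"
  by (rule inf.local_parameter_Y) (use f_nonzero in \<open>simp_all add: pderiv_pCons\<close>)

lemma value_poly_infinity:
  assumes "Polynomial.degree p \<le> n"
  shows "inf.regular_value (subst_at xgen p / xgen ^ n) (Polynomial.coeff p n)"
  using assms
proof (induction p arbitrary: n)
  case 0
  then show ?case using inf.regular_value_const[of 0] by simp
next
  case (pCons a p)
  show ?case
  proof (cases n)
    case 0
    with pCons have "p = 0" by (metis degree_pCons_eq_if le_zero_eq nat.simps(3))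
    with 0 show ?thesis using inf.regular_value_const[of a] by simp
  next
    case (Suc m)
    have "Polynomial.degree p \<le> m"
      using pCons.prems Suc by (cases "p = 0") auto
    then have "inf.regular_value (kconst a * inverse xgen ^ n + subst_at xgen p / xgen ^ m)
        (a * 0 ^ n + Polynomial.coeff p m)"
      using pCons.IH by (intro inf.regular_value_add inf.regular_value_mult inf.regular_value_power
          inf.regular_value_const inf.regular_value_X)
    moreover have "kconst a * inverse xgen ^ n + subst_at xgen p / xgen ^ m =
        subst_at xgen (pCons a p) / xgen ^ n"
      unfolding Suc subst_at_pCons power_inverse by (rule horner_divide) simp
    ultimately show ?thesis by (simp add: Suc)
  qed
qed

text \<open>If the degree exceeded n, further division by a positive power of x would give value 0
  at infinity, yet it gives the leading coefficient.\<close>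

lemma poly_pole_bound:
  assumes "inf.regular (subst_at xgen p / xgen ^ n)"
  shows "Polynomial.degree p \<le> n"
proof (rule ccontr)
  assume "\<not> Polynomial.degree p \<le> n"
  then obtain k where k: "Polynomial.degree p = n + Suc k"
    by (metis less_imp_Suc_add not_le add_Suc_right)
  obtain c where "inf.regular_value (subst_at xgen p / xgen ^ n) c"
    using assms unfolding inf.regular_def by blast
  then have "inf.regular_value (subst_at xgen p / xgen ^ n * inverse xgen ^ Suc k) (c * 0 ^ Suc k)"
    by (intro inf.regular_value_mult inf.regular_value_power inf.regular_value_X)
  moreover have "subst_at xgen p / xgen ^ n * inverse xgen ^ Suc k = subst_at xgen p / xgen ^ Polynomial.degree p"
    unfolding k power_add power_inverse divide_inverse by simp
  ultimately have "inf.regular_value (subst_at xgen p / xgen ^ Polynomial.degree p) (c * 0 ^ Suc k)"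
    by (simp only:)
  then have "c * 0 ^ Suc k = lead_coeff p"
    by (rule inf.regular_value_unique[OF _ value_poly_infinity[OF order_refl]])
  then have "lead_coeff p = 0" by simp
  then have "p = 0" by simp
  then show False using k by simp
qed

text \<open>Infinity is fixed by the involution, so both parts are regular there. Squaring the
  second part gives \<open>2 deg b + 2g + 1 \<le> 2n\<close>, and parity sharpens this to the stated
  bound.\<close>

lemma pole_bound:
  assumes "inf.regular ((subst_at xgen a + subst_at xgen b * y) / xgen ^ n)"
  shows "Polynomial.degree a \<le> n" "b = 0 \<or> Polynomial.degree b + g + 1 \<le> n"
proof -
  have emb: "(subst_at xgen a + subst_at xgen b * y) / xgen ^ n =
      embed f (to_fract a / to_fract ([:0, 1:] ^ n), to_fract b / to_fract ([:0, 1:] ^ n))"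
  proof -
    have "xgen ^ n = to_ac (to_fract ([:0, 1:] ^ n))"
      using subst_at_xgen[of "[:0, 1:] ^ n"] by simp
    then show ?thesis
      by (simp add: embed_def subst_at_xgen add_divide_distrib)
  qed
  have reg: "inf.regular (to_ac (to_fract a / to_fract ([:0, 1:] ^ n)))"
      "inf.regular (to_ac (to_fract b / to_fract ([:0, 1:] ^ n)) * y)"
    using regular_at_split[OF Inf_point] assms unfolding emb by (simp_all del: to_ac_divide)
  have xn: "to_ac (to_fract p / to_fract ([:0, 1:] ^ n)) = subst_at xgen p / xgen ^ n" for p
    using subst_at_xgen[of "[:0, 1:] ^ n"] by (simp add: subst_at_xgen)
  show "Polynomial.degree a \<le> n"
    using reg(1) unfolding xn by (rule poly_pole_bound)
  have "inf.regular ((subst_at xgen b / xgen ^ n * y) ^ 2)"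
    using reg(2) unfolding xn by (rule inf.regular_intros)
  moreover have "(subst_at xgen b / xgen ^ n * y) ^ 2 = subst_at xgen (b ^ 2 * f) / xgen ^ (2 * n)"
    by (simp add: power_mult_distrib power_divide ygen_square power_mult[symmetric] mult.commute)
  ultimately have "Polynomial.degree (b ^ 2 * f) \<le> 2 * n"
    using poly_pole_bound by metis
  then show "b = 0 \<or> Polynomial.degree b + g + 1 \<le> n"
    using f_nonzero degree_f by (cases "b = 0") (simp_all add: degree_mult_eq degree_power_eq)
qed

text \<open>The unit in \<open>v^2 = rho / x\<close>; it shows that x has a pole of order exactly 2
  at infinity.\<close>

definition rho :: ambient where
  "rho = subst_at (inverse xgen) (reflect_poly f)"

lemma value_rho: "inf.regular_value rho (lead_coeff f)"
  unfolding rho_def using inf.regular_value_poly[of "reflect_poly f"] by simp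

lemma lead_coeff_nonzero: "lead_coeff f \<noteq> 0"
  using f_nonzero by simp

lemma rho_nonzero: "rho \<noteq> 0"
  using value_rho inf.regular_value_const[of 0] inf.regular_value_unique lead_coeff_nonzero by force

lemma v_square: "v ^ 2 = inverse xgen * rho"
  using inf.Y_square unfolding rho_def by simp

lemma inverse_xgen_eq: "inverse xgen = v ^ 2 * inverse rho"
  unfolding v_square using rho_nonzero by simp

end

section \<open>Principal divisors\<close>

lemma odd_power_expand:
  fixes t :: "'a::comm_ring_1"
  shows "(a + b * (t * x)) * ((t ^ 2) ^ e * t) = a * (t ^ 2) ^ e * t + b * x * (t ^ 2) ^ (e + 1)"
  by (simp add: algebra_simps power2_eq_square)

lemma eq_power_int_minus:
  fixes t :: "'a::field"
  shows "t \<noteq> 0 \<Longrightarrow> h * t ^ n = w \<Longrightarrow> h = t powi (- int n) * w"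
  by (auto simp: power_int_minus)

context odd_curve
begin

lemma order_at_parameter:
  assumes P: "P \<in> points g f" and s: "parameter_at P s" and h: "order_at P h n"
  obtains w c where "value_at P w c" "c \<noteq> 0" "h = s powi n * w"
proof -
  interpret chart_point "chart_x P" "chart_y g f P" "chart_equation f P" "px P" "py P"
    by (rule chart_point_at) fact
  obtain t w c where t: "local_parameter t" "regular_value w c" "c \<noteq> 0" "h = t powi n * w"
    using h unfolding order_at_def by blast
  obtain r d where r: "regular_value r d" "d \<noteq> 0" "t = s * r"
    using local_parameter_ratio t(1) s by blast
  have "h = s powi n * (r powi n * w)"
    using t(4) r(3) by (simp add: power_int_mult_distrib mult_ac)
  moreover have "regular_value (r powi n * w) (d powi n * c)"
    using r t by (intro regular_value_mult regular_value_power_int)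
  moreover have "d powi n * c \<noteq> 0"
    using r t by simp
  ultimately show ?thesis
    using that by blast
qed

lemma order_atI:
  assumes "parameter_at P t" "value_at P w c" "c \<noteq> 0" "h = t powi n * w"
  shows "order_at P h n"
  using assms unfolding order_at_def by blast

lemma parameter_ex: "P \<in> points g f \<Longrightarrow> \<exists>t. parameter_at P t"
  using chart_point.local_parameter_exists[OF chart_point_at] smooth_at by metis

lemma order_at_mult:
  assumes P: "P \<in> points g f" and "order_at P h m" "order_at P k n"
  shows "order_at P (h * k) (m + n)"
proof -
  interpret chart_point "chart_x P" "chart_y g f P" "chart_equation f P" "px P" "py P"
    by (rule chart_point_at) fact
  obtain t where t: "local_parameter t"
    using parameter_ex P by blast
  obtain w c where w: "regular_value w c" "c \<noteq> 0" "h = t powi m * w"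
    using order_at_parameter[OF P t assms(2)] by blast
  obtain w' c' where w': "regular_value w' c'" "c' \<noteq> 0" "k = t powi n * w'"
    using order_at_parameter[OF P t assms(3)] by blast
  show ?thesis
  proof (rule order_atI[OF t])
    show "regular_value (w * w') (c * c')"
      using w w' by (intro regular_value_mult)
    show "c * c' \<noteq> 0"
      using w w' by simp
    show "h * k = t powi (m + n) * (w * w')"
      using w w' local_parameter_nonzero[OF t] by (simp add: power_int_add mult_ac)
  qed
qed

lemma order_at_inverse:
  assumes P: "P \<in> points g f" and "order_at P h m"
  shows "order_at P (inverse h) (- m)"
proof -
  interpret chart_point "chart_x P" "chart_y g f P" "chart_equation f P" "px P" "py P"
    by (rule chart_point_at) fact
  obtain t w c where w: "local_parameter t" "regular_value w c" "c \<noteq> 0" "h = t powi m * w"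
    using assms(2) unfolding order_at_def by blast
  show ?thesis
  proof (rule order_atI[OF w(1)])
    show "regular_value (inverse w) (inverse c)"
      using w by (intro regular_value_inverse)
    show "inverse c \<noteq> 0"
      using w by simp
    show "inverse h = t powi - m * inverse w"
      using w(4) by (simp add: power_int_minus)
  qed
qed

lemma order_at_0_iff:
  assumes P: "P \<in> points g f"
  shows "order_at P h 0 \<longleftrightarrow> (\<exists>c. c \<noteq> 0 \<and> value_at P h c)"
  using parameter_ex[OF P] unfolding order_at_def by auto

lemma order_at_positive:
  assumes P: "P \<in> points g f" and "order_at P h m" "m > 0"
  shows "value_at P h 0"
proof -
  interpret chart_point "chart_x P" "chart_y g f P" "chart_equation f P" "px P" "py P"
    by (rule chart_point_at) fact
  obtain t w c where w: "local_parameter t" "regular_value w c" "c \<noteq> 0" "h = t powi m * w"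
    using assms(2) unfolding order_at_def by blast
  have "regular_value t 0"
    using w(1) unfolding local_parameter_def by blast
  then have "regular_value (t ^ nat m * w) (0 ^ nat m * c)"
    using w by (intro regular_value_mult regular_value_power)
  with w assms(3) show ?thesis
    by (simp add: power_int_def zero_power)
qed

section \<open>The subgroup of principal divisors\<close>

lemma principal_divisors_iff:
  "D \<in> principal_divisors g f \<longleftrightarrow> Poly_Mapping.keys D \<subseteq> points g f \<and>
    (\<exists>h\<in>range (embed f). h \<noteq> 0 \<and> (\<forall>P\<in>points g f. order_at P h (Poly_Mapping.lookup D P)))"
  by (auto simp: principal_divisors_def has_order_iff embed_eq_0_iff)

lemma principal_divisors_zero: "0 \<in> principal_divisors g f"
proof -
  have "order_at P 1 0" if P: "P \<in> points g f" for P
    using chart_point.regular_value_const[OF chart_point_at[OF P], of 1]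
    by (auto simp: order_at_0_iff[OF P] intro!: exI[of _ 1])
  moreover have "1 \<in> range (embed f)"
    by (metis embed_one rangeI)
  ultimately have "\<exists>h\<in>range (embed f). h \<noteq> 0 \<and> (\<forall>P\<in>points g f. order_at P h (Poly_Mapping.lookup 0 P))"
    by (intro bexI[of _ "1 :: ambient"]) simp_all
  then show ?thesis
    unfolding principal_divisors_iff by simp
qed

lemma principal_divisors_add:
  assumes D: "D \<in> principal_divisors g f" and E: "E \<in> principal_divisors g f"
  shows "D + E \<in> principal_divisors g f"
proof -
  obtain h where h: "h \<in> range (embed f)" "h \<noteq> 0" "\<forall>P\<in>points g f. order_at P h (Poly_Mapping.lookup D P)"
    using D unfolding principal_divisors_iff by blast
  obtain k where k: "k \<in> range (embed f)" "k \<noteq> 0" "\<forall>P\<in>points g f. order_at P k (Poly_Mapping.lookup E P)"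
    using E unfolding principal_divisors_iff by blast
  have "h * k \<in> range (embed f)"
    using h(1) k(1) by (rule embed_range_mult)
  moreover have "\<forall>P\<in>points g f. order_at P (h * k) (Poly_Mapping.lookup (D + E) P)"
    using h(3) k(3) order_at_mult by (simp add: lookup_add)
  moreover have "Poly_Mapping.keys (D + E) \<subseteq> points g f"
    using D E keys_add[of D E] unfolding principal_divisors_iff by blast
  ultimately show ?thesis
    unfolding principal_divisors_iff using h(2) k(2) by (intro conjI bexI[of _ "h * k"]) simp_all
qed

lemma principal_divisors_minus:
  assumes D: "D \<in> principal_divisors g f"
  shows "- D \<in> principal_divisors g f"
proof -
  obtain h where h: "h \<in> range (embed f)" "h \<noteq> 0" "\<forall>P\<in>points g f. order_at P h (Poly_Mapping.lookup D P)"
    using D unfolding principal_divisors_iff by blast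
  have keys: "Poly_Mapping.keys D \<subseteq> points g f"
    using D unfolding principal_divisors_iff by blast
  have "inverse h \<in> range (embed f)"
    using h(1) by (rule embed_range_inverse)
  moreover have "\<forall>P\<in>points g f. order_at P (inverse h) (Poly_Mapping.lookup (- D) P)"
    using h(3) order_at_inverse by simp
  ultimately show ?thesis
    unfolding principal_divisors_iff using h(2) keys
    by (intro conjI bexI[of _ "inverse h"]) (simp_all add: keys_minus)
qed

lemma principal_divisors_subgroup:
  "subgroup (principal_divisors g f) (free_Abelian_group (points g f))"
proof (rule subgroup.intro)
  show sub: "principal_divisors g f \<subseteq> carrier (free_Abelian_group (points g f))"
    by (auto simp: principal_divisors_def)
  show "inv\<^bsub>free_Abelian_group (points g f)\<^esub> D \<in> principal_divisors g f"
    if "D \<in> principal_divisors g f" for D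
    using that sub principal_divisors_minus by (auto simp: subset_iff)
qed (simp_all add: principal_divisors_zero principal_divisors_add)

text \<open>
  The divisor is that of \<open>a + b y\<close>, whose norm is \<open>a\<^sup>2 - b\<^sup>2 f\<close>.
\<close>

lemma multiple_principal:
  assumes P: "Fin x0 y0 \<in> points g f"
    and norm: "a ^ 2 - b ^ 2 * f = smult k ([:- x0, 1:] ^ (2 * e + 1))" and k: "k \<noteq> 0"
    and e: "e = Polynomial.degree b + g" and a: "Polynomial.degree a \<le> e" and b: "b \<noteq> 0"
    and zero: "poly a x0 + poly b x0 * y0 = 0" and nz: "poly a x0 \<noteq> 0"
  shows "frag_cmul (int (2 * e + 1)) (frag_of (Fin x0 y0) - frag_of (Inf 0)) \<in> principal_divisors g f"
    (is "?D \<in> _")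
proof -
  define h where "h = subst_at xgen a + subst_at xgen b * y"
  define h' where "h' = subst_at xgen a - subst_at xgen b * y"
  have h_range: "h \<in> range (embed f)"
    by (rule range_eqI[of _ _ "(to_fract a, to_fract b)"]) (simp add: h_def embed_def subst_at_xgen)
  have hh': "h * h' = kconst k * (xgen - kconst x0) ^ (2 * e + 1)"
  proof -
    have "h * h' = subst_at xgen a ^ 2 - subst_at xgen b ^ 2 * y ^ 2"
      by (simp add: h_def h'_def algebra_simps power2_eq_square)
    also have "\<dots> = subst_at xgen (a ^ 2 - b ^ 2 * f)"
      by (simp add: ygen_square)
    finally show ?thesis
      unfolding norm by (simp del: power_Suc)
  qed
  have "h \<noteq> 0"
    using independent_finite[of a b] b unfolding h_def by auto
  have value_h: "value_at (Fin c d) h (poly a c + poly b c * d)"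
    and value_h': "value_at (Fin c d) h' (poly a c - poly b c * d)" if "Fin c d \<in> points g f" for c d
  proof -
    interpret chart_point "chart_x (Fin c d)" "chart_y g f (Fin c d)" "chart_equation f (Fin c d)"
        "px (Fin c d)" "py (Fin c d)"
      by (rule chart_point_at) fact
    have "regular_value (subst_at xgen p) (poly p c)" "regular_value y d" for p
      using regular_value_poly[of p] regular_value_Y by simp_all
    then show "regular_value h (poly a c + poly b c * d)" "regular_value h' (poly a c - poly b c * d)"
      unfolding h_def h'_def
      by (intro regular_value_add regular_value_diff regular_value_mult; blast)+
  qed
  \<comment> \<open>At P the conjugate \<open>h'\<close> has the nonzero value
    \<open>2 a(x0)\<close>, so the whole power of \<open>x - x0\<close> in the norm belongs to
    \<open>h\<close>; \<open>x - x0\<close> is a parameter because \<open>y0\<close> is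
    nonzero.\<close>
  have order_P: "order_at (Fin x0 y0) h (int (2 * e + 1))"
  proof -
    interpret chart_point "chart_x (Fin x0 y0)" "chart_y g f (Fin x0 y0)" "chart_equation f (Fin x0 y0)"
        "px (Fin x0 y0)" "py (Fin x0 y0)"
      by (rule chart_point_at) fact
    have "y0 \<noteq> 0"
      using zero nz by auto
    then have t: "local_parameter (xgen - kconst x0)"
      using local_parameter_X by simp
    have "poly a x0 - poly b x0 * y0 = poly a x0 + poly a x0"
      using zero by (simp add: add_eq_0_iff)
    then have ne: "poly a x0 - poly b x0 * y0 \<noteq> 0"
      using nz by (metis mult_2 mult_eq_0_iff zero_neq_numeral)
    have v': "regular_value h' (poly a x0 - poly b x0 * y0)"
      using value_h' P by simp
    have "h' \<noteq> 0"
      using v' ne regular_value_const[of 0] regular_value_unique by force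
    then have "h = (xgen - kconst x0) powi int (2 * e + 1) * (kconst k * inverse h')"
      using hh' by (simp add: field_simps del: power_Suc of_nat_add of_nat_Suc)
    moreover have "regular_value (kconst k * inverse h') (k * inverse (poly a x0 - poly b x0 * y0))"
      using v' ne by (intro regular_value_mult regular_value_inverse regular_value_const)
    moreover have "k * inverse (poly a x0 - poly b x0 * y0) \<noteq> 0"
      using k ne by simp
    ultimately show ?thesis
      using t by (blast intro: order_atI)
  qed
  have order_inf: "order_at (Inf 0) h (- int (2 * e + 1))"
  proof -
    have x: "xgen = inverse (v ^ 2 * inverse rho)"
      using inverse_xgen_eq by (metis inverse_inverse_eq)
    have "v \<noteq> 0"
      by (rule inf.local_parameter_nonzero[OF parameter_infinity])
    define d where "d = Polynomial.degree b"
    \<comment> \<open>This is \<open>h v^(2e+1)\<close> after substituting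
      \<open>x = rho / v^2\<close> and \<open>y = v x^(g+1)\<close>. The part from \<open>a\<close>
      keeps a factor \<open>v\<close> and vanishes at infinity; the part from \<open>b\<close> has a
      nonzero value.\<close>
    define w where "w = subst_at xgen a / xgen ^ e * v * rho ^ e + subst_at xgen b / xgen ^ d * rho ^ (e + 1)"
    have "inf.regular_value w (Polynomial.coeff a e * 0 * lead_coeff f ^ e + Polynomial.coeff b d * lead_coeff f ^ (e + 1))"
      unfolding w_def using a d_def
      by (intro inf.regular_value_add inf.regular_value_mult inf.regular_value_power value_rho
          value_poly_infinity inf.regular_value_Y) simp_all
    moreover have "h = v powi (- int (2 * e + 1)) * w"
    proof -
      have xr: "xgen * v ^ 2 = rho"
        using v_square by simp
      have "h * v ^ (2 * e + 1) = w"
      proof -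
        have h_v: "h = subst_at xgen a + subst_at xgen b * (v * xgen ^ (g + 1))"
          unfolding h_def by simp
        have "v ^ (2 * e + 1) = (v ^ 2) ^ e * v"
          by (simp add: power_mult)
        then have "h * v ^ (2 * e + 1) = subst_at xgen a * (v ^ 2) ^ e * v +
            subst_at xgen b * xgen ^ (g + 1) * (v ^ 2) ^ (e + 1)"
          unfolding h_v by (simp only: odd_power_expand)
        also have "subst_at xgen a * (v ^ 2) ^ e * v = subst_at xgen a / xgen ^ e * v * rho ^ e"
          unfolding xr[symmetric] power_mult_distrib by (simp add: mult_ac)
        also have "subst_at xgen b * xgen ^ (g + 1) * (v ^ 2) ^ (e + 1) =
            subst_at xgen b / xgen ^ d * rho ^ (e + 1)"
        proof -
          have "xgen ^ (e + 1) = xgen ^ d * xgen ^ (g + 1)"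
            by (simp add: e d_def power_add)
          then show ?thesis
            unfolding xr[symmetric] power_mult_distrib by simp
        qed
        finally show ?thesis unfolding w_def .
      qed
      then show ?thesis
        using \<open>v \<noteq> 0\<close> by (intro eq_power_int_minus)
    qed
    moreover have "Polynomial.coeff b d * lead_coeff f ^ (e + 1) \<noteq> 0"
      using b lead_coeff_nonzero by (simp add: d_def)
    ultimately show ?thesis
      using parameter_infinity by (intro order_atI[of _ v w]) auto
  qed
  \<comment> \<open>A zero of \<open>h\<close> is a zero of the norm and hence lies over
    \<open>x0\<close>; at the conjugate of P the value of \<open>h\<close> is again
    \<open>2 a(x0)\<close>.\<close>
  have order_other: "order_at Q h 0" if Q: "Q \<in> points g f" "Q \<noteq> Fin x0 y0" "Q \<noteq> Inf 0" for Q
  proof -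
    obtain c d where cd: "Q = Fin c d" "d ^ 2 = poly f c"
      using Q by (cases Q) auto
    have "poly a c + poly b c * d \<noteq> 0"
    proof
      assume z: "poly a c + poly b c * d = 0"
      then have "poly a c = - (poly b c * d)"
        by (simp add: eq_neg_iff_add_eq_0)
      then have "poly (a ^ 2 - b ^ 2 * f) c = 0"
        by (simp add: power_mult_distrib flip: cd(2))
      then have "c = x0"
        unfolding norm using k by auto
      then have "d ^ 2 = y0 ^ 2"
        using cd P by simp
      then have "d = - y0"
        using Q cd \<open>c = x0\<close> by (auto simp: power2_eq_iff)
      with z zero \<open>c = x0\<close> have "poly a x0 + poly a x0 = 0"
        by (simp add: add_eq_0_iff)
      with nz show False
        by (metis mult_2 mult_eq_0_iff zero_neq_numeral)
    qed
    then show ?thesis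
      using value_h Q(1) order_at_0_iff cd(1) by blast
  qed
  have "Poly_Mapping.keys ?D \<subseteq> points g f"
    using P Inf_point keys_cmul[of "int (2 * e + 1)" "frag_of (Fin x0 y0) - frag_of (Inf 0)"]
      keys_diff[of "frag_of (Fin x0 y0)" "frag_of (Inf 0)"] by (auto simp del: Fin_in_points_iff)
  moreover have "order_at Q h (Poly_Mapping.lookup ?D Q)" if "Q \<in> points g f" for Q
  proof -
    consider "Q = Fin x0 y0" | "Q = Inf 0" | "Q \<noteq> Fin x0 y0" "Q \<noteq> Inf 0" by blast
    then show ?thesis
    proof cases
      case 1
      then show ?thesis using order_P by (simp add: lookup_minus)
    next
      case 2
      then show ?thesis using order_inf by (simp add: lookup_minus)
    next
      case 3
      then show ?thesis using order_other[OF that] by (simp add: lookup_minus)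
    qed
  qed
  ultimately show ?thesis
    unfolding principal_divisors_iff using h_range \<open>h \<noteq> 0\<close> by blast
qed

lemma multiple_not_principal:
  assumes P: "Fin x0 y0 \<in> points g f" and "y0 \<noteq> 0" and n: "0 < n" "n \<le> 2 * g"
  shows "frag_cmul (int n) (frag_of (Fin x0 y0) - frag_of (Inf 0)) \<notin> principal_divisors g f"
    (is "?D \<notin> _")
proof
  assume "?D \<in> principal_divisors g f"
  then obtain h where h: "h \<in> range (embed f)" "\<And>Q. Q \<in> points g f \<Longrightarrow> order_at Q h (Poly_Mapping.lookup ?D Q)"
    unfolding principal_divisors_iff by blast
  have order_P: "order_at (Fin x0 y0) h (int n)"
    using h(2)[OF P] by (simp add: lookup_minus)
  have order_inf: "order_at (Inf 0) h (- int n)"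
    using h(2)[OF Inf_point] by (simp add: lookup_minus)
  have order_other: "order_at Q h 0" if "Q \<in> points g f" "Q \<noteq> Fin x0 y0" "Q \<noteq> Inf 0" for Q
    using h(2)[OF that(1)] that by (simp add: lookup_minus)
  have "regular_at Q h" if "Q \<in> points g f" "Q \<noteq> Inf 0" for Q
    using order_at_positive[OF P order_P] order_other[OF that(1)] n that P
      chart_point.regularI[OF chart_point_at] order_at_0_iff[OF that(1)]
    by (cases "Q = Fin x0 y0") (metis of_nat_0_less_iff)+
  then obtain a b where ab: "h = subst_at xgen a + subst_at xgen b * y"
    using finite_regular_imp_polynomial[OF h(1)] by blast
  have "parameter_at (Inf 0) v"
    using parameter_infinity by simp
  then obtain w c where "value_at (Inf 0) w c" and w2: "h = v powi (- int n) * w"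
    by (rule order_at_parameter[OF Inf_point _ order_inf])
  then have w: "inf.regular_value w c" "h = v powi (- int n) * w"
    by (simp, simp only: w2)
  have "v \<noteq> 0"
    by (rule inf.local_parameter_nonzero[OF parameter_infinity])
  \<comment> \<open>Since \<open>x^g\<close> has a pole of order \<open>2g\<close>, which is at
    least \<open>n\<close>, the quotient is regular at infinity.\<close>
  have "h / xgen ^ g = h * (v ^ 2 * inverse rho) ^ g"
    by (subst inverse_xgen_eq[symmetric]) (simp add: divide_inverse power_inverse)
  also have "\<dots> = v ^ (2 * g - n) * inverse rho ^ g * w"
  proof -
    have "v ^ (2 * g) = v ^ n * v ^ (2 * g - n)"
      using n by (simp flip: power_add)
    moreover have "(v ^ 2 * inverse rho) ^ g = v ^ (2 * g) * inverse rho ^ g"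
      unfolding power_mult_distrib power_mult ..
    moreover have "h = inverse (v ^ n) * w"
      using w(2) by (simp only: power_int_minus power_int_of_nat)
    ultimately show ?thesis
      using \<open>v \<noteq> 0\<close> by (simp del: power_inverse add: mult_ac)
  qed
  also have "inf.regular \<dots>"
    using inf.regularI[OF w(1)] inf.regular_intros(10)[OF value_rho lead_coeff_nonzero]
    by (intro inf.regular_intros(2,5,8))
  finally have reg: "inf.regular ((subst_at xgen a + subst_at xgen b * y) / xgen ^ g)"
    unfolding ab .
  \<comment> \<open>A nonzero \<open>b\<close> would need \<open>deg b + g + 1 \<le> g\<close>;
    already y has a pole of order \<open>2g + 1\<close>.\<close>
  have "b = 0"
    using pole_bound(2)[OF reg] by auto
  have value_h: "value_at (Fin x0 d) h (poly a x0)" if "Fin x0 d \<in> points g f" for d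
    using chart_point.regular_value_poly[OF chart_point_at[OF that], of a] ab \<open>b = 0\<close> by simp
  have "poly a x0 = 0"
    using order_at_positive[OF P order_P] n value_h[OF P]
      chart_point.regular_value_unique[OF chart_point_at[OF P]] by auto
  have conj: "Fin x0 (- y0) \<in> points g f" "Fin x0 (- y0) \<noteq> Fin x0 y0"
    using P \<open>y0 \<noteq> 0\<close> by auto
  obtain c where "c \<noteq> 0" "value_at (Fin x0 (- y0)) h c"
    using order_other[OF conj] order_at_0_iff[OF conj(1)] by auto
  then show False
    using value_h[OF conj(1)] \<open>poly a x0 = 0\<close>
      chart_point.regular_value_unique[OF chart_point_at[OF conj(1)]] by auto
qed

end

section \<open>The Galois action\<close>

lemma galois_simps:
  assumes "\<sigma> \<in> galois"
  shows "\<sigma> (a + b) = \<sigma> a + \<sigma> b" "\<sigma> (a * b) = \<sigma> a * \<sigma> b" "\<sigma> (to_ac q) = to_ac q"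
    "\<sigma> 0 = 0" "\<sigma> 1 = 1" "\<sigma> (- a) = - \<sigma> a" "\<sigma> a = 0 \<longleftrightarrow> a = 0" "\<sigma> (a / b) = \<sigma> a / \<sigma> b"
proof -
  show add: "\<sigma> (a + b) = \<sigma> a + \<sigma> b" and mult: "\<sigma> (a * b) = \<sigma> a * \<sigma> b"
    and rat: "\<sigma> (to_ac q) = to_ac q" for a b q
    using assms by (simp_all add: galois_def)
  show 0: "\<sigma> 0 = 0" and 1: "\<sigma> 1 = 1"
    using rat[of 0] rat[of 1] by simp_all
  show "\<sigma> (- a) = - \<sigma> a"
    using add[of a "- a"] 0 by (simp add: eq_neg_iff_add_eq_0 add.commute)
  have "inj \<sigma>"
    using assms by (simp add: galois_def bij_is_inj)
  then show eq0: "\<sigma> a = 0 \<longleftrightarrow> a = 0" for a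
    using 0 by (metis injD)
  show "\<sigma> (a / b) = \<sigma> a / \<sigma> b"
  proof (cases "b = 0")
    case False
    then have "\<sigma> (a / b) * \<sigma> b = \<sigma> a"
      by (simp flip: mult)
    with False eq0 show ?thesis
      by (metis nonzero_eq_divide_eq)
  qed (simp add: 0)
qed

lemma galois_inv:
  assumes "\<sigma> \<in> galois"
  shows "inv_into UNIV \<sigma> \<in> galois" "inv_into UNIV \<sigma> (\<sigma> a) = a" "\<sigma> (inv_into UNIV \<sigma> a) = a"
proof -
  have bij: "bij \<sigma>"
    using assms by (simp add: galois_def)
  show inv1: "inv_into UNIV \<sigma> (\<sigma> a) = a" and inv2: "\<sigma> (inv_into UNIV \<sigma> a) = a" for a
    using bij by (simp_all add: bij_is_inj bij_is_surj surj_f_inv_f)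
  have "inv_into UNIV \<sigma> (a + b) = inv_into UNIV \<sigma> a + inv_into UNIV \<sigma> b" "inv_into UNIV \<sigma> (a * b) = inv_into UNIV \<sigma> a * inv_into UNIV \<sigma> b" for a b
    using galois_simps(1,2)[OF assms, of "inv_into UNIV \<sigma> a" "inv_into UNIV \<sigma> b"] inv1 inv2 by metis+
  moreover have "inv_into UNIV \<sigma> (to_ac q) = to_ac q" for q
    using galois_simps(3)[OF assms] inv1 by metis
  ultimately show "inv_into UNIV \<sigma> \<in> galois"
    using bij by (simp add: galois_def bij_imp_bij_inv)
qed

lemma galois_point_inv:
  assumes "\<sigma> \<in> galois"
  shows "galois_point (inv_into UNIV \<sigma>) (galois_point \<sigma> P) = P" "galois_point \<sigma> (galois_point (inv_into UNIV \<sigma>) P) = P"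
  by (cases P; simp add: galois_inv[OF assms])+

section \<open>Galois action on polynomials and rational functions\<close>

definition galois_poly :: "(qbar \<Rightarrow> qbar) \<Rightarrow> qbar poly \<Rightarrow> qbar poly" where
  "galois_poly \<sigma> p = map_poly \<sigma> p"

lemma galois_poly_simps:
  assumes \<sigma>: "\<sigma> \<in> galois"
  shows "galois_poly \<sigma> 0 = 0" "galois_poly \<sigma> (pCons c p) = pCons (\<sigma> c) (galois_poly \<sigma> p)"
    "galois_poly \<sigma> (p + q) = galois_poly \<sigma> p + galois_poly \<sigma> q"
    "galois_poly \<sigma> (p * q) = galois_poly \<sigma> p * galois_poly \<sigma> q"
    "galois_poly \<sigma> p = 0 \<longleftrightarrow> p = 0" "poly (galois_poly \<sigma> p) (\<sigma> x) = \<sigma> (poly p x)"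
    "galois_poly \<sigma> (geom f) = geom f" "Polynomial.coeff (galois_poly \<sigma> p) n = \<sigma> (Polynomial.coeff p n)"
proof -
  note s = galois_simps[OF \<sigma>]
  show 0: "galois_poly \<sigma> 0 = 0"
    by (simp add: galois_poly_def)
  show c: "galois_poly \<sigma> (pCons c p) = pCons (\<sigma> c) (galois_poly \<sigma> p)" for c p
    by (simp add: galois_poly_def map_poly_pCons s)
  show add: "galois_poly \<sigma> (p + q) = galois_poly \<sigma> p + galois_poly \<sigma> q" for p q
    by (induction p q rule: poly_induct2) (simp_all add: c s 0)
  have smult: "galois_poly \<sigma> (smult a p) = smult (\<sigma> a) (galois_poly \<sigma> p)" for a p
    by (induction p) (simp_all add: c s 0)
  show "galois_poly \<sigma> (p * q) = galois_poly \<sigma> p * galois_poly \<sigma> q"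
    by (induction p) (simp_all add: c s 0 add smult)
  show co: "Polynomial.coeff (galois_poly \<sigma> p) n = \<sigma> (Polynomial.coeff p n)" for p n
    by (simp add: galois_poly_def coeff_map_poly s)
  show "galois_poly \<sigma> p = 0 \<longleftrightarrow> p = 0"
    by (simp add: poly_eq_iff co s)
  show "poly (galois_poly \<sigma> p) (\<sigma> x) = \<sigma> (poly p x)"
    by (induction p) (simp_all add: c s 0)
  show "galois_poly \<sigma> (geom f) = geom f"
    by (simp add: poly_eq_iff co coeff_map_poly s)
qed

lemma galois_poly_inv: "\<sigma> \<in> galois \<Longrightarrow> galois_poly \<sigma> (galois_poly (inv_into UNIV \<sigma>) p) = p"
  by (simp add: poly_eq_iff galois_poly_simps(8) galois_inv)

definition galois_fract :: "(qbar \<Rightarrow> qbar) \<Rightarrow> qbar poly fract \<Rightarrow> qbar poly fract" where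
  "galois_fract \<sigma> r = to_fract (galois_poly \<sigma> (fst (quot_of_fract r))) /
     to_fract (galois_poly \<sigma> (snd (quot_of_fract r)))"

text \<open>The action is defined through the reduced fraction; by cross-multiplication every other
  representation gives the same result.\<close>

lemma galois_fract_divide:
  assumes \<sigma>: "\<sigma> \<in> galois" and "q \<noteq> 0"
  shows "galois_fract \<sigma> (to_fract p / to_fract q) = to_fract (galois_poly \<sigma> p) / to_fract (galois_poly \<sigma> q)"
proof -
  define r where "r = to_fract p / to_fract q"
  define p' q' where "p' = fst (quot_of_fract r)" and "q' = snd (quot_of_fract r)"
  have "r = to_fract p' / to_fract q'"
    by (simp add: p'_def q'_def flip: Fract_conv_to_fract)
  moreover have "q' \<noteq> 0"
    by (simp add: q'_def)
  ultimately have "to_fract (p * q') = to_fract (p' * q)"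
    using assms(2) by (simp add: r_def field_simps)
  then have "galois_poly \<sigma> (p * q') = galois_poly \<sigma> (p' * q)"
    by (simp only: to_fract_eq_iff)
  then have "to_fract (galois_poly \<sigma> p) * to_fract (galois_poly \<sigma> q') =
      to_fract (galois_poly \<sigma> p') * to_fract (galois_poly \<sigma> q)"
    by (simp add: galois_poly_simps[OF \<sigma>] flip: to_fract_mult)
  moreover have "galois_poly \<sigma> q \<noteq> 0" "galois_poly \<sigma> q' \<noteq> 0"
    using assms(2) \<open>q' \<noteq> 0\<close> by (simp_all add: galois_poly_simps[OF \<sigma>])
  ultimately show ?thesis
    unfolding r_def[symmetric] galois_fract_def p'_def[symmetric] q'_def[symmetric]
    by (simp add: frac_eq_eq)
qed

lemma fract_as_quotient: "\<exists>p q. q \<noteq> 0 \<and> r = to_fract p / to_fract q"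
  by (cases r) (metis Fract_conv_to_fract)

lemma galois_fract_simps:
  assumes \<sigma>: "\<sigma> \<in> galois"
  shows "galois_fract \<sigma> (to_fract p) = to_fract (galois_poly \<sigma> p)"
    "galois_fract \<sigma> (r + s) = galois_fract \<sigma> r + galois_fract \<sigma> s"
    "galois_fract \<sigma> (r * s) = galois_fract \<sigma> r * galois_fract \<sigma> s"
    "galois_fract \<sigma> (inverse r) = inverse (galois_fract \<sigma> r)"
    "galois_fract \<sigma> (r / s) = galois_fract \<sigma> r / galois_fract \<sigma> s"
    "galois_fract \<sigma> (r ^ n) = galois_fract \<sigma> r ^ n"
    "galois_fract \<sigma> (galois_fract (inv_into UNIV \<sigma>) r) = r"
proof -
  note g = galois_poly_simps[OF \<sigma>] and d = galois_fract_divide[OF \<sigma>]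
  have one: "galois_poly \<sigma> 1 = 1"
    unfolding one_pCons by (simp add: g galois_simps[OF \<sigma>])
  show p: "galois_fract \<sigma> (to_fract p) = to_fract (galois_poly \<sigma> p)" for p
    using d[of 1 p] by (simp add: one)
  show "galois_fract \<sigma> (r + s) = galois_fract \<sigma> r + galois_fract \<sigma> s"
  proof -
    obtain p q p' q' where *: "q \<noteq> 0" "r = to_fract p / to_fract q" "q' \<noteq> 0" "s = to_fract p' / to_fract q'"
      using fract_as_quotient by metis
    then have rs: "r + s = to_fract (p * q' + p' * q) / to_fract (q * q')"
      by (simp add: field_simps)
    have "galois_fract \<sigma> (r + s) = to_fract (galois_poly \<sigma> (p * q' + p' * q)) / to_fract (galois_poly \<sigma> (q * q'))"
      unfolding rs by (rule d) (use * in simp)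
    also have "\<dots> = galois_fract \<sigma> r + galois_fract \<sigma> s"
      unfolding *(2,4) d[OF *(1)] d[OF *(3)] using *(1,3) by (simp add: g add_frac_eq)
    finally show ?thesis .
  qed
  show mult: "galois_fract \<sigma> (r * s) = galois_fract \<sigma> r * galois_fract \<sigma> s" for r s
  proof -
    obtain p q p' q' where *: "q \<noteq> 0" "r = to_fract p / to_fract q" "q' \<noteq> 0" "s = to_fract p' / to_fract q'"
      using fract_as_quotient by metis
    then have rs: "r * s = to_fract (p * p') / to_fract (q * q')"
      by simp
    have "galois_fract \<sigma> (r * s) = to_fract (galois_poly \<sigma> (p * p')) / to_fract (galois_poly \<sigma> (q * q'))"
      unfolding rs by (rule d) (use * in simp)
    also have "\<dots> = galois_fract \<sigma> r * galois_fract \<sigma> s"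
      using * by (simp add: d g)
    finally show ?thesis .
  qed
  show inv: "galois_fract \<sigma> (inverse r) = inverse (galois_fract \<sigma> r)" for r
  proof (cases "r = 0")
    case True
    then show ?thesis using p[of 0] by (simp add: g)
  next
    case False
    have "galois_fract \<sigma> (inverse r) * galois_fract \<sigma> r = 1"
      using False p[of 1] by (simp add: one flip: mult)
    then show ?thesis by (metis inverse_unique mult.commute)
  qed
  show "galois_fract \<sigma> (r / s) = galois_fract \<sigma> r / galois_fract \<sigma> s"
    by (simp add: divide_inverse mult inv)
  show "galois_fract \<sigma> (r ^ n) = galois_fract \<sigma> r ^ n"
    using p[of 1] by (induction n) (simp_all add: mult one)
  show "galois_fract \<sigma> (galois_fract (inv_into UNIV \<sigma>) r) = r"
  proof -
    obtain p q where *: "q \<noteq> 0" "r = to_fract p / to_fract q"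
      using fract_as_quotient by metis
    have inv: "inv_into UNIV \<sigma> \<in> galois"
      using \<sigma> by (rule galois_inv)
    show ?thesis
      using * by (simp add: galois_fract_divide[OF inv] d galois_poly_simps[OF inv] galois_poly_inv[OF \<sigma>])
  qed
qed

text \<open>The action on coefficients that fixes x and y. It respects the multiplication of the
  function field as soon as the defining polynomial is Galois-stable.\<close>

definition galois_fun :: "(qbar \<Rightarrow> qbar) \<Rightarrow> rat_fun \<Rightarrow> rat_fun" where
  "galois_fun \<sigma> h = (galois_fract \<sigma> (fst h), galois_fract \<sigma> (snd h))"

lemma galois_fun_mult:
  assumes \<sigma>: "\<sigma> \<in> galois" and F: "galois_poly \<sigma> F = F"
  shows "galois_fun \<sigma> (h \<otimes>\<^bsub>function_field F\<^esub> k) = galois_fun \<sigma> h \<otimes>\<^bsub>function_field F\<^esub> galois_fun \<sigma> k"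
  by (cases h; cases k) (simp add: galois_fun_def function_field_def galois_fract_simps[OF \<sigma>] F)

lemma galois_fun_inv: "\<sigma> \<in> galois \<Longrightarrow> galois_fun \<sigma> (galois_fun (inv_into UNIV \<sigma>) h) = h"
  by (simp add: galois_fun_def galois_fract_simps)

lemma galois_fun_nat_pow:
  assumes \<sigma>: "\<sigma> \<in> galois" and F: "galois_poly \<sigma> F = F"
  shows "galois_fun \<sigma> (h [^]\<^bsub>function_field F\<^esub> (n::nat)) = galois_fun \<sigma> h [^]\<^bsub>function_field F\<^esub> n"
proof (induction n)
  case 0
  have "galois_poly \<sigma> 1 = 1"
    unfolding one_pCons by (simp add: galois_poly_simps[OF \<sigma>] galois_simps[OF \<sigma>])
  then show ?case
    using galois_fract_simps(1)[OF \<sigma>, of 1] galois_fract_simps(1)[OF \<sigma>, of 0]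
    by (simp add: galois_fun_def nat_pow_def galois_poly_simps[OF \<sigma>])
qed (simp add: nat_pow_def galois_fun_mult[OF assms])

lemma galois_fract_at_inverse:
  assumes \<sigma>: "\<sigma> \<in> galois"
  shows "galois_fract \<sigma> (at_inverse p) = at_inverse (galois_poly \<sigma> p)"
proof -
  have pCons: "at_inverse (pCons c p) = to_fract [:c:] + inverse (to_fract [:0, 1:]) * at_inverse p" for c p
    by (simp add: at_inverse_def map_poly_pCons)
  have zero: "at_inverse 0 = 0"
    by (simp add: at_inverse_def)
  note s = galois_fract_simps[OF \<sigma>] galois_poly_simps[OF \<sigma>] galois_simps[OF \<sigma>]
  show ?thesis
    using s(1)[of 0] by (induction p) (simp_all add: zero pCons s)
qed

lemma galois_fun_chart_fun:
  assumes \<sigma>: "\<sigma> \<in> galois"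
  shows "galois_fun \<sigma> (chart_fun g P a b) =
    chart_fun g (galois_point \<sigma> P) (galois_poly \<sigma> a) (galois_poly \<sigma> b)"
proof -
  note s = galois_fract_simps[OF \<sigma>] galois_poly_simps[OF \<sigma>] galois_simps[OF \<sigma>]
  show ?thesis
    by (cases P) (simp_all add: galois_fun_def s galois_fract_at_inverse[OF \<sigma>])
qed

lemma galois_chart_val:
  assumes \<sigma>: "\<sigma> \<in> galois"
  shows "chart_val (galois_point \<sigma> P) (galois_poly \<sigma> a) (galois_poly \<sigma> b) = \<sigma> (chart_val P a b)"
proof -
  note s = galois_poly_simps[OF \<sigma>] galois_simps[OF \<sigma>]
  have "poly (galois_poly \<sigma> p) 0 = \<sigma> (poly p 0)" for p
    using s(6)[of p 0] by (simp add: s)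
  then show ?thesis
    by (cases P) (simp_all add: s)
qed

section \<open>Galois action on local rings, orders and divisors\<close>

lemma galois_has_value:
  assumes \<sigma>: "\<sigma> \<in> galois" and F: "galois_poly \<sigma> F = F" and h: "has_value g F P h c"
  shows "has_value g F (galois_point \<sigma> P) (galois_fun \<sigma> h) (\<sigma> c)"
proof -
  obtain a b a' b' where *: "chart_val P a' b' \<noteq> 0"
      "h \<otimes>\<^bsub>function_field F\<^esub> chart_fun g P a' b' = chart_fun g P a b"
      "c = chart_val P a b / chart_val P a' b'"
    using h unfolding has_value_def by blast
  note s = galois_simps[OF \<sigma>]
  show ?thesis
    unfolding has_value_def
  proof (intro exI conjI)
    show "chart_val (galois_point \<sigma> P) (galois_poly \<sigma> a') (galois_poly \<sigma> b') \<noteq> 0"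
      using * by (simp add: galois_chart_val[OF \<sigma>] s)
    show "galois_fun \<sigma> h \<otimes>\<^bsub>function_field F\<^esub>
        chart_fun g (galois_point \<sigma> P) (galois_poly \<sigma> a') (galois_poly \<sigma> b') =
        chart_fun g (galois_point \<sigma> P) (galois_poly \<sigma> a) (galois_poly \<sigma> b)"
      using * by (simp flip: galois_fun_chart_fun[OF \<sigma>] galois_fun_mult[OF \<sigma> F])
    show "\<sigma> c = chart_val (galois_point \<sigma> P) (galois_poly \<sigma> a) (galois_poly \<sigma> b) /
        chart_val (galois_point \<sigma> P) (galois_poly \<sigma> a') (galois_poly \<sigma> b')"
      using * by (simp add: galois_chart_val[OF \<sigma>] s)
  qed
qed

lemma galois_has_value_iff:
  assumes \<sigma>: "\<sigma> \<in> galois" and F: "\<And>\<tau>. \<tau> \<in> galois \<Longrightarrow> galois_poly \<tau> F = F"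
  shows "has_value g F (galois_point \<sigma> P) h (\<sigma> c) \<longleftrightarrow> has_value g F P (galois_fun (inv_into UNIV \<sigma>) h) c"
  using galois_has_value[OF \<sigma> F[OF \<sigma>], of g P "galois_fun (inv_into UNIV \<sigma>) h" c]
    galois_has_value[OF galois_inv(1)[OF \<sigma>] F[OF galois_inv(1)[OF \<sigma>]], of g "galois_point \<sigma> P" h "\<sigma> c"]
  by (auto simp: galois_fun_inv[OF \<sigma>] galois_point_inv[OF \<sigma>] galois_inv[OF \<sigma>])

lemma galois_fun_inv': "\<sigma> \<in> galois \<Longrightarrow> galois_fun (inv_into UNIV \<sigma>) (galois_fun \<sigma> h) = h"
  using galois_fun_inv[OF galois_inv(1), of \<sigma> h]
  by (simp add: galois_def inv_inv_eq)

lemma galois_image: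
  assumes \<sigma>: "\<sigma> \<in> galois" and F: "\<And>\<tau>. \<tau> \<in> galois \<Longrightarrow> galois_poly \<tau> F = F"
  shows "max_ideal g F (galois_point \<sigma> P) = galois_fun \<sigma> ` max_ideal g F P"
    and "local_ring g F (galois_point \<sigma> P) = galois_fun \<sigma> ` local_ring g F P"
    and "local_units g F (galois_point \<sigma> P) = galois_fun \<sigma> ` local_units g F P"
proof -
  note iff = galois_has_value_iff[OF assms]
  have image: "A = galois_fun \<sigma> ` B" if "\<And>h. h \<in> A \<longleftrightarrow> galois_fun (inv_into UNIV \<sigma>) h \<in> B" for A B
  proof (rule equalityI; rule subsetI)
    fix h assume "h \<in> A"
    then show "h \<in> galois_fun \<sigma> ` B"
      using that galois_fun_inv[OF \<sigma>] by (metis image_eqI)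
  next
    fix h assume "h \<in> galois_fun \<sigma> ` B"
    then show "h \<in> A"
      using that galois_fun_inv'[OF \<sigma>] by auto
  qed
  \<comment> \<open>Values move by \<sigma> as well; surjectivity of \<sigma> allows the bound value
    to be renamed.\<close>
  have surj: "(\<exists>c. Q c) \<longleftrightarrow> (\<exists>c. Q (\<sigma> c))" for Q
    using galois_inv(3)[OF \<sigma>] by metis
  show "max_ideal g F (galois_point \<sigma> P) = galois_fun \<sigma> ` max_ideal g F P"
    using iff[of g P _ 0] by (intro image) (simp add: max_ideal_def galois_simps[OF \<sigma>])
  show "local_ring g F (galois_point \<sigma> P) = galois_fun \<sigma> ` local_ring g F P"
    by (intro image) (simp add: local_ring_def surj[of "has_value g F (galois_point \<sigma> P) _"] iff)
  show "local_units g F (galois_point \<sigma> P) = galois_fun \<sigma> ` local_units g F P"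
    by (intro image) (simp add: local_units_def galois_simps[OF \<sigma>] iff
        surj[of "\<lambda>c. c \<noteq> 0 \<and> has_value g F (galois_point \<sigma> P) _ c"])
qed

lemma galois_uniformizer:
  assumes \<sigma>: "\<sigma> \<in> galois" and F: "\<And>\<tau>. \<tau> \<in> galois \<Longrightarrow> galois_poly \<tau> F = F" and t: "uniformizer g F P t"
  shows "uniformizer g F (galois_point \<sigma> P) (galois_fun \<sigma> t)"
proof -
  have "max_ideal g F (galois_point \<sigma> P) = galois_fun \<sigma> ` max_ideal g F P"
    by (rule galois_image(1)[OF \<sigma> F])
  moreover have "local_ring g F (galois_point \<sigma> P) = galois_fun \<sigma> ` local_ring g F P"
    by (rule galois_image(2)[OF \<sigma> F])
  ultimately show ?thesis
    using t unfolding uniformizer_def by (simp add: image_image galois_fun_mult[OF \<sigma> F[OF \<sigma>]])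
qed

lemma galois_point_in_points:
  assumes \<sigma>: "\<sigma> \<in> galois" and F: "galois_poly \<sigma> F = F" and P: "P \<in> points g F"
  shows "galois_point \<sigma> P \<in> points g F"
proof -
  note s = galois_simps[OF \<sigma>]
  have pow: "\<sigma> (a ^ 2) = \<sigma> a ^ 2" for a
    by (simp add: power2_eq_square s)
  have "poly F (\<sigma> x) = \<sigma> (poly F x)" "Polynomial.coeff F n = \<sigma> (Polynomial.coeff F n)" for x n
    using galois_poly_simps(6,8)[OF \<sigma>, of F] F by simp_all
  with P show ?thesis
    unfolding points_def by (cases P) (auto simp flip: pow)
qed

text \<open>As \<open>galois_point \<sigma>\<close> is injective, no two terms of the divisor
  merge.\<close>

lemma lookup_galois_divisor:
  assumes \<sigma>: "\<sigma> \<in> galois"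
  shows "Poly_Mapping.lookup (galois_divisor \<sigma> D) (galois_point \<sigma> P) = Poly_Mapping.lookup D P"
proof -
  have inj: "galois_point \<sigma> Q = galois_point \<sigma> P \<longleftrightarrow> Q = P" for Q
    using galois_point_inv[OF \<sigma>] by metis
  have inj': "galois_point \<sigma> P = galois_point \<sigma> Q \<longleftrightarrow> Q = P" for Q
    using inj by metis
  have "Poly_Mapping.lookup (galois_divisor \<sigma> D) (galois_point \<sigma> P) =
      (\<Sum>Q\<in>Poly_Mapping.keys D. if Q = P then Poly_Mapping.lookup D Q else 0)"
    unfolding galois_divisor_def frag_extend_def
    unfolding lookup_sum by (rule sum.cong) (auto simp: inj inj')
  also have "\<dots> = Poly_Mapping.lookup D P"
    by (simp add: in_keys_iff)
  finally show ?thesis .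
qed

context odd_curve
begin

text \<open>
  Free of inverses, so that it can be transported along \<open>\<sigma>\<close>, which is only known to be multiplicative.
\<close>

lemma has_order_nat:
  assumes P: "P \<in> points g f"
  shows "has_order g f P h n \<longleftrightarrow> (\<exists>t w. uniformizer g f P t \<and> w \<in> local_units g f P \<and>
    (if n \<ge> 0 then h = t [^]\<^bsub>function_field f\<^esub> nat n \<otimes>\<^bsub>function_field f\<^esub> w
     else h \<otimes>\<^bsub>function_field f\<^esub> t [^]\<^bsub>function_field f\<^esub> nat (- n) = w))"
proof -
  have "h = t [^]\<^bsub>function_field f\<^esub> n \<otimes>\<^bsub>function_field f\<^esub> w \<longleftrightarrow>
      (if n \<ge> 0 then h = t [^]\<^bsub>function_field f\<^esub> nat n \<otimes>\<^bsub>function_field f\<^esub> w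
       else h \<otimes>\<^bsub>function_field f\<^esub> t [^]\<^bsub>function_field f\<^esub> nat (- n) = w)"
    if "uniformizer g f P t" for t w
  proof -
    have "embed f t \<noteq> 0"
      using that uniformizer_iff[OF P] chart_point.local_parameter_nonzero[OF chart_point_at[OF P]] by blast
    then show ?thesis
      by (auto simp: inj_eq[OF inj_embed, symmetric] embed_mult embed_int_pow embed_nat_pow
          power_int_def field_simps power_inverse)
  qed
  then show ?thesis
    unfolding has_order_def by blast
qed

lemma galois_has_order:
  assumes \<sigma>: "\<sigma> \<in> galois" and F: "\<And>\<tau>. \<tau> \<in> galois \<Longrightarrow> galois_poly \<tau> f = f"
    and P: "P \<in> points g f" and h: "has_order g f P h n"
  shows "has_order g f (galois_point \<sigma> P) (galois_fun \<sigma> h) n"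
proof -
  obtain t w where *: "uniformizer g f P t" "w \<in> local_units g f P"
    "if n \<ge> 0 then h = t [^]\<^bsub>function_field f\<^esub> nat n \<otimes>\<^bsub>function_field f\<^esub> w
     else h \<otimes>\<^bsub>function_field f\<^esub> t [^]\<^bsub>function_field f\<^esub> nat (- n) = w"
    using h unfolding has_order_nat[OF P] by blast
  have "uniformizer g f (galois_point \<sigma> P) (galois_fun \<sigma> t)"
    by (rule galois_uniformizer) fact+
  moreover have "galois_fun \<sigma> w \<in> local_units g f (galois_point \<sigma> P)"
    using *(2) galois_image(3)[OF \<sigma> F] by simp
  ultimately show ?thesis
    unfolding has_order_nat[OF galois_point_in_points[OF \<sigma> F[OF \<sigma>] P]] using *(3)
    by (intro exI[of _ "galois_fun \<sigma> t"] exI[of _ "galois_fun \<sigma> w"])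
      (auto simp: galois_fun_mult[OF \<sigma> F[OF \<sigma>], symmetric] galois_fun_nat_pow[OF \<sigma> F[OF \<sigma>], symmetric])
qed

lemma galois_principal:
  assumes \<sigma>: "\<sigma> \<in> galois" and F: "\<And>\<tau>. \<tau> \<in> galois \<Longrightarrow> galois_poly \<tau> f = f"
    and D: "D \<in> principal_divisors g f"
  shows "galois_divisor \<sigma> D \<in> principal_divisors g f"
proof -
  obtain h where h: "h \<noteq> (0, 0)" "\<And>P. P \<in> points g f \<Longrightarrow> has_order g f P h (Poly_Mapping.lookup D P)"
    and keys: "Poly_Mapping.keys D \<subseteq> points g f"
    using D unfolding principal_divisors_def by auto
  have "galois_fun \<sigma> h \<noteq> (0, 0)"
  proof
    assume "galois_fun \<sigma> h = (0, 0)"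
    then have "h = galois_fun (inv_into UNIV \<sigma>) (0, 0)"
      using galois_fun_inv'[OF \<sigma>] by metis
    also have "\<dots> = (0, 0)"
      using galois_fract_simps(1)[OF galois_inv(1)[OF \<sigma>], of 0]
        galois_poly_simps(1)[OF galois_inv(1)[OF \<sigma>]] by (simp add: galois_fun_def)
    finally show False using h(1) by simp
  qed
  moreover have "has_order g f Q (galois_fun \<sigma> h) (Poly_Mapping.lookup (galois_divisor \<sigma> D) Q)"
    if Q: "Q \<in> points g f" for Q
  proof -
    have P: "galois_point (inv_into UNIV \<sigma>) Q \<in> points g f"
      by (rule galois_point_in_points[OF galois_inv(1)[OF \<sigma>] F[OF galois_inv(1)[OF \<sigma>]] Q])
    show ?thesis
      using galois_has_order[OF \<sigma> F P h(2)[OF P]] lookup_galois_divisor[OF \<sigma>, of D "galois_point (inv_into UNIV \<sigma>) Q"]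
      by (simp add: galois_point_inv[OF \<sigma>])
  qed
  moreover have "Poly_Mapping.keys (galois_divisor \<sigma> D) \<subseteq> points g f"
    using keys_frag_extend[of "\<lambda>P. frag_of (galois_point \<sigma> P)" D] keys
      galois_point_in_points[OF \<sigma> F[OF \<sigma>]] unfolding galois_divisor_def by fastforce
  ultimately show ?thesis
    unfolding principal_divisors_def
    by (intro CollectI conjI exI[of _ "galois_fun \<sigma> h"] ballI) simp_all
qed

end

section \<open>Rational divisor classes\<close>

lemma divisor_degree_add: "divisor_degree (D + E) = divisor_degree D + divisor_degree E"
proof -
  define A where "A = Poly_Mapping.keys D \<union> Poly_Mapping.keys E"
  have *: "divisor_degree B = (\<Sum>P\<in>A. Poly_Mapping.lookup B P)" if "Poly_Mapping.keys B \<subseteq> A" for B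
    unfolding divisor_degree_def using that
    by (intro sum.mono_neutral_left) (auto simp: A_def in_keys_iff)
  have "Poly_Mapping.keys (D + E) \<subseteq> A"
    unfolding A_def by (rule keys_add)
  then show ?thesis
    using *[of D] *[of E] *[of "D + E"] by (simp add: A_def lookup_add sum.distrib)
qed

lemma divisor_degree_minus: "divisor_degree (- D) = - divisor_degree D"
  by (simp add: divisor_degree_def sum_negf)

lemma divisor_degree_diff_of: "divisor_degree (frag_of P - frag_of Q) = 0"
proof -
  have "divisor_degree (frag_of P) = 1" for P
    by (simp add: divisor_degree_def)
  then show ?thesis
    using divisor_degree_add[of "frag_of P" "- frag_of Q"] divisor_degree_minus[of "frag_of Q"] by simp
qed

lemma galois_divisor_simps:
  "galois_divisor \<sigma> 0 = 0" "galois_divisor \<sigma> (D + E) = galois_divisor \<sigma> D + galois_divisor \<sigma> E"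
  "galois_divisor \<sigma> (- D) = - galois_divisor \<sigma> D"
  "galois_divisor \<sigma> (D - E) = galois_divisor \<sigma> D - galois_divisor \<sigma> E"
  "galois_divisor \<sigma> (frag_of P) = frag_of (galois_point \<sigma> P)"
  by (simp_all add: galois_divisor_def frag_extend_add frag_extend_minus frag_extend_diff)

lemma galois_divisor_inv:
  assumes \<sigma>: "\<sigma> \<in> galois"
  shows "galois_divisor \<sigma> (galois_divisor (inv_into UNIV \<sigma>) D) = D"
proof (rule poly_mapping_eqI)
  fix P
  show "Poly_Mapping.lookup (galois_divisor \<sigma> (galois_divisor (inv_into UNIV \<sigma>) D)) P = Poly_Mapping.lookup D P"
    using lookup_galois_divisor[OF \<sigma>, of "galois_divisor (inv_into UNIV \<sigma>) D" "galois_point (inv_into UNIV \<sigma>) P"]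
      lookup_galois_divisor[OF galois_inv(1)[OF \<sigma>], of D P]
    by (simp add: galois_point_inv[OF \<sigma>])
qed

locale rational_odd_curve = odd_curve g "geom f0" for g :: nat and f0 :: "rat poly"
begin

abbreviation "F \<equiv> geom f0"

abbreviation "divisors \<equiv> free_Abelian_group (points g F)"

abbreviation "principals \<equiv> principal_divisors g F"

lemma normal_principal: "principals \<lhd> divisors"
  by (rule comm_group.subgroup_imp_normal[OF abelian_free_Abelian_group principal_divisors_subgroup])

lemma galois_principal_image:
  assumes \<sigma>: "\<sigma> \<in> galois"
  shows "galois_divisor \<sigma> ` principals = principals"
proof -
  have F: "\<And>\<tau>. \<tau> \<in> galois \<Longrightarrow> galois_poly \<tau> F = F"
    by (rule galois_poly_simps)
  show ?thesis
  proof (rule equalityI; rule subsetI)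
    fix D assume "D \<in> principals"
    then have "galois_divisor (inv_into UNIV \<sigma>) D \<in> principals"
      using galois_principal[OF galois_inv(1)[OF \<sigma>] F] by blast
    then show "D \<in> galois_divisor \<sigma> ` principals"
      using galois_divisor_inv[OF \<sigma>, of D] by (metis image_eqI)
  qed (use galois_principal[OF \<sigma> F] in blast)
qed

lemma group_Pic: "group (Pic g F)"
  unfolding Pic_def by (rule normal.factorgroup_is_group[OF normal_principal])

lemma r_coset_divisors: "principals #>\<^bsub>divisors\<^esub> D = (\<lambda>E. E + D) ` principals"
  unfolding r_coset_def by auto

lemma carrier_Pic: "c \<in> carrier (Pic g F) \<longleftrightarrow> (\<exists>D. Poly_Mapping.keys D \<subseteq> points g F \<and> c = (\<lambda>E. E + D) ` principals)"
  unfolding Pic_def FactGroup_def RCOSETS_def by (auto simp: r_coset_divisors) blast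

lemma mult_Pic: "c \<otimes>\<^bsub>Pic g F\<^esub> d = (\<lambda>(D, E). D + E) ` (c \<times> d)"
  unfolding Pic_def FactGroup_def set_mult_def by auto

lemma one_Pic: "\<one>\<^bsub>Pic g F\<^esub> = principals"
  unfolding Pic_def FactGroup_def by simp

lemma inv_Pic:
  assumes "c \<in> carrier (Pic g F)"
  shows "inv\<^bsub>Pic g F\<^esub> c = uminus ` c"
proof -
  have "Poly_Mapping.keys D \<subseteq> points g F" if D: "D \<in> c" for D
  proof -
    obtain B where B: "Poly_Mapping.keys B \<subseteq> points g F" "c = (\<lambda>E. E + B) ` principals"
      using assms unfolding carrier_Pic by (elim exE conjE)
    with D obtain E where BE: "E \<in> principals" "D = E + B"
      by auto
    then have "Poly_Mapping.keys E \<subseteq> points g F"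
      using subgroup.subset[OF principal_divisors_subgroup] by (auto simp: subset_iff)
    with B(1) BE(2) keys_add[of E B] show ?thesis by blast
  qed
  then have "(\<Union>D\<in>c. {inv\<^bsub>divisors\<^esub> D}) = uminus ` c"
    unfolding UNION_singleton_eq_range by (intro image_cong) simp_all
  then show ?thesis
    using normal.inv_FactGroup[OF normal_principal, of c] assms
    unfolding Pic_def SET_INV_def by simp
qed

text \<open>Needed for \<open>group.ord\<close> to have its usual meaning in the Jacobian.
  Invariance passes to sums and inverses because the Galois action is additive on divisors.\<close>

lemma jacobian_subgroup:
  "subgroup {c \<in> carrier (Pic g F). (\<exists>D\<in>c. divisor_degree D = 0) \<and>
     (\<forall>\<sigma>\<in>galois. galois_divisor \<sigma> ` c = c)} (Pic g F)"
proof (rule group.subgroupI[OF group_Pic])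
  let ?J = "{c \<in> carrier (Pic g F). (\<exists>D\<in>c. divisor_degree D = 0) \<and>
     (\<forall>\<sigma>\<in>galois. galois_divisor \<sigma> ` c = c)}"
  have "\<one>\<^bsub>Pic g F\<^esub> \<in> ?J"
    using group.is_monoid[OF group_Pic] principal_divisors_zero galois_principal_image
    by (auto simp: one_Pic monoid.one_closed divisor_degree_def intro!: bexI[of _ 0]
        simp flip: one_Pic)
  then show "?J \<noteq> {}" by blast
  show "inv\<^bsub>Pic g F\<^esub> c \<in> ?J" if "c \<in> ?J" for c
  proof -
    have "galois_divisor \<sigma> ` uminus ` c = uminus ` galois_divisor \<sigma> ` c" for \<sigma>
      by (simp add: image_image galois_divisor_simps)
    with that group.inv_closed[OF group_Pic, of c] show ?thesis
      by (auto simp: inv_Pic divisor_degree_minus)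
  qed
  show "c \<otimes>\<^bsub>Pic g F\<^esub> d \<in> ?J" if cd: "c \<in> ?J" "d \<in> ?J" for c d
  proof -
    have "galois_divisor \<sigma> ` (\<lambda>(D, E). D + E) ` (c \<times> d) =
        (\<lambda>(D, E). D + E) ` ((galois_divisor \<sigma> ` c) \<times> (galois_divisor \<sigma> ` d))" for \<sigma>
      by (force simp: image_iff galois_divisor_simps)
    moreover have "c \<otimes>\<^bsub>Pic g F\<^esub> d \<in> carrier (Pic g F)"
      using cd monoid.m_closed[OF group.is_monoid[OF group_Pic]] by blast
    moreover obtain D E where "D \<in> c" "E \<in> d" "divisor_degree D = 0" "divisor_degree E = 0"
      using cd by auto
    then have "\<exists>B\<in>(\<lambda>(D, E). D + E) ` (c \<times> d). divisor_degree B = 0"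
      by (intro bexI[of _ "D + E"]) (auto simp: divisor_degree_add)
    ultimately show ?thesis
      using cd by (simp add: mult_Pic)
  qed
qed auto

lemma group_jacobian: "group (jacobian_rational_points g f0)"
  unfolding jacobian_rational_points_def
  by (rule subgroup.subgroup_is_group[OF jacobian_subgroup group_Pic])

definition point_class :: "point \<Rightarrow> (point \<Rightarrow>\<^sub>0 int) set" where
  "point_class P = (\<lambda>E. E + (frag_of P - frag_of (Inf 0))) ` principals"

lemma point_class_in_jacobian:
  assumes P: "P \<in> points g F" and rational: "\<And>\<sigma>. \<sigma> \<in> galois \<Longrightarrow> galois_point \<sigma> P = P"
  shows "point_class P \<in> carrier (jacobian_rational_points g f0)"
proof -
  let ?D = "frag_of P - frag_of (Inf 0)"
  have "Poly_Mapping.keys ?D \<subseteq> points g F"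
    using P Inf_point keys_diff[of "frag_of P" "frag_of (Inf 0)"] by auto
  then have "point_class P \<in> carrier (Pic g F)"
    unfolding carrier_Pic point_class_def by blast
  moreover have "?D \<in> point_class P"
    unfolding point_class_def using principal_divisors_zero by (intro image_eqI[of _ _ 0]) simp_all
  then have "\<exists>D\<in>point_class P. divisor_degree D = 0"
    using divisor_degree_diff_of by blast
  moreover have "galois_divisor \<sigma> ` point_class P = point_class P" if \<sigma>: "\<sigma> \<in> galois" for \<sigma>
  proof -
    have D: "galois_divisor \<sigma> ?D = ?D"
      using rational[OF \<sigma>] galois_simps(4)[OF \<sigma>] by (simp add: galois_divisor_simps)
    have "galois_divisor \<sigma> ` point_class P = (\<lambda>E. E + ?D) ` galois_divisor \<sigma> ` principals"
      unfolding point_class_def image_image by (simp only: galois_divisor_simps(2) D)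
    then show ?thesis
      unfolding galois_principal_image[OF \<sigma>] point_class_def .
  qed
  ultimately show ?thesis
    unfolding jacobian_rational_points_def by simp
qed

text \<open>Turns the order in the Jacobian into a question about functions. Powers in the subgroup
  are those of the Picard group, and passing to cosets is a homomorphism.\<close>

lemma point_class_pow_eq_one_iff:
  assumes P: "P \<in> points g F"
  shows "point_class P [^]\<^bsub>jacobian_rational_points g f0\<^esub> (n::nat) = \<one>\<^bsub>jacobian_rational_points g f0\<^esub> \<longleftrightarrow>
    frag_cmul (int n) (frag_of P - frag_of (Inf 0)) \<in> principals"
proof -
  let ?D = "frag_of P - frag_of (Inf 0)"
  have "Poly_Mapping.keys ?D \<subseteq> points g F"
    using P Inf_point keys_diff[of "frag_of P" "frag_of (Inf 0)"] by auto
  then have D: "?D \<in> carrier divisors" by simp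
  have coset: "principals #>\<^bsub>divisors\<^esub> ?D = point_class P"
    unfolding r_coset_divisors point_class_def ..
  have hom: "(\<lambda>D. principals #>\<^bsub>divisors\<^esub> D) \<in> hom divisors (Pic g F)"
    unfolding Pic_def by (rule normal.r_coset_hom_Mod[OF normal_principal])
  have "point_class P [^]\<^bsub>Pic g F\<^esub> n = principals #>\<^bsub>divisors\<^esub> (?D [^]\<^bsub>divisors\<^esub> n)"
    unfolding coset[symmetric]
    by (rule group_hom.hom_nat_pow[symmetric])
      (use D hom group_Pic in \<open>simp_all add: group_hom_def group_hom_axioms_def\<close>)
  moreover have "principals #>\<^bsub>divisors\<^esub> E = principals \<longleftrightarrow> E \<in> principals" if "E \<in> carrier divisors" for E
    using that group.coset_join1[OF group_free_Abelian_group _ that principal_divisors_subgroup]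
      group.coset_join2[OF group_free_Abelian_group that principal_divisors_subgroup]
      subgroup.subset[OF principal_divisors_subgroup] by blast
  moreover have "?D [^]\<^bsub>divisors\<^esub> n \<in> carrier divisors"
    using monoid.nat_pow_closed[OF group.is_monoid[OF group_free_Abelian_group] D] .
  moreover have "c [^]\<^bsub>jacobian_rational_points g f0\<^esub> n = c [^]\<^bsub>Pic g F\<^esub> n" for c
    unfolding jacobian_rational_points_def by (simp add: nat_pow_def)
  ultimately show ?thesis
    by (simp add: one_Pic jacobian_rational_points_def)
qed

text \<open>A divisor of 15 that divides neither 3 nor 5 is 15 itself. An element of infinite order
  has \<open>ord\<close> 0, which does not divide 15.\<close>

lemma point_class_order_15:
  assumes P: "P \<in> points g F" and rational: "\<And>\<sigma>. \<sigma> \<in> galois \<Longrightarrow> galois_point \<sigma> P = P"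
    and "frag_cmul 15 (frag_of P - frag_of (Inf 0)) \<in> principals"
    and "frag_cmul 3 (frag_of P - frag_of (Inf 0)) \<notin> principals"
    and "frag_cmul 5 (frag_of P - frag_of (Inf 0)) \<notin> principals"
  shows "group.ord (jacobian_rational_points g f0) (point_class P) = 15"
proof -
  interpret J: group "jacobian_rational_points g f0"
    by (rule group_jacobian)
  have iff: "J.ord (point_class P) dvd n \<longleftrightarrow> frag_cmul (int n) (frag_of P - frag_of (Inf 0)) \<in> principals" for n
    using J.pow_eq_id[OF point_class_in_jacobian[OF P rational]] point_class_pow_eq_one_iff[OF P] by blast
  have 15: "J.ord (point_class P) dvd 15" and 3: "\<not> J.ord (point_class P) dvd 3"
    and 5: "\<not> J.ord (point_class P) dvd 5"
    using iff[of 15] iff[of 3] iff[of 5] assms by simp_all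
  define d where "d = J.ord (point_class P)"
  have "d \<le> 15" "d dvd 15" "\<not> d dvd 3" "\<not> d dvd 5"
    using 15 3 5 dvd_imp_le[of d 15] by (simp_all add: d_def)
  moreover have "d = 0 \<or> d = 1 \<or> d = 2 \<or> d = 3 \<or> d = 4 \<or> d = 5 \<or> d = 6 \<or> d = 7 \<or> d = 8 \<or>
      d = 9 \<or> d = 10 \<or> d = 11 \<or> d = 12 \<or> d = 13 \<or> d = 14 \<or> d = 15"
    using \<open>d \<le> 15\<close> by presburger
  ultimately have "d = 15"
    by auto
  then show ?thesis unfolding d_def .
qed

end

section \<open>Isomorphisms of curves\<close>

context odd_curve
begin

section \<open>Comparing functions at almost all points\<close>

lemma finite_points_over: 
  assumes "finite A"
  shows "finite {P \<in> points g f. P = Inf 0 \<or> px P \<in> A}"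
proof -
  have "finite {b. poly [:- poly f a, 0, 1:] b = 0}" for a
    by (rule poly_roots_finite) simp
  then have "finite {b. b ^ 2 = poly f a}" for a
    by (simp add: power2_eq_square eq_neg_iff_add_eq_0 algebra_simps)
  then have "finite (insert (Inf 0) (\<Union>a\<in>A. Fin a ` {b. b ^ 2 = poly f a}))"
    using assms by simp
  moreover have "{P \<in> points g f. P = Inf 0 \<or> px P \<in> A} \<subseteq>
      insert (Inf 0) (\<Union>a\<in>A. Fin a ` {b. b ^ 2 = poly f a})"
  proof
    fix P assume "P \<in> {P \<in> points g f. P = Inf 0 \<or> px P \<in> A}"
    then show "P \<in> insert (Inf 0) (\<Union>a\<in>A. Fin a ` {b. b ^ 2 = poly f a})"
      by (cases P) auto
  qed
  ultimately show ?thesis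
    by (rule finite_subset[rotated])
qed

lemma eventually_px_nonroot:
  assumes "q \<noteq> 0"
  shows "\<forall>\<^sub>F P in cofinite. P \<in> points g f \<longrightarrow> P \<noteq> Inf 0 \<and> poly q (px P) \<noteq> 0"
proof -
  have "{P. \<not> (P \<in> points g f \<longrightarrow> P \<noteq> Inf 0 \<and> poly q (px P) \<noteq> 0)} =
      {P \<in> points g f. P = Inf 0 \<or> px P \<in> {a. poly q a = 0}}"
    by auto
  then show ?thesis
    unfolding eventually_cofinite using finite_points_over[OF poly_roots_finite[OF assms]] by simp
qed

lemma infinite_points: "infinite (points g f)"
proof
  assume "finite (points g f)"
  then have "finite (px ` points g f)" by simp
  moreover have "px ` points g f = UNIV"
  proof (rule UNIV_eq_I[symmetric])
    fix a
    obtain b where "Fin a b \<in> points g f" using point_over_ex by blast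
    then show "a \<in> px ` points g f"
      by (intro image_eqI[of _ _ "Fin a b"]) simp_all
  qed
  ultimately show False
    using infinite_UNIV_char_0 by metis
qed

lemma embed_common_denominator:
  assumes "h \<in> range (embed f)"
  obtains a b q where "q \<noteq> 0" "h * subst_at xgen q = subst_at xgen a + subst_at xgen b * y"
proof -
  obtain r s where h: "h = embed f (r, s)"
    using assms by auto
  obtain p q p' q' where *: "q \<noteq> 0" "r = to_fract p / to_fract q" "q' \<noteq> 0" "s = to_fract p' / to_fract q'"
    using fract_as_quotient by metis
  then have pr: "to_fract p = r * to_fract q" "to_fract p' = s * to_fract q'"
    by simp_all
  have "h * subst_at xgen (q * q') = subst_at xgen (p * q') + subst_at xgen (p' * q) * y"
    unfolding h embed_def subst_at_xgen to_fract_mult to_ac_mult pr by (simp add: algebra_simps)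
  with that[of "q * q'" "p * q'" "p' * q"] * show ?thesis by simp
qed

lemma Fin_of_nonInf: "P \<in> points g f \<Longrightarrow> P \<noteq> Inf 0 \<Longrightarrow> P = Fin (px P) (py P)"
  by (cases P) auto

lemma eventually_regular:
  assumes "h \<in> range (embed f)"
  shows "\<forall>\<^sub>F P in cofinite. P \<in> points g f \<longrightarrow> (\<exists>c. value_at P h c)"
proof -
  obtain a b q where q: "q \<noteq> 0" "h * subst_at xgen q = subst_at xgen a + subst_at xgen b * y"
    using embed_common_denominator[OF assms] by blast
  show ?thesis
    using eventually_px_nonroot[OF q(1)]
  proof eventually_elim
    case (elim P)
    show ?case
    proof
      assume P: "P \<in> points g f"
      then have "P \<noteq> Inf 0" and nz: "poly q (px P) \<noteq> 0"
        using elim by auto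
      then have x: "chart_x P = xgen" and y: "chart_y g f P = y"
        using Fin_of_nonInf[OF P] by (metis chart_x.simps(1), metis chart_y.simps(1))
      interpret chart_point "chart_x P" "chart_y g f P" "chart_equation f P" "px P" "py P"
        by (rule chart_point_at) fact
      have rv: "regular_value (subst_at xgen p) (poly p (px P))" for p
        using regular_value_poly x by simp
      have "regular_value (subst_at xgen a + subst_at xgen b * y) (poly a (px P) + poly b (px P) * py P)"
        using regular_value_Y y by (intro regular_value_add regular_value_mult rv) simp
      then have "regular_value ((subst_at xgen a + subst_at xgen b * y) * inverse (subst_at xgen q))
          ((poly a (px P) + poly b (px P) * py P) * inverse (poly q (px P)))"
        using nz by (intro regular_value_mult regular_value_inverse rv)
      moreover have "h = (subst_at xgen a + subst_at xgen b * y) * inverse (subst_at xgen q)"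
        using q by (simp add: subst_at_xgen_eq_0_iff flip: q(2))
      ultimately show "\<exists>c. value_at P h c" by auto
    qed
  qed
qed

text \<open>Where the function vanishes, so does the norm of its numerator. This norm is a nonzero
  polynomial with finitely many roots, each below finitely many points, but the curve is
  infinite.\<close>

lemma eventually_zero_imp_zero:
  assumes "h \<in> range (embed f)" and zero: "\<forall>\<^sub>F P in cofinite. P \<in> points g f \<longrightarrow> value_at P h 0"
  shows "h = 0"
proof (rule ccontr)
  assume "h \<noteq> 0"
  obtain a b q where q: "q \<noteq> 0" "h * subst_at xgen q = subst_at xgen a + subst_at xgen b * y"
    using embed_common_denominator[OF assms(1)] by blast
  define n where "n = a ^ 2 - b ^ 2 * f"
  have "h * subst_at xgen q \<noteq> 0"
    using \<open>h \<noteq> 0\<close> q(1) by (simp add: subst_at_xgen_eq_0_iff)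
  then have "a \<noteq> 0 \<or> b \<noteq> 0"
    unfolding q(2) by auto
  then have "subst_at xgen a + subst_at xgen b * y \<noteq> 0" "subst_at xgen a + subst_at xgen (- b) * y \<noteq> 0"
    using independent_finite[of a b] independent_finite[of a "- b"] by auto
  then have "subst_at xgen n \<noteq> 0"
  proof -
    have "subst_at xgen n = subst_at xgen a ^ 2 - subst_at xgen b ^ 2 * y ^ 2"
      by (simp add: n_def ygen_square)
    also have "\<dots> = (subst_at xgen a + subst_at xgen b * y) * (subst_at xgen a + subst_at xgen (- b) * y)"
      by (simp add: algebra_simps power2_eq_square)
    finally show ?thesis
      using \<open>subst_at xgen a + subst_at xgen b * y \<noteq> 0\<close> \<open>subst_at xgen a + subst_at xgen (- b) * y \<noteq> 0\<close>
      by simp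
  qed
  then have "n \<noteq> 0" by auto
  have "\<forall>\<^sub>F P in cofinite. P \<notin> points g f"
    using zero eventually_px_nonroot[OF \<open>n \<noteq> 0\<close>]
  proof eventually_elim
    case (elim P)
    show "P \<notin> points g f"
    proof
      assume P: "P \<in> points g f"
      then have "P \<noteq> Inf 0" and nz: "poly n (px P) \<noteq> 0" and z: "value_at P h 0"
        using elim by auto
      then have eq: "P = Fin (px P) (py P)"
        using Fin_of_nonInf[OF P] by simp
      then have x: "chart_x P = xgen" and y: "chart_y g f P = y"
        by (metis chart_x.simps(1), metis chart_y.simps(1))
      have on: "py P ^ 2 = poly f (px P)"
        using P eq by (metis Fin_in_points_iff)
      interpret chart_point "chart_x P" "chart_y g f P" "chart_equation f P" "px P" "py P"
        by (rule chart_point_at) fact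
      have rv: "regular_value (subst_at xgen p) (poly p (px P))" for p
        using regular_value_poly x by simp
      have "regular_value (subst_at xgen a + subst_at xgen b * y) (poly a (px P) + poly b (px P) * py P)"
        using regular_value_Y y by (intro regular_value_add regular_value_mult rv) simp
      moreover have "regular_value (subst_at xgen a + subst_at xgen b * y) (0 * poly q (px P))"
        unfolding q(2)[symmetric] by (intro regular_value_mult rv) (fact z)
      ultimately have "poly a (px P) + poly b (px P) * py P = 0"
        using regular_value_unique by (metis mult_zero_left)
      then have "poly a (px P) = - (poly b (px P) * py P)"
        by (simp add: eq_neg_iff_add_eq_0)
      then have "poly n (px P) = 0"
        by (simp add: n_def power_mult_distrib flip: on)
      with nz show False by simp
    qed
  qed
  then show False
    using infinite_points by (simp add: eventually_cofinite)
qed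

lemma eventually_eq_imp_eq:
  assumes "h \<in> range (embed f)" "k \<in> range (embed f)"
    and "\<forall>\<^sub>F P in cofinite. P \<in> points g f \<longrightarrow> (\<exists>c. value_at P h c \<and> value_at P k c)"
  shows "h = k"
proof -
  have "\<forall>\<^sub>F P in cofinite. P \<in> points g f \<longrightarrow> value_at P (h - k) 0"
    using assms(3)
  proof eventually_elim
    case (elim P)
    then show ?case
      using chart_point.regular_value_diff[OF chart_point_at, of P h _ k] by fastforce
  qed
  then have "h - k = 0"
    using assms by (intro eventually_zero_imp_zero embed_range_diff)
  then show ?thesis by simp
qed

end

section \<open>Pullback of functions along an isomorphism\<close>

locale curve_map = C: odd_curve g f1 + D: odd_curve g f2 for g f1 f2 +
  fixes \<phi> \<psi> :: "point \<Rightarrow> point"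
  assumes \<phi>: "\<And>P. P \<in> points g f1 \<Longrightarrow> \<phi> P \<in> points g f2"
    and \<psi>: "\<And>Q. Q \<in> points g f2 \<Longrightarrow> \<psi> Q \<in> points g f1"
    and \<psi>\<phi>: "\<And>P. P \<in> points g f1 \<Longrightarrow> \<psi> (\<phi> P) = P"
    and \<phi>\<psi>: "\<And>Q. Q \<in> points g f2 \<Longrightarrow> \<phi> (\<psi> Q) = Q"
    and pull: "pulls_back g f1 f2 \<phi>"
    and pull_inv: "pulls_back g f2 f1 \<psi>"

lemma curve_map_inverse: "curve_map g f1 f2 \<phi> \<psi> \<Longrightarrow> curve_map g f2 f1 \<psi> \<phi>"
  by (simp add: curve_map_def curve_map_axioms_def)

lemma pulls_back_compose:
  assumes "pulls_back g f1 f2 \<phi>" "pulls_back g f2 f3 \<psi>"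
    and "\<And>P. P \<in> points g f1 \<Longrightarrow> \<phi> P \<in> points g f2"
  shows "pulls_back g f1 f3 (\<lambda>P. \<psi> (\<phi> P))"
  unfolding pulls_back_def
proof
  fix h
  obtain h' where "\<forall>P\<in>points g f2. \<forall>c. has_value g f3 (\<psi> P) h c \<longrightarrow> has_value g f2 P h' c"
    using assms(2) unfolding pulls_back_def by blast
  moreover obtain h'' where "\<forall>P\<in>points g f1. \<forall>c. has_value g f2 (\<phi> P) h' c \<longrightarrow> has_value g f1 P h'' c"
    using assms(1) unfolding pulls_back_def by blast
  ultimately show "\<exists>h'. \<forall>P\<in>points g f1. \<forall>c. has_value g f3 (\<psi> (\<phi> P)) h c \<longrightarrow> has_value g f1 P h' c"
    using assms(3) by blast
qed

lemma curve_map_compose: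
  assumes "curve_map g f1 f2 \<phi> \<psi>" "curve_map g f2 f3 \<phi>' \<psi>'"
  shows "curve_map g f1 f3 (\<lambda>P. \<phi>' (\<phi> P)) (\<lambda>P. \<psi> (\<psi>' P))"
  using assms unfolding curve_map_def curve_map_axioms_def
  by (auto intro: pulls_back_compose)

context curve_map
begin

text \<open>\<open>pulls_back\<close> provides a function for each \<open>h\<close> separately, with
  no relation between the choices. Compatibility with multiplication and substitution is derived
  from uniqueness.\<close>

definition pullback :: "ambient \<Rightarrow> ambient" where
  "pullback h = (SOME k. k \<in> range (embed f1) \<and>
     (\<forall>P\<in>points g f1. \<forall>c. D.value_at (\<phi> P) h c \<longrightarrow> C.value_at P k c))"

lemma pullback_props:
  assumes "h \<in> range (embed f2)"
  shows "pullback h \<in> range (embed f1)"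
    and "\<And>P c. P \<in> points g f1 \<Longrightarrow> D.value_at (\<phi> P) h c \<Longrightarrow> C.value_at P (pullback h) c"
proof -
  obtain h0 where h0: "h = embed f2 h0"
    using assms by blast
  obtain k0 where k0: "\<forall>P\<in>points g f1. \<forall>c. has_value g f2 (\<phi> P) h0 c \<longrightarrow> has_value g f1 P k0 c"
    using pull unfolding pulls_back_def by blast
  have "\<exists>k. k \<in> range (embed f1) \<and> (\<forall>P\<in>points g f1. \<forall>c. D.value_at (\<phi> P) h c \<longrightarrow> C.value_at P k c)"
    using k0 \<phi> by (intro exI[of _ "embed f1 k0"]) (auto simp: h0 C.has_value_iff D.has_value_iff)
  then have "pullback h \<in> range (embed f1) \<and>
      (\<forall>P\<in>points g f1. \<forall>c. D.value_at (\<phi> P) h c \<longrightarrow> C.value_at P (pullback h) c)"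
    unfolding pullback_def by (rule someI_ex)
  then show "pullback h \<in> range (embed f1)"
    and "\<And>P c. P \<in> points g f1 \<Longrightarrow> D.value_at (\<phi> P) h c \<Longrightarrow> C.value_at P (pullback h) c"
    by blast+
qed

lemma eventually_\<phi>:
  assumes "\<forall>\<^sub>F Q in cofinite. Q \<in> points g f2 \<longrightarrow> R Q"
  shows "\<forall>\<^sub>F P in cofinite. P \<in> points g f1 \<longrightarrow> R (\<phi> P)"
proof -
  have "finite {Q. \<not> (Q \<in> points g f2 \<longrightarrow> R Q)}"
    using assms by (simp add: eventually_cofinite)
  then have "finite (\<psi> ` {Q. \<not> (Q \<in> points g f2 \<longrightarrow> R Q)})"
    by simp
  moreover have "{P. \<not> (P \<in> points g f1 \<longrightarrow> R (\<phi> P))} \<subseteq> \<psi> ` {Q. \<not> (Q \<in> points g f2 \<longrightarrow> R Q)}"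
    using \<phi> \<psi>\<phi> by (auto intro!: image_eqI)
  ultimately show ?thesis
    unfolding eventually_cofinite by (rule finite_subset[rotated])
qed

text \<open>Agreement of values at almost all points determines the pullback; its algebraic
  properties all come from here.\<close>

lemma pullback_eqI:
  assumes "h \<in> range (embed f2)" "k \<in> range (embed f1)"
    and "\<forall>\<^sub>F P in cofinite. P \<in> points g f1 \<longrightarrow> (\<exists>c. D.value_at (\<phi> P) h c \<and> C.value_at P k c)"
  shows "pullback h = k"
proof (rule C.eventually_eq_imp_eq)
  show "pullback h \<in> range (embed f1)" "k \<in> range (embed f1)"
    using assms pullback_props by simp_all
  show "\<forall>\<^sub>F P in cofinite. P \<in> points g f1 \<longrightarrow> (\<exists>c. C.value_at P (pullback h) c \<and> C.value_at P k c)"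
    using assms(3) by eventually_elim (use pullback_props(2)[OF assms(1)] in blast)
qed

lemma pullback_mult:
  assumes "h \<in> range (embed f2)" "k \<in> range (embed f2)"
  shows "pullback (h * k) = pullback h * pullback k"
proof (rule pullback_eqI)
  show "h * k \<in> range (embed f2)" "pullback h * pullback k \<in> range (embed f1)"
    using assms pullback_props(1) by (simp_all add: C.embed_range_mult D.embed_range_mult)
  show "\<forall>\<^sub>F P in cofinite. P \<in> points g f1 \<longrightarrow>
      (\<exists>c. D.value_at (\<phi> P) (h * k) c \<and> C.value_at P (pullback h * pullback k) c)"
    using eventually_\<phi>[OF D.eventually_regular[OF assms(1)]] eventually_\<phi>[OF D.eventually_regular[OF assms(2)]]
  proof eventually_elim
    case (elim P)
    show ?case
    proof
      assume P: "P \<in> points g f1"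
      then obtain c d where "D.value_at (\<phi> P) h c" "D.value_at (\<phi> P) k d"
        using elim by blast
      then show "\<exists>c. D.value_at (\<phi> P) (h * k) c \<and> C.value_at P (pullback h * pullback k) c"
        using pullback_props(2)[OF assms(1) P] pullback_props(2)[OF assms(2) P]
          chart_point.regular_value_mult[OF C.chart_point_at[OF P]]
          chart_point.regular_value_mult[OF D.chart_point_at[OF \<phi>[OF P]]] by blast
    qed
  qed
qed

lemma pullback_power:
  assumes "h \<in> range (embed f2)"
  shows "pullback (h ^ Suc n) = pullback h ^ Suc n"
proof (induction n)
  case (Suc n)
  have "pullback (h * h ^ Suc n) = pullback h * pullback (h ^ Suc n)"
    using assms by (intro pullback_mult D.embed_range_power)
  with Suc show ?case
    by (metis power_Suc)
qed simp

lemma pullback_subst_at: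
  assumes "h \<in> range (embed f2)" "subst_at h p \<in> range (embed f2)" "subst_at (pullback h) p \<in> range (embed f1)"
  shows "pullback (subst_at h p) = subst_at (pullback h) p"
proof (rule pullback_eqI[OF assms(2,3)])
  show "\<forall>\<^sub>F P in cofinite. P \<in> points g f1 \<longrightarrow>
      (\<exists>c. D.value_at (\<phi> P) (subst_at h p) c \<and> C.value_at P (subst_at (pullback h) p) c)"
    using eventually_\<phi>[OF D.eventually_regular[OF assms(1)]]
  proof eventually_elim
    case (elim P)
    then show ?case
      using pullback_props(2)[OF assms(1)]
        chart_point.regular_value_subst_at[OF C.chart_point_at]
        chart_point.regular_value_subst_at[OF D.chart_point_at[OF \<phi>]] by blast
  qed
qed

lemma pullback_inverse_pullback:
  assumes "h \<in> range (embed f1)"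
  shows "pullback (curve_map.pullback g f2 f1 \<psi> h) = h"
proof -
  interpret inv: curve_map g f2 f1 \<psi> \<phi>
    by (rule curve_map_inverse) (rule curve_map_axioms)
  show ?thesis
  proof (rule pullback_eqI)
    show "inv.pullback h \<in> range (embed f2)" "h \<in> range (embed f1)"
      using assms inv.pullback_props by simp_all
    show "\<forall>\<^sub>F P in cofinite. P \<in> points g f1 \<longrightarrow> (\<exists>c. D.value_at (\<phi> P) (inv.pullback h) c \<and> C.value_at P h c)"
      using C.eventually_regular[OF assms]
    proof eventually_elim
      case (elim P)
      then show ?case
        using inv.pullback_props(2)[OF assms, of "\<phi> P"] \<phi> \<psi>\<phi> by metis
    qed
  qed
qed

section \<open>The preimage of infinity\<close>

definition base :: point where
  "base = \<psi> (Inf 0)"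

lemma base: "base \<in> points g f1" "\<phi> base = Inf 0"
  unfolding base_def using \<psi> \<phi>\<psi> by simp_all

lemma not_base: "P \<in> points g f1 \<Longrightarrow> P \<noteq> base \<Longrightarrow> \<phi> P \<in> points g f2 \<and> \<phi> P \<noteq> Inf 0"
  unfolding base_def using \<phi> \<psi>\<phi> by metis

definition x' :: ambient where "x' = pullback xgen"
definition y' :: ambient where "y' = pullback D.y"
definition v' :: ambient where "v' = pullback D.v"

lemma v_in_range: "D.v \<in> range (embed f2)"
  by (intro D.embed_range_divide D.embed_range_power D.embed_range_simps)

lemma rho_in_range: "D.rho \<in> range (embed f2)"
  using D.value_at_in_range[OF D.Inf_point, of D.rho] D.value_rho by simp

lemma x'_in_range: "x' \<in> range (embed f1)" and y'_in_range: "y' \<in> range (embed f1)"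
  unfolding x'_def y'_def by (intro pullback_props D.embed_range_simps)+

lemma x'_regular: "P \<in> points g f1 \<Longrightarrow> P \<noteq> base \<Longrightarrow> C.regular_at P x'"
  and y'_regular: "P \<in> points g f1 \<Longrightarrow> P \<noteq> base \<Longrightarrow> C.regular_at P y'"
proof -
  assume P: "P \<in> points g f1" "P \<noteq> base"
  then obtain a b where Q: "\<phi> P = Fin a b" "\<phi> P \<in> points g f2"
    using not_base[OF P] D.Fin_of_nonInf by metis
  have "D.value_at (\<phi> P) xgen a" "D.value_at (\<phi> P) D.y b"
    using chart_point.regular_value_X[OF D.chart_point_at[OF Q(2)]]
      chart_point.regular_value_Y[OF D.chart_point_at[OF Q(2)]] by (simp_all add: Q(1))
  then have "C.value_at P x' a" "C.value_at P y' b"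
    unfolding x'_def y'_def using pullback_props(2)[OF _ P(1)] D.embed_range_simps by blast+
  then show "C.regular_at P x'" "C.regular_at P y'"
    using chart_point.regularI[OF C.chart_point_at[OF P(1)]] by blast+
qed

lemma y'_eq: "y' = v' * x' ^ (g + 1)"
proof -
  have "pullback (D.v * xgen ^ (g + 1)) = v' * x' ^ (g + 1)"
    unfolding v'_def x'_def using pullback_power[of xgen g] v_in_range D.embed_range_simps(2)
    by (simp only: pullback_mult D.embed_range_power Suc_eq_plus1)
  then show ?thesis
    unfolding y'_def by simp
qed

text \<open>
  This lemma and the next say that \<open>v'\<close> is a local parameter at the base point and that \<open>x'\<close> has a
  pole of order 2 there.
\<close>

lemma x'_v'_unit:
  obtains c where "C.value_at base (x' * v' ^ 2) c" "c \<noteq> 0"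
proof -
  have rho: "D.rho = xgen * D.v ^ 2"
    unfolding D.v_square by simp
  have "pullback (D.v ^ 2) = v' ^ 2"
    using pullback_power[OF v_in_range, of 1] unfolding v'_def numeral_2_eq_2 by simp
  then have "pullback D.rho = x' * v' ^ 2"
    unfolding rho x'_def using pullback_mult[OF D.embed_range_simps(2) D.embed_range_power[OF v_in_range]]
    by simp
  moreover have "D.value_at (\<phi> base) D.rho (lead_coeff f2)"
    using D.value_rho by (simp add: base)
  ultimately show ?thesis
    using pullback_props(2)[OF rho_in_range base(1)] D.lead_coeff_nonzero that by metis
qed

lemma divisible_by_v':
  assumes "C.value_at base t 0"
  obtains r where "C.regular_at base r" "t = v' * r"
proof -
  interpret inv: curve_map g f2 f1 \<psi> \<phi>
    by (rule curve_map_inverse) (rule curve_map_axioms)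
  have t: "t \<in> range (embed f1)"
    using C.value_at_in_range[OF base(1) assms] .
  have "D.value_at (Inf 0) (inv.pullback t) 0"
    using inv.pullback_props(2)[OF t D.Inf_point] assms by (simp add: base_def)
  then have "D.inf.regular_value (inv.pullback t) 0" by simp
  then obtain s c where s: "D.inf.regular_value s c" "inv.pullback t = D.v * s"
    using D.parameter_infinity unfolding D.inf.local_parameter_def D.inf.regular_def by blast
  have sv: "D.value_at (\<phi> base) s c"
    using s(1) by (simp add: base)
  then have s_range: "s \<in> range (embed f2)"
    using D.value_at_in_range[OF D.Inf_point, of s c] by (simp add: base)
  have "t = pullback (inv.pullback t)"
    using pullback_inverse_pullback[OF t] by simp
  also have "\<dots> = v' * pullback s"
    unfolding s(2) v'_def by (rule pullback_mult[OF v_in_range s_range])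
  finally have "t = v' * pullback s" .
  moreover have "C.regular_at base (pullback s)"
    using pullback_props(2)[OF s_range base(1) sv] chart_point.regularI[OF C.chart_point_at[OF base(1)]]
    by blast
  ultimately show ?thesis using that by blast
qed

text \<open>Pulling back along the inverse map would make \<open>xgen\<close> itself
  constant.\<close>

lemma x'_not_const: "x' \<noteq> kconst c"
proof
  assume c: "x' = kconst c"
  interpret inv: curve_map g f2 f1 \<psi> \<phi>
    by (rule curve_map_inverse) (rule curve_map_axioms)
  have "xgen = inv.pullback x'"
    unfolding x'_def using inv.pullback_inverse_pullback[of xgen] D.embed_range_simps(2) by simp
  also have "\<dots> = kconst c"
    unfolding c
  proof (rule inv.pullback_eqI)
    show "\<forall>\<^sub>F P in cofinite. P \<in> points g f2 \<longrightarrow> (\<exists>d. C.value_at (\<psi> P) (kconst c) d \<and> D.value_at P (kconst c) d)"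
      using chart_point.regular_value_const[OF C.chart_point_at[OF \<psi>]]
        chart_point.regular_value_const[OF D.chart_point_at] by (intro always_eventually) blast
  qed (rule C.embed_range_simps D.embed_range_simps)+
  finally have "subst_at xgen [:- c, 1:] = 0" by simp
  then show False
    by (simp add: subst_at_xgen_eq_0_iff del: subst_at_pCons)
qed

lemma y'_square: "x' = subst_at xgen a \<Longrightarrow> y' ^ 2 = subst_at xgen (pcompose f2 a)"
proof -
  assume a: "x' = subst_at xgen a"
  have "y' ^ 2 = pullback (D.y ^ 2)"
    unfolding y'_def using pullback_power[of D.y 1] D.embed_range_simps(3) by (simp add: numeral_2_eq_2)
  also have "\<dots> = pullback (subst_at xgen f2)"
    by (simp add: ygen_square)
  also have "\<dots> = subst_at x' f2"
    unfolding x'_def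
  proof (rule pullback_subst_at)
    show "subst_at (pullback xgen) f2 \<in> range (embed f1)"
      using C.embed_range_simps(1)[of "pcompose f2 a"] a unfolding x'_def by (simp add: subst_at_pcompose)
  qed (rule D.embed_range_simps)+
  finally show ?thesis
    unfolding a subst_at_pcompose .
qed

text \<open>The pulled-back coordinates are regular on the affine part. Their poles at infinity are
  at most those of x and \<open>x^(g+1)\<close>, so \<open>x'\<close> is a linear polynomial in x
  and \<open>y' = c + \<delta> y\<close>. Comparing \<open>y'^2\<close> with \<open>f2\<close>
  evaluated at \<open>x'\<close> gives \<open>c \<delta> = 0\<close>, and \<gamma> is
  \<open>\<delta>^2\<close>.\<close>

theorem base_infinity_imp_affine:
  assumes "base = Inf 0" "g \<ge> 1"
  obtains \<alpha> \<beta> \<gamma> where "\<alpha> \<noteq> 0" "\<gamma> \<noteq> 0" "smult \<gamma> f1 = pcompose f2 [:\<beta>, \<alpha>:]"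
proof -
  have "C.value_at base C.v 0"
    using C.inf.regular_value_Y by (simp add: assms(1))
  then obtain r where r: "C.regular_at base r" "C.v = v' * r"
    using divisible_by_v' by blast
  have r_reg: "C.inf.regular r"
    using r(1) by (simp add: assms(1))
  obtain c where c: "C.value_at base (x' * v' ^ 2) c"
    using x'_v'_unit by blast
  have xv: "C.inf.regular (x' * v' ^ 2)"
    using C.inf.regularI[of "x' * v' ^ 2" c] c by (simp add: assms(1))
  have inv_rho: "C.inf.regular (inverse C.rho)"
    by (rule C.inf.regular_intros(10)[OF C.value_rho C.lead_coeff_nonzero])
  \<comment> \<open>The own coordinate \<open>v\<close> of the source vanishes at infinity and so is
    a multiple of \<open>v'\<close>. This bounds the pole of \<open>x'\<close>, of order 2 in terms
    of \<open>v'\<close>, by that of x.\<close>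
  have inv_x: "inverse xgen = (v' * r) ^ 2 * inverse C.rho"
    unfolding r(2)[symmetric] by (rule C.inverse_xgen_eq)
  have "x' / xgen = x' * v' ^ 2 * r ^ 2 * inverse C.rho"
    unfolding divide_inverse[of x' xgen] inv_x by (simp add: power_mult_distrib mult_ac)
  then have x'x: "C.inf.regular (x' / xgen)"
    using xv r_reg inv_rho by (simp only: C.inf.regular_intros(2,5))
  have reg_v': "C.inf.regular v'"
  proof -
    have "D.value_at (\<phi> base) D.v 0"
      using D.inf.regular_value_Y by (simp add: base)
    then have "C.value_at base v' 0"
      unfolding v'_def by (rule pullback_props(2)[OF v_in_range base(1)])
    then show ?thesis
      using C.inf.regularI[of v' 0] by (simp add: assms(1))
  qed
  have "y' / xgen ^ (g + 1) = v' * (x' / xgen) ^ (g + 1)"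
    unfolding y'_eq power_divide by simp
  then have y'x: "C.inf.regular (y' / xgen ^ (g + 1))"
    using x'x reg_v' by (simp only: C.inf.regular_intros(2,5))
  obtain a b where ab: "x' = subst_at xgen a + subst_at xgen b * C.y"
    using C.finite_regular_imp_polynomial[OF x'_in_range] x'_regular assms(1) by metis
  obtain c d where cd: "y' = subst_at xgen c + subst_at xgen d * C.y"
    using C.finite_regular_imp_polynomial[OF y'_in_range] y'_regular assms(1) by metis
  have "Polynomial.degree a \<le> 1" "b = 0"
    using C.pole_bound[of a b 1] x'x \<open>g \<ge> 1\<close> by (auto simp flip: ab)
  have "Polynomial.degree d = 0"
    using C.pole_bound(2)[of c d "g + 1"] y'x by (auto simp flip: cd)
  then obtain \<delta> where \<delta>: "d = [:\<delta>:]"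
    by (metis degree_eq_zeroE)
  have "y' ^ 2 = subst_at xgen (pcompose f2 a)"
    using ab \<open>b = 0\<close> by (intro y'_square) simp
  moreover have "y' ^ 2 = subst_at xgen (c ^ 2 + d ^ 2 * f1) + subst_at xgen (2 * c * d) * C.y"
  proof -
    have "subst_at xgen 2 = 2"
      using subst_at_add[of xgen 1 1] by simp
    moreover have "y' ^ 2 = subst_at xgen c ^ 2 + subst_at xgen d ^ 2 * C.y ^ 2 + 2 * subst_at xgen c * subst_at xgen d * C.y"
      unfolding cd by (simp add: power2_eq_square algebra_simps)
    ultimately show ?thesis
      by (simp add: ygen_square)
  qed
  ultimately have sum: "subst_at xgen (c ^ 2 + d ^ 2 * f1) + subst_at xgen (2 * c * d) * C.y =
      subst_at xgen (pcompose f2 a)"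
    by (simp only:)
  have "p - r + q = 0" if "p + q = r" for p q r :: ambient
    using that by auto
  from this[OF sum] have "subst_at xgen (c ^ 2 + d ^ 2 * f1 - pcompose f2 a) + subst_at xgen (2 * c * d) * C.y = 0"
    unfolding subst_at_diff .
  then have eq: "c ^ 2 + d ^ 2 * f1 = pcompose f2 a" and "2 * c * d = 0"
    using C.independent_finite by fastforce+
  then have "c = 0 \<or> d = 0"
    by simp
  have "Polynomial.degree a = 1"
  proof (rule ccontr)
    assume "Polynomial.degree a \<noteq> 1"
    then have "Polynomial.degree a = 0"
      using \<open>Polynomial.degree a \<le> 1\<close> by simp
    then obtain e where "a = [:e:]" by (metis degree_eq_zeroE)
    then show False
      using ab \<open>b = 0\<close> x'_not_const[of e] by simp
  qed
  then have deg: "Polynomial.degree (pcompose f2 a) = 2 * g + 1"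
    using D.degree_f by (simp add: degree_pcompose)
  \<comment> \<open>Otherwise the square of \<open>c\<close> would have odd degree.\<close>
  have "d \<noteq> 0"
  proof
    assume "d = 0"
    then have "Polynomial.degree (c ^ 2) = 2 * g + 1"
      using eq deg by simp
    moreover have "c \<noteq> 0"
      using calculation by auto
    ultimately have "2 * Polynomial.degree c = 2 * g + 1"
      by (simp add: degree_power_eq)
    then show False by presburger
  qed
  with \<open>c = 0 \<or> d = 0\<close> eq \<delta> have "smult (\<delta> ^ 2) f1 = pcompose f2 a" "\<delta> \<noteq> 0"
    by (auto simp: power2_eq_square)
  moreover obtain \<alpha> \<beta> where "a = [:\<beta>, \<alpha>:]" "\<alpha> \<noteq> 0"
    using \<open>Polynomial.degree a = 1\<close> by (rule degree1_coeffs) auto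
  ultimately show ?thesis
    using that[of \<alpha> "\<delta> ^ 2" \<beta>] by simp
qed

text \<open>If the base point were finite with \<open>y0\<close> nonzero,
  \<open>(x - x0)^2 x'\<close> would be a polynomial in x of degree at most 2. But \<open>x'\<close>
  is regular at the conjugate point, where \<open>x - x0\<close> vanishes too, so both factors
  \<open>x - x0\<close> cancel and \<open>x'\<close> is constant. In genus 1 the conclusion fails,
  because translations move infinity anywhere.\<close>

theorem base_weierstrass:
  assumes "g \<ge> 2"
  shows "base = Inf 0 \<or> py base = 0"
proof (rule ccontr)
  assume contra: "\<not> (base = Inf 0 \<or> py base = 0)"
  obtain x0 y0 where xy: "base = Fin x0 y0"
    using contra base(1) C.Fin_of_nonInf by blast
  have "y0 \<noteq> 0"
    using contra xy by simp
  define t where "t = xgen - kconst x0"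
  have P: "Fin x0 y0 \<in> points g f1"
    using base(1) xy by simp
  have tv: "C.value_at (Fin a b) t (a - x0)" if "Fin a b \<in> points g f1" for a b
    using chart_point.regular_value_diff[OF C.chart_point_at[OF that]
        chart_point.regular_value_X[OF C.chart_point_at[OF that]]
        chart_point.regular_value_const[OF C.chart_point_at[OF that], of x0]]
    by (simp add: t_def)
  have "C.value_at base t 0"
    using tv[OF P] by (simp add: xy)
  then obtain r where r: "C.regular_at base r" "t = v' * r"
    using divisible_by_v' by blast
  obtain c where c: "C.value_at base (x' * v' ^ 2) c"
    using x'_v'_unit by blast
  have "C.regular_at P (t ^ 2 * x')" if "P \<in> points g f1" "P \<noteq> Inf 0" for P
  proof -
    interpret chart_point "chart_x P" "chart_y g f1 P" "chart_equation f1 P" "px P" "py P"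
      by (rule C.chart_point_at) fact
    show ?thesis
    proof (cases "P = base")
      case True
      have "t ^ 2 * x' = x' * v' ^ 2 * r ^ 2"
        unfolding r(2) by (simp add: power_mult_distrib mult_ac)
      moreover have "regular (x' * v' ^ 2)" "regular r"
        using r(1) c True regularI by blast+
      ultimately show ?thesis
        by (simp only: regular_intros(2,5))
    next
      case False
      have "regular t"
        using tv[of "px P" "py P"] C.Fin_of_nonInf[OF that] that regularI by metis
      with x'_regular[OF that(1) False] show ?thesis
        by (blast intro: regular_intros)
    qed
  qed
  moreover have "t ^ 2 * x' \<in> range (embed f1)"
    unfolding t_def
    by (intro C.embed_range_mult C.embed_range_power C.embed_range_diff C.embed_range_simps x'_in_range)
  ultimately obtain a b where ab: "t ^ 2 * x' = subst_at xgen a + subst_at xgen b * C.y"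
    using C.finite_regular_imp_polynomial by blast
  have "C.regular_at (Inf 0) x'"
    using x'_regular[OF C.Inf_point] xy by simp
  then have "C.inf.regular x'" by simp
  moreover have t_inv: "t * inverse xgen = kconst 1 - kconst x0 * inverse xgen"
    by (simp add: t_def left_diff_distrib)
  have "C.inf.regular (t * inverse xgen)"
    unfolding t_inv by (intro C.inf.regular_intros(2,3,7,9))
  ultimately have "C.inf.regular ((t * inverse xgen) ^ 2 * x')"
    by (simp only: C.inf.regular_intros(2,5))
  moreover have "(t * inverse xgen) ^ 2 * x' = (t ^ 2 * x') / xgen ^ 2"
    by (simp add: power_mult_distrib divide_inverse power_inverse)
  ultimately have reg: "C.inf.regular ((subst_at xgen a + subst_at xgen b * C.y) / xgen ^ 2)"
    by (simp add: ab)
  \<comment> \<open>A nonzero \<open>b\<close> would give \<open>g + 1 \<le> 2\<close>.\<close>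
  have "Polynomial.degree a \<le> 2" "b = 0"
    using C.pole_bound[OF reg] \<open>g \<ge> 2\<close> by auto
  have conj: "Fin x0 (- y0) \<in> points g f1" "Fin x0 (- y0) \<noteq> base"
    using P \<open>y0 \<noteq> 0\<close> xy by auto
  interpret chart_point "chart_x (Fin x0 (- y0))" "chart_y g f1 (Fin x0 (- y0))"
      "chart_equation f1 (Fin x0 (- y0))" "px (Fin x0 (- y0))" "py (Fin x0 (- y0))"
    by (rule C.chart_point_at) fact
  have divides: "[:- x0, 1:] dvd q" if "regular h" "t * h = subst_at xgen q" for h q
  proof -
    obtain d where "regular_value h d"
      using \<open>regular h\<close> unfolding regular_def by blast
    then have "regular_value (subst_at xgen q) ((x0 - x0) * d)"
      unfolding that(2)[symmetric] by (rule regular_value_mult[OF tv[OF conj(1)]])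
    moreover have "regular_value (subst_at xgen q) (poly q x0)"
      using regular_value_poly by simp
    ultimately have "poly q x0 = 0"
      using regular_value_unique by (metis diff_self mult_zero_left)
    then show ?thesis by (simp add: poly_eq_0_iff_dvd)
  qed
  have t: "t = subst_at xgen [:- x0, 1:]"
    by (simp add: t_def)
  have "t \<noteq> 0"
    unfolding t by (simp add: subst_at_xgen_eq_0_iff del: subst_at_pCons)
  have "regular x'"
    using x'_regular conj by blast
  moreover have "regular t"
    using regularI[OF tv[OF conj(1)]] .
  ultimately have "regular (t * x')"
    by (rule regular_intros(2)[rotated])
  then have "[:- x0, 1:] dvd a"
    using divides[of "t * x'" a] ab \<open>b = 0\<close> by (simp add: power2_eq_square mult.assoc)
  then obtain q where q: "a = [:- x0, 1:] * q" by (rule dvdE)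
  have "t * (t * x') = t * subst_at xgen q"
    using ab \<open>b = 0\<close> unfolding q subst_at_mult t[symmetric] by (simp add: power2_eq_square mult.assoc)
  then have tx: "t * x' = subst_at xgen q"
    using \<open>t \<noteq> 0\<close> by simp
  then have "[:- x0, 1:] dvd q"
    using divides \<open>regular x'\<close> by blast
  then obtain k where k: "q = [:- x0, 1:] * k" by (rule dvdE)
  have "t * x' = t * subst_at xgen k"
    using tx unfolding k subst_at_mult t[symmetric] .
  then have x'k: "x' = subst_at xgen k"
    using \<open>t \<noteq> 0\<close> by simp
  have "Polynomial.degree k = 0"
  proof (cases "k = 0")
    case False
    have "Polynomial.degree ([:- x0, 1:] * m) = Suc (Polynomial.degree m)" if "m \<noteq> 0" for m
      by (subst degree_mult_eq) (use that in simp_all)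
    then have "Polynomial.degree a = Suc (Suc (Polynomial.degree k))"
      using False unfolding q k by (simp del: mult_pCons_left)
    with \<open>Polynomial.degree a \<le> 2\<close> show ?thesis by simp
  qed simp
  then obtain e where "k = [:e:]" by (metis degree_eq_zeroE)
  then show False
    using x'k x'_not_const[of e] by simp
qed

end

section \<open>The family\<close>

text \<open>
  The first six coefficients are \<open>15/2 gchoose k\<close> for \<open>k \<le> 5\<close>.
\<close>

definition family_sqrt :: "'a::field_char_0 \<Rightarrow> 'a poly" where
  "family_sqrt l = [:1, 15/2, 195/8, 715/16, 6435/128, 9009/256, l:]"

text \<open>The quotient \<open>(a^2 - (1 + x)^15) / x^6\<close> written out. As \<open>a^2\<close>
  has degree 12, it contributes only up to \<open>x^6\<close>; the coefficients -105, -15, -1 above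
  are negated binomial coefficients of 15.\<close>

definition family_poly :: "'a::field_char_0 \<Rightarrow> 'a poly" where
  "family_poly l = [:2 * l - 15015/512, 15 * l - 57915/256, 195/4 * l - 12490335/16384,
     715/8 * l - 24029005/16384, 6435/64 * l - 115642527/65536, 9009/128 * l - 1365,
     l ^ 2 - 455, - 105, - 15, - 1:]"

lemma family_identity: "family_sqrt l ^ 2 - [:0, 0, 0, 1:] ^ 2 * family_poly l = [:1, 1:] ^ 15"
  by (simp add: family_sqrt_def family_poly_def eval_nat_numeral algebra_simps)

lemma family_identity_at: "poly (family_sqrt l) x ^ 2 - x ^ 6 * poly (family_poly l) x = (1 + x) ^ 15"
proof -
  have "poly (family_sqrt l ^ 2 - [:0, 0, 0, 1:] ^ 2 * family_poly l) x = poly ([:1, 1:] ^ 15) x"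
    unfolding family_identity ..
  moreover have "poly [:0, 0, 0, 1:] x = x ^ 3" "poly [:1, 1:] x = 1 + x"
    by (simp_all add: power3_eq_cube)
  ultimately show ?thesis
    by (simp only: poly_diff poly_mult poly_power) (simp flip: power_mult)
qed

lemma degree_family_poly: "Polynomial.degree (family_poly l) = 9"
  by (simp add: family_poly_def)

text \<open>
  \<open>(1 + x)^(15/2)\<close> solves \<open>15 a = 2 (1 + x) a'\<close>, so only the two top coefficients survive.  A double
  root of \<open>f\<close> is a root of the right-hand side, which makes it explicit.
\<close>

lemma family_sqrt_ode:
  "[:15:] * family_sqrt l - [:2, 2:] * pderiv (family_sqrt l) = [:0, 0, 0, 0, 0, 45045/256 - 12 * l, 3 * l:]"
  by (simp add: family_sqrt_def pderiv_pCons algebra_simps)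

lemma family_double_root:
  assumes "poly (family_poly l) x = 0" "poly (pderiv (family_poly l)) x = 0"
  shows "x = 0 \<or> poly (family_sqrt l) x = 0 \<or> 45045/256 - 12 * l + 3 * l * x = 0"
proof -
  define A A' where "A = poly (family_sqrt l) x" and "A' = poly (pderiv (family_sqrt l)) x"
  have sq: "A ^ 2 = (1 + x) ^ 15"
    using family_identity_at[of l x] assms(1) by (simp add: A_def)
  have "poly (pderiv (family_sqrt l ^ 2 - [:0, 0, 0, 1:] ^ 2 * family_poly l)) x = poly (pderiv ([:1, 1:] ^ 15)) x"
    unfolding family_identity ..
  \<comment> \<open>At a double root both \<open>x^6 f\<close> and its derivative vanish, so the
    identity and its derivative determine \<open>A^2\<close> and \<open>2 A A'\<close>.\<close>
  then have d: "2 * A * A' = 15 * (1 + x) ^ 14"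
    using assms unfolding A_def A'_def
    by (simp add: pderiv_diff pderiv_mult pderiv_power pderiv_pCons mult.assoc)
  have ode: "15 * A - (2 + 2 * x) * A' = x ^ 5 * (45045/256 - 12 * l + 3 * l * x)"
    using arg_cong[OF family_sqrt_ode[of l], of "\<lambda>p. poly p x"] unfolding A_def A'_def
    by (simp add: eval_nat_numeral algebra_simps del: mult_cancel_left)
  \<comment> \<open>Multiplying the differential relation by \<open>A\<close> leaves only
    \<open>A^2\<close> and \<open>2 A A'\<close>, which are explicit powers of \<open>1 + x\<close>
    and cancel.\<close>
  have "A * (x ^ 5 * (45045/256 - 12 * l + 3 * l * x)) = 15 * A ^ 2 - (1 + x) * (2 * A * A')"
    unfolding ode[symmetric] by (simp add: algebra_simps power2_eq_square)
  also have "\<dots> = 0"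
    unfolding sq d by (simp add: eval_nat_numeral algebra_simps)
  finally show ?thesis
    by (auto simp: A_def)
qed

lemma geom_family: "geom (family_poly l) = family_poly (to_ac l)" "geom (family_sqrt l) = family_sqrt (to_ac l)"
  by (simp_all add: family_poly_def family_sqrt_def map_poly_pCons)

lemma poly_geom: "poly (geom p) (to_ac x) = to_ac (poly p x)"
  by (induction p) (simp_all add: map_poly_pCons)

lemma geom_mult: "geom (p * q) = geom p * geom q"
proof -
  have "geom (p + q) = geom p + geom q" for p q
    by (rule poly_eqI) (simp add: coeff_map_poly)
  moreover have "geom (smult c p) = smult (to_ac c) (geom p)" for c p
    by (rule poly_eqI) (simp add: coeff_map_poly)
  ultimately show ?thesis
    by (induction p) (simp_all add: map_poly_pCons)
qed

text \<open>Each of the three possibilities for a double root forces it to be rational: 0, -1 or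
  \<open>q\<close> below. They are excluded over the rationals, where the size of \<open>l\<close>
  can be used.\<close>

lemma odd_curve_family:
  assumes "l \<ge> 1000"
  shows "odd_curve 4 (geom (family_poly l))"
proof
  show "Polynomial.degree (geom (family_poly l)) = 2 * 4 + 1"
    unfolding geom_family by (simp add: degree_family_poly)
  fix x assume x: "poly (geom (family_poly l)) x = 0"
  show "poly (pderiv (geom (family_poly l))) x \<noteq> 0"
  proof
    assume dx: "poly (pderiv (geom (family_poly l))) x = 0"
    define L where "L = to_ac l"
    have sq: "poly (family_sqrt L) x ^ 2 = (1 + x) ^ 15"
      using family_identity_at[of L x] x by (simp add: geom_family L_def)
    consider "x = 0" | "x \<noteq> 0" "poly (family_sqrt L) x = 0" | "45045/256 - 12 * L + 3 * L * x = 0"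
      using family_double_root[of L x] x dx unfolding geom_family L_def by blast
    then show False
    proof cases
      case 1
      then have "to_ac (poly (family_poly l) 0) = 0"
        using x poly_geom[of "family_poly l" 0] by simp
      then have "poly (family_poly l) 0 = 0"
        by (simp only: to_ac_eq_0_iff)
      with assms show False
        by (simp add: family_poly_def)
    next
      case 2
      then have "1 + x = 0"
        using sq by simp
      then have "x = to_ac (- 1)"
        by (simp add: eq_neg_iff_add_eq_0 add.commute)
      then have "to_ac (poly (family_sqrt l) (- 1)) = 0"
        using 2 poly_geom[of "family_sqrt l" "- 1"] by (simp add: geom_family L_def)
      then have "poly (family_sqrt l) (- 1) = 0"
        by (simp only: to_ac_eq_0_iff)
      with assms show False
        by (simp add: family_sqrt_def)
    next
      case 3
      \<comment> \<open>The solution of the linear condition; for \<open>l \<ge> 1000\<close> it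
        lies between 3 and 4.\<close>
      define q where "q = 4 - 15015 / (256 * l)"
      have "l \<noteq> 0" "L \<noteq> 0"
        using assms by (auto simp: L_def)
      have "3 * L * x = 3 * L * to_ac q"
      proof -
        have "3 * l * q = 12 * l - 45045/256"
          using \<open>l \<noteq> 0\<close> by (simp add: q_def field_simps)
        then have "to_ac (3 * l * q) = to_ac (12 * l - 45045/256)" by (rule arg_cong)
        then have "3 * L * to_ac q = 12 * L - 45045/256"
          by (simp add: L_def)
        moreover have "3 * L * x = 12 * L - 45045/256"
          using 3 by (simp add: algebra_simps eq_diff_eq)
        ultimately show ?thesis by simp
      qed
      then have "x = to_ac q"
        using \<open>L \<noteq> 0\<close> by simp
      then have "to_ac (poly (family_sqrt l) q ^ 2) = to_ac ((1 + q) ^ 15)"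
        using sq poly_geom[of "family_sqrt l" q] by (simp add: geom_family L_def)
      then have eq: "poly (family_sqrt l) q ^ 2 = (1 + q) ^ 15"
        by (simp only: to_ac_eq_iff)
      have "15015 / (256 * l) \<le> 1" "15015 / (256 * l) \<ge> 0"
        using assms by simp_all
      then have q: "3 \<le> q" "q \<le> 4"
        unfolding q_def by simp_all
      \<comment> \<open>At \<open>q\<close> the left side of the identity is at least
        \<open>(1000 * 3^6)^2\<close>, about \<open>5 * 10^11\<close>, while the right side is at
        most \<open>5^15\<close>, about \<open>3 * 10^10\<close>.\<close>
      have "1000 * 3 ^ 6 \<le> l * q ^ 6"
        using assms q by (intro mult_mono power_mono) auto
      also have "\<dots> \<le> poly (family_sqrt l) q"
        using q by (simp add: family_sqrt_def algebra_simps eval_nat_numeral)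
      finally have "(1000 * 3 ^ 6) ^ 2 \<le> poly (family_sqrt l) q ^ 2"
        by (intro power_mono) auto
      moreover have "(1 + q) ^ 15 \<le> 5 ^ 15"
        using q by (intro power_mono) auto
      ultimately show False
        using eq by simp
    qed
  qed
qed

text \<open>A repeated factor of positive degree has a root in the algebraic closure, which would be
  a multiple root of \<open>f\<close>.\<close>

lemma squarefree_of_odd_curve:
  assumes "odd_curve g (geom f)"
  shows "squarefree f"
proof (rule squarefreeI)
  interpret odd_curve g "geom f" by fact
  fix p assume "p ^ 2 dvd f"
  then obtain k where k: "f = p ^ 2 * k" by (rule dvdE)
  have "f \<noteq> 0"
    using f_nonzero by auto
  then have "p \<noteq> 0"
    using k by auto
  have "Polynomial.degree p = 0"
  proof (rule ccontr)
    assume "Polynomial.degree p \<noteq> 0"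
    then have "Polynomial.degree (geom p) \<noteq> 0"
      by (simp add: degree_map_poly)
    then obtain x where x: "poly (geom p) x = 0"
      using alg_closed_imp_poly_has_root[of "geom p"] by auto
    have "geom f = geom p * (geom p * geom k)"
      unfolding k power2_eq_square geom_mult by (simp add: mult.assoc)
    then have "poly (geom f) x = 0" "poly (pderiv (geom f)) x = 0"
      using x by (simp_all add: pderiv_mult)
    then show False
      using simple_roots by blast
  qed
  then show "p dvd 1"
    using \<open>p \<noteq> 0\<close> by (simp add: is_unit_iff_degree)
qed

lemma hyperelliptic_family: "l \<ge> 1000 \<Longrightarrow> hyperelliptic 4 (family_poly l)"
  using squarefree_of_odd_curve[OF odd_curve_family]
  by (simp add: hyperelliptic_def degree_family_poly)

lemma family_order_15:
  assumes "l \<ge> 1000"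
  shows "\<exists>c\<in>carrier (jacobian_rational_points 4 (family_poly l)).
    group.ord (jacobian_rational_points 4 (family_poly l)) c = 15"
proof -
  interpret rational_odd_curve 4 "family_poly l"
    unfolding rational_odd_curve_def by (rule odd_curve_family) fact
  define L where "L = to_ac l"
  have F: "F = family_poly L"
    by (simp add: geom_family L_def)
  \<comment> \<open>At \<open>x = -1\<close> the factor \<open>- x^3\<close> is 1, so
    \<open>a - x^3 y\<close> vanishes exactly for this choice of sign.\<close>
  define y0 where "y0 = - poly (family_sqrt l) (- 1)"
  define P where "P = Fin (- 1) (to_ac y0)"
  have "y0 \<noteq> 0"
    using assms by (simp add: y0_def family_sqrt_def)
  have a: "poly (family_sqrt L) (- 1) = - to_ac y0"
    using poly_geom[of "family_sqrt l" "- 1"] by (simp add: geom_family L_def y0_def)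
  have "to_ac y0 ^ 2 = poly F (- 1)"
    using family_identity_at[of L "- 1"] by (simp add: F a)
  then have P: "P \<in> points 4 F"
    unfolding P_def Fin_in_points_iff .
  have rational: "galois_point \<sigma> P = P" if "\<sigma> \<in> galois" for \<sigma>
    using galois_simps(3)[OF that] galois_simps(3)[OF that, of "- 1"] by (simp add: P_def)
  \<comment> \<open>Here \<open>e = 7\<close> is the degree 3 of \<open>- x^3\<close> plus the genus
    4.\<close>
  have "frag_cmul (int (2 * 7 + 1)) (frag_of P - frag_of (Inf 0)) \<in> principals"
    unfolding P_def
  proof (rule multiple_principal)
    show "Fin (- 1) (to_ac y0) \<in> points 4 F"
      using P by (simp only: P_def)
    show "family_sqrt L ^ 2 - (- [:0, 0, 0, 1:]) ^ 2 * F = smult 1 ([:- (- 1), 1:] ^ (2 * 7 + 1))"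
      unfolding F power2_minus family_identity by simp
    show "7 = Polynomial.degree (- [:0, 0, 0, 1 :: qbar:]) + 4" "Polynomial.degree (family_sqrt L) \<le> 7"
      by (simp_all add: family_sqrt_def)
    show "poly (family_sqrt L) (- 1) + poly (- [:0, 0, 0, 1:]) (- 1) * to_ac y0 = 0"
      by (simp add: a)
    show "poly (family_sqrt L) (- 1) \<noteq> 0"
      using \<open>y0 \<noteq> 0\<close> by (simp add: a)
  qed simp_all
  moreover have "frag_cmul (int n) (frag_of P - frag_of (Inf 0)) \<notin> principals" if "0 < n" "n \<le> 8" for n
    unfolding P_def using P \<open>y0 \<noteq> 0\<close> that by (intro multiple_not_principal) (simp_all add: P_def)
  from this[of 3] this[of 5]
  have "frag_cmul 3 (frag_of P - frag_of (Inf 0)) \<notin> principals"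
    "frag_cmul 5 (frag_of P - frag_of (Inf 0)) \<notin> principals" by simp_all
  ultimately show ?thesis
    using point_class_order_15[OF P rational] point_class_in_jacobian[OF P rational] by auto
qed

section \<open>Affine equivalences inside the family\<close>

lemma coeff_pcompose_linear:
  fixes p :: "'a::comm_ring_1 poly"
  assumes "Polynomial.degree p \<le> n"
  shows "Polynomial.coeff (pcompose p [:b, a:]) k =
    (\<Sum>i\<le>n. Polynomial.coeff p i * (of_nat (i choose k) * a ^ k * b ^ (i - k)))"
proof -
  have "pcompose p [:b, a:] = (\<Sum>i\<le>n. smult (Polynomial.coeff p i) ([:b, a:] ^ i))"
  proof -
    have "pcompose p [:b, a:] = (\<Sum>i\<le>Polynomial.degree p. smult (Polynomial.coeff p i) ([:b, a:] ^ i))"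
      by (simp add: pcompose_altdef poly_altdef coeff_map_poly degree_map_poly)
    also have "\<dots> = (\<Sum>i\<le>n. smult (Polynomial.coeff p i) ([:b, a:] ^ i))"
      using assms by (intro sum.mono_neutral_left) (auto simp: coeff_eq_0)
    finally show ?thesis .
  qed
  moreover have "Polynomial.coeff ([:b, a:] ^ i) k = of_nat (i choose k) * a ^ k * b ^ (i - k)" for i
  proof (cases "k \<le> i")
    case False
    have "Polynomial.degree ([:b, a:] ^ i) \<le> 1 * i"
      using degree_power_le[of "[:b, a:]" i] by (cases "a = 0") auto
    with False show ?thesis
      by (simp add: coeff_eq_0 binomial_eq_0)
  qed (simp add: coeff_linear_poly_power)
  ultimately show ?thesis
    by (simp add: coeff_sum)
qed

text \<open>The hypotheses compare the coefficients of \<open>x^8\<close>, \<open>x^7\<close> and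
  \<open>x^6\<close>, with the scalar already replaced by \<open>a^9\<close>. The nine roots have
  mean -5/3 by the coefficient -15. An affine map has to fix it, and the coefficient of
  \<open>x^7\<close> then leaves only the identity and the reflection
  \<open>x \<mapsto> - x - 10/3\<close>.\<close>

lemma affine_coefficients:
  fixes a b u v :: "'a::field_char_0"
  assumes "a \<noteq> 0" "a ^ 9 * (- 15) = - (15 * a ^ 8) - 9 * a ^ 8 * b"
    and "a ^ 9 * (- 105) = - (105 * a ^ 7) - 15 * (8 * a ^ 7 * b) - 36 * a ^ 7 * b ^ 2"
    and "a ^ 9 * u = v * a ^ 6 - 105 * (7 * a ^ 6 * b) - 15 * (28 * a ^ 6 * b ^ 2) - 84 * a ^ 6 * b ^ 3"
  shows "a = 1 \<and> b = 0 \<and> u = v \<or> a = - 1 \<and> b = - (10 / 3) \<and> u + v = - (8050 / 9)"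
proof -
  have "a ^ 8 * (15 * a) = a ^ 8 * (15 + 9 * b)"
    using assms(2) by Groebner_Basis.algebra
  then have 1: "15 * a = 15 + 9 * b"
    using assms(1) by simp
  have "a ^ 7 * (105 * a ^ 2) = a ^ 7 * (105 + 120 * b + 36 * b ^ 2)"
    using assms(3) by Groebner_Basis.algebra
  then have 2: "105 * a ^ 2 = 105 + 120 * b + 36 * b ^ 2"
    using assms(1) by simp
  have "a ^ 6 * (a ^ 3 * u) = a ^ 6 * (v - 735 * b - 420 * b ^ 2 - 84 * b ^ 3)"
    using assms(4) by Groebner_Basis.algebra
  then have 3: "a ^ 3 * u = v - 735 * b - 420 * b ^ 2 - 84 * b ^ 3"
    by (rule mult_left_cancel[THEN iffD1, rotated]) (use assms(1) in simp)
  \<comment> \<open>Squaring the first relation eliminates \<open>a\<close>: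
    \<open>105 (1 + 3 b / 5)^2 = 105 + 120 b + 36 b^2\<close>.\<close>
  have "b * (3 * b + 10) = 0"
    using 1 2 by Groebner_Basis.algebra
  then consider "b = 0" | "3 * b = - 10"
    by (auto simp: eq_neg_iff_add_eq_0)
  then show ?thesis
  proof cases
    case 1
    then show ?thesis
      using \<open>15 * a = 15 + 9 * b\<close> 3 by simp
  next
    case 2
    then have b: "b = - (10 / 3)"
      by (simp add: field_simps)
    then have "a = - 1"
      using 1 by simp
    moreover have "- u = v + 8050 / 9"
      using 3 unfolding b calculation by (simp add: power2_eq_square power3_eq_cube field_simps)
    then have "u + v = - (8050 / 9)"
      by (auto simp: minus_equation_iff[of u])
    ultimately show ?thesis
      using b by simp
  qed
qed

text \<open>The coefficients of \<open>x^9\<close>, \<open>x^8\<close> and \<open>x^7\<close> are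
  the same for the whole family and pin down the substitution; the coefficient
  \<open>l^2 - 455\<close> of \<open>x^6\<close> then tells the parameters apart.\<close>

lemma family_affine_imp_eq:
  assumes l: "l \<ge> 1000" and m: "m \<ge> 1000"
    and eq: "smult \<gamma> (geom (family_poly l)) = pcompose (geom (family_poly m)) [:\<beta>, \<alpha>:]" and "\<alpha> \<noteq> 0"
  shows "l = m"
proof -
  define L M where "L = to_ac l" and "M = to_ac m"
  have co: "\<gamma> * Polynomial.coeff (family_poly L) k =
      (\<Sum>i\<le>9. Polynomial.coeff (family_poly M) i * (of_nat (i choose k) * \<alpha> ^ k * \<beta> ^ (i - k)))" for k
    using arg_cong[OF eq, of "\<lambda>p. Polynomial.coeff p k"]
    by (simp add: geom_family coeff_pcompose_linear[of _ 9] degree_family_poly flip: L_def M_def)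
  have fc: "Polynomial.coeff (family_poly M) 9 = - 1" "Polynomial.coeff (family_poly M) 8 = - 15"
    "Polynomial.coeff (family_poly M) 7 = - 105" "Polynomial.coeff (family_poly M) 6 = M ^ 2 - 455" for M :: qbar
    by (simp_all add: family_poly_def eval_nat_numeral)
  have s: "(\<Sum>i\<le>9. h i) = (\<Sum>i\<le>5. h i) + h 6 + h 7 + h 8 + h 9" for h :: "nat \<Rightarrow> qbar"
    by (simp add: eval_nat_numeral)
  have low: "(\<Sum>i\<le>5. Polynomial.coeff (family_poly M) i * (of_nat (i choose k) * \<alpha> ^ k * \<beta> ^ (i - k))) = 0"
    if "k > 5" for k
    using that by (intro sum.neutral) auto
  have ch: "(9::nat) choose 8 = 9" "(9::nat) choose 7 = 36" "(9::nat) choose 6 = 84"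
    "(8::nat) choose 7 = 8" "(8::nat) choose 6 = 28" "(7::nat) choose 6 = 7"
    by (simp_all add: eval_nat_numeral)
  have co': "\<gamma> * Polynomial.coeff (family_poly L) k = (\<Sum>i\<in>{6,7,8,9}. Polynomial.coeff (family_poly M) i *
      (of_nat (i choose k) * \<alpha> ^ k * \<beta> ^ (i - k)))" if "k > 5" for k
    unfolding co s low[OF that] by simp
  have 9: "\<gamma> = \<alpha> ^ 9"
    using co'[of 9] by (simp add: fc binomial_eq_0)
  have "\<alpha> ^ 9 * (- 15) = - (15 * \<alpha> ^ 8) - 9 * \<alpha> ^ 8 * \<beta>"
    using co'[of 8] unfolding 9 by (simp add: fc ch binomial_eq_0)
  moreover have "\<alpha> ^ 9 * (- 105) = - (105 * \<alpha> ^ 7) - 15 * (8 * \<alpha> ^ 7 * \<beta>) - 36 * \<alpha> ^ 7 * \<beta> ^ 2"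
    using co'[of 7] unfolding 9 by (simp add: fc ch binomial_eq_0)
  moreover have "\<alpha> ^ 9 * (L ^ 2 - 455) = (M ^ 2 - 455) * \<alpha> ^ 6 - 105 * (7 * \<alpha> ^ 6 * \<beta>) -
      15 * (28 * \<alpha> ^ 6 * \<beta> ^ 2) - 84 * \<alpha> ^ 6 * \<beta> ^ 3"
    using co'[of 6] unfolding 9 by (simp add: fc ch binomial_eq_0)
  ultimately consider "L ^ 2 - 455 = M ^ 2 - 455" | "L ^ 2 - 455 + (M ^ 2 - 455) = - (8050 / 9)"
    using affine_coefficients[OF \<open>\<alpha> \<noteq> 0\<close>] by blast
  then show ?thesis
  proof cases
    case 1
    then have "to_ac (l ^ 2) = to_ac (m ^ 2)"
      by (simp add: L_def M_def)
    then have "l ^ 2 = m ^ 2"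
      by (simp only: to_ac_eq_iff)
    then show ?thesis
      using l m by (simp add: power2_eq_iff)
  next
    case 2
    \<comment> \<open>The reflection would need \<open>l^2 + m^2 = 140/9\<close>, too small for the
      parameters.\<close>
    then have "to_ac (l ^ 2 - 455 + (m ^ 2 - 455)) = to_ac (- (8050 / 9))"
      by (simp add: L_def M_def)
    then have "l ^ 2 - 455 + (m ^ 2 - 455) = - (8050 / 9)"
      by (simp only: to_ac_eq_iff)
    moreover have "1000 ^ 2 \<le> l ^ 2" "0 \<le> m ^ 2"
      using power_mono[of 1000 l 2] l by simp_all
    ultimately show ?thesis by simp
  qed
qed

section \<open>Finiteness of isomorphism classes and selection of an infinite subfamily\<close>

definition curves_isomorphic :: "nat \<Rightarrow> qbar poly \<Rightarrow> qbar poly \<Rightarrow> bool" where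
  "curves_isomorphic g f1 f2 \<longleftrightarrow> (\<exists>\<phi> \<psi>. curve_map g f1 f2 \<phi> \<psi>)"

lemma curves_isomorphic_sym: "curves_isomorphic g f1 f2 \<Longrightarrow> curves_isomorphic g f2 f1"
  unfolding curves_isomorphic_def using curve_map_inverse by blast

lemma isomorphic_over_Q_imp_curves_isomorphic:
  assumes "isomorphic_over_Q g f1 f2" "odd_curve g (geom f1)" "odd_curve g (geom f2)"
  shows "curves_isomorphic g (geom f1) (geom f2)"
proof -
  let ?A = "points g (geom f1)" and ?B = "points g (geom f2)"
  obtain \<phi> where \<phi>: "bij_betw \<phi> ?A ?B" "pulls_back g (geom f1) (geom f2) \<phi>"
      "pulls_back g (geom f2) (geom f1) (inv_into ?A \<phi>)"
    using assms(1) unfolding isomorphic_over_Q_def by blast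
  have "curve_map g (geom f1) (geom f2) \<phi> (inv_into ?A \<phi>)"
    unfolding curve_map_def curve_map_axioms_def
    using assms \<phi> bij_betwE[OF \<phi>(1)] bij_betwE[OF bij_betw_inv_into[OF \<phi>(1)]]
      bij_betw_inv_into_left[OF \<phi>(1)] bij_betw_inv_into_right[OF \<phi>(1)] by blast
  then show ?thesis
    unfolding curves_isomorphic_def by blast
qed

lemma (in odd_curve) finite_weierstrass: "finite {P \<in> points g f. P = Inf 0 \<or> py P = 0}"
proof -
  have "{P \<in> points g f. P = Inf 0 \<or> py P = 0} \<subseteq> {P \<in> points g f. P = Inf 0 \<or> px P \<in> {a. poly f a = 0}}"
  proof
    fix P assume "P \<in> {P \<in> points g f. P = Inf 0 \<or> py P = 0}"
    then show "P \<in> {P \<in> points g f. P = Inf 0 \<or> px P \<in> {a. poly f a = 0}}"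
      by (cases P) auto
  qed
  then show ?thesis
    using finite_points_over[OF poly_roots_finite[OF f_nonzero]] finite_subset by blast
qed

lemma finitely_many_isomorphic:
  assumes curve: "odd_curve g f0" and g: "g \<ge> 2"
    and rigid: "\<And>i j \<alpha> \<beta> \<gamma>. i \<in> I \<Longrightarrow> j \<in> I \<Longrightarrow> \<alpha> \<noteq> 0 \<Longrightarrow>
      smult \<gamma> (f i) = pcompose (f j) [:\<beta>, \<alpha>:] \<Longrightarrow> i = j"
  shows "finite {i \<in> I. curves_isomorphic g f0 (f i)}"
proof (rule ccontr)
  let ?J = "{i \<in> I. curves_isomorphic g f0 (f i)}"
  assume inf: "infinite ?J"
  have "\<forall>i\<in>?J. \<exists>\<phi> \<psi>. curve_map g f0 (f i) \<phi> \<psi>"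
    unfolding curves_isomorphic_def by blast
  then obtain \<phi> \<psi> where map: "\<And>i. i \<in> ?J \<Longrightarrow> curve_map g f0 (f i) (\<phi> i) (\<psi> i)"
    by metis
  let ?W = "{P \<in> points g f0. P = Inf 0 \<or> py P = 0}"
  have "(\<lambda>i. \<psi> i (Inf 0)) ` ?J \<subseteq> ?W"
  proof
    fix P assume "P \<in> (\<lambda>i. \<psi> i (Inf 0)) ` ?J"
    then obtain i where i: "i \<in> ?J" "P = \<psi> i (Inf 0)" by blast
    interpret curve_map g f0 "f i" "\<phi> i" "\<psi> i"
      by (rule map) fact
    show "P \<in> ?W"
      using base(1) base_weierstrass[OF g] i(2) unfolding base_def by simp
  qed
  then have "finite ((\<lambda>i. \<psi> i (Inf 0)) ` ?J)"
    using odd_curve.finite_weierstrass[OF curve] finite_subset by blast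
  then have "\<not> inj_on (\<lambda>i. \<psi> i (Inf 0)) ?J"
    using inf finite_imageD by blast
  then obtain i j where ij: "i \<in> ?J" "j \<in> ?J" "i \<noteq> j" "\<psi> i (Inf 0) = \<psi> j (Inf 0)"
    unfolding inj_on_def by blast
  interpret I: curve_map g f0 "f i" "\<phi> i" "\<psi> i"
    by (rule map) fact
  \<comment> \<open>Going back from curve i to the common source and on to curve j sends infinity to
    infinity, since both maps have the same preimage of infinity.\<close>
  interpret IJ: curve_map g "f i" "f j" "\<lambda>P. \<phi> j (\<psi> i P)" "\<lambda>P. \<phi> i (\<psi> j P)"
    by (rule curve_map_compose[OF curve_map_inverse[OF map[OF ij(1)]] map[OF ij(2)]])
  have "IJ.base = Inf 0"
    unfolding IJ.base_def ij(4)[symmetric] using I.base(2) unfolding I.base_def .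
  then obtain \<alpha> \<beta> \<gamma> where "\<alpha> \<noteq> 0" "smult \<gamma> (f i) = pcompose (f j) [:\<beta>, \<alpha>:]"
    using IJ.base_infinity_imp_affine g by (metis le_trans one_le_numeral)
  then show False
    using rigid ij by blast
qed

text \<open>Colour each pair by whether it is related; symmetry makes the colour depend on the
  unordered pair only. An infinite set with all pairs related would give one element infinitely many
  related ones.\<close>

lemma infinite_independent_subset:
  fixes R :: "nat \<Rightarrow> nat \<Rightarrow> bool"
  assumes sym: "\<And>i j. R i j \<Longrightarrow> R j i" and fin: "\<And>i. finite {j. R i j}"
  obtains Y where "infinite Y" "\<And>i j. i \<in> Y \<Longrightarrow> j \<in> Y \<Longrightarrow> i \<noteq> j \<Longrightarrow> \<not> R i j"
proof -
  define c where "c A = (if \<exists>i\<in>A. \<exists>j\<in>A. i \<noteq> j \<and> R i j then 1 else (0::nat))" for A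
  have "\<forall>i\<in>UNIV. \<forall>j\<in>UNIV. i \<noteq> j \<longrightarrow> c {i, j} < 2"
    by (simp add: c_def)
  then obtain Y t where Y: "infinite Y" "\<forall>i\<in>Y. \<forall>j\<in>Y. i \<noteq> j \<longrightarrow> c {i, j} = t"
    using Ramsey2[OF infinite_UNIV_nat, of c 2] by blast
  have iff: "R i j \<longleftrightarrow> t = 1" if "i \<in> Y" "j \<in> Y" "i \<noteq> j" for i j
    using Y(2) that sym unfolding c_def by (auto split: if_splits)
  obtain i where "i \<in> Y"
    using Y(1) by (metis all_not_in_conv finite.emptyI)
  have "t \<noteq> 1"
  proof
    assume "t = 1"
    then have "Y - {i} \<subseteq> {j. R i j}"
      using iff[OF \<open>i \<in> Y\<close>] by blast
    then have "finite (Y - {i})"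
      using fin[of i] by (rule finite_subset)
    then show False
      using Y(1) by simp
  qed
  then show ?thesis
    using that[OF Y(1)] iff by blast
qed

theorem theorem4p2:
  shows "\<exists>S :: rat poly set. infinite S \<and>
    (\<forall>f\<in>S. hyperelliptic 4 f \<and>
       (\<exists>c\<in>carrier (jacobian_rational_points 4 f).
          group.ord (jacobian_rational_points 4 f) c = 15)) \<and>
    pairwise (\<lambda>f1 f2. \<not> isomorphic_over_Q 4 f1 f2) S"
proof -
  \<comment> \<open>The shift by 1000 brings every index into the range where the curves are known
    to be smooth and the parameters positive.\<close>
  define f :: "nat \<Rightarrow> rat poly" where "f n = family_poly (of_nat n + 1000)" for n
  have large: "(of_nat n + 1000 :: rat) \<ge> 1000" for n :: nat
    by simp
  have curve: "odd_curve 4 (geom (f n))" for n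
    unfolding f_def by (rule odd_curve_family[OF large])
  have rigid: "i = j" if "\<alpha> \<noteq> 0" "smult \<gamma> (geom (f i)) = pcompose (geom (f j)) [:\<beta>, \<alpha>:]" for i j \<alpha> \<beta> \<gamma>
    using family_affine_imp_eq[OF large large that(2)[unfolded f_def] that(1)] by simp
  define R where "R i j \<longleftrightarrow> curves_isomorphic 4 (geom (f i)) (geom (f j))" for i j
  have "finite {j \<in> UNIV. curves_isomorphic 4 (geom (f i)) (geom (f j))}" for i
    by (rule finitely_many_isomorphic[OF curve]) (use rigid in auto)
  then obtain Y where Y: "infinite Y" "\<And>i j. i \<in> Y \<Longrightarrow> j \<in> Y \<Longrightarrow> i \<noteq> j \<Longrightarrow> \<not> R i j"
    using infinite_independent_subset[of R] curves_isomorphic_sym unfolding R_def by auto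
  have "inj f"
  proof (rule injI)
    fix i j assume "f i = f j"
    \<comment> \<open>Equal polynomials are related by the identity substitution, so rigidity also
      yields injectivity.\<close>
    then show "i = j"
      using rigid[of 1 1 i j 0] by simp
  qed
  then have "infinite (f ` Y)"
    using Y(1) finite_imageD inj_on_subset by blast
  moreover have "pairwise (\<lambda>f1 f2. \<not> isomorphic_over_Q 4 f1 f2) (f ` Y)"
    using Y(2) isomorphic_over_Q_imp_curves_isomorphic[OF _ curve curve]
    unfolding pairwise_def R_def by blast
  moreover have "hyperelliptic 4 (f n) \<and> (\<exists>c\<in>carrier (jacobian_rational_points 4 (f n)).
      group.ord (jacobian_rational_points 4 (f n)) c = 15)" for n
    unfolding f_def using hyperelliptic_family[OF large] family_order_15[OF large] by blast
  ultimately show ?thesis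
    by (intro exI[of _ "f ` Y"]) blast
qed

end
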